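(* Let $m\ge1$ and $d\ge 2$ be integers and let $\varepsilon>0$ be a fixed real number. There exists $\delta>0$, depending only on $d$, $m$ and $\varepsilon$, such that the following holds. Let $p$ be a prime, let $S$ be a matrix as in the context with $s_{0,1}s_{1,2}\cdots s_{m-1,m}\ne0$, let $\mathcal F=\{F_0,\ldots,F_m\}\in\mathfrak F(S,m)$ be a polynomial system over $\mathbb F_p$ of total degree $d$, and let $\mathbf w_n=(u_{n,0},\ldots,u_{n,m})$, $n\ge0$, be the sequence generated by iterating $\mathcal F$ from an initial vector $\mathbf w_0\in\mathbb F_p^{m+1}$. Assume that $\{\mathbf w_n\}$ is purely periodic with (least) period $\tau$. Then for any positive integer $N$ with $\tau\ge N\ge p^{m+\varepsilon}$ and any nonzero vector $\mathbf b=(b_0,\ldots,b_m)\in\mathbb F_p^{m+1}$, $$\left|\sum_{n=0}^{N-1}\mathbf e_p\Big(\sum_{i=0}^{m}b_iu_{n,i}\Big)\right|\ll Np^{-\delta},$$ where the implied constant depends only on $d$, $m$ and $\varepsilon$.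
   Context: $\mathbf e_p(z)=\exp(2\pi i z/p)$. The field $\mathbb F_p$ is represented by $\{0,1,\ldots,p-1\}$, so its elements are also regarded as integers. $A\ll B$ means $|A|\le cB$ for some constant $c>0$. $S$ is an integral upper triangular $(m+1)\times(m+1)$ matrix, rows and columns indexed by $0,\ldots,m$, with ones on the diagonal and entries $s_{i,j}$ for $0\le i<j\le m$ (used as exponents, hence non-negative). $\mathfrak F(S,m)$ is the set of all systems $\{F_0,\ldots,F_m\}$ of polynomials in $\mathbb F_p[X_0,\ldots,X_m]$ of the form $$F_i=X_iG_i(X_{i+1},\ldots,X_m)+H_i(X_{i+1},\ldots,X_m)\quad (0\le i\le m-1),\qquad F_m=g_mX_m+h_m,$$ with $g_m,h_m\in\mathbb F_p$, $g_m\ne0$, $G_i,H_i\in\mathbb F_p[X_{i+1},\ldots,X_m]$, where for $0\le i\le m-1$ $$G_i=g_iX_{i+1}^{s_{i,i+1}}\cdots X_m^{s_{i,m}}+\widetilde G_i,\qquad g_i\in\mathbb F_p^*,$$ and $\deg_{X_j}\widetilde G_i<s_{i,j}$, $\deg_{X_j}H_i\le s_{i,j}$ for $j=i+1,\ldots,m$ (the zero polynomial has degree $-\infty$). The sequence generated by iterating $\mathcal F$: $u_{n+1,i}\equiv F_i(u_{n,0},\ldots,u_{n,m})\pmod p$ with $0\le u_{n,i}<p$, for $i=0,\ldots,m$, $n\ge0$. Purely periodic with period $\tau$ means $\mathbf w_{n+\tau}=\mathbf w_n$ for all $n\ge0$, with $\tau$ the least such positive integer. *)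

theory Defs
  imports Complex_Main "HOL-Library.Poly_Mapping" "HOL-Library.Extended_Real"
    "HOL-Library.FuncSet" "HOL-Number_Theory.Cong"
begin

text \<open>
  A monomial is an exponent vector \<open>nat \<Rightarrow>\<^sub>0 nat\<close>, and a polynomial is an element of the monoid
  algebra over the integers. The field with \<open>p\<close> elements is represented by the integers
  \<open>{0..<p}\<close>, since \<open>p\<close> varies inside the theorem and so cannot be part of a type: a polynomial
  over that field is an integer polynomial with coefficients in \<open>{0..<p}\<close>, and an identity between
  polynomials over the field is a coefficientwise congruence modulo \<open>p\<close>.
\<close>

type_synonym mpoly = "(nat \<Rightarrow>\<^sub>0 nat) \<Rightarrow>\<^sub>0 int"

definition Const :: "int \<Rightarrow> mpoly" where
  "Const c = Poly_Mapping.single 0 c"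

definition Var :: "nat \<Rightarrow> mpoly" where
  "Var j = Poly_Mapping.single (Poly_Mapping.single j 1) 1"

definition mpoly_eval :: "mpoly \<Rightarrow> (nat \<Rightarrow> int) \<Rightarrow> int" where
  "mpoly_eval F x =
     (\<Sum>t\<in>Poly_Mapping.keys F. Poly_Mapping.lookup F t *
        (\<Prod>j\<in>Poly_Mapping.keys t. x j ^ Poly_Mapping.lookup t j))"

definition mpoly_cong :: "nat \<Rightarrow> mpoly \<Rightarrow> mpoly \<Rightarrow> bool" where
  "mpoly_cong p F G \<longleftrightarrow>
     (\<forall>t. [Poly_Mapping.lookup F t = Poly_Mapping.lookup G t] (mod int p))"

definition Fp :: "nat \<Rightarrow> int set" where
  "Fp p = {0..<int p}"

definition Fp_mpolys :: "nat \<Rightarrow> nat set \<Rightarrow> mpoly set" where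
  "Fp_mpolys p V =
     {F. (\<forall>t. Poly_Mapping.lookup F t \<in> Fp p) \<and>
         (\<forall>t\<in>Poly_Mapping.keys F. Poly_Mapping.keys t \<subseteq> V)}"

text \<open>Degrees live in \<^typ>\<open>ereal\<close>, where the supremum of the empty set is \<open>- \<infinity>\<close>, the degree of zero.\<close>

definition deg_in :: "nat \<Rightarrow> mpoly \<Rightarrow> ereal" where
  "deg_in j F = (SUP t\<in>Poly_Mapping.keys F. ereal (real (Poly_Mapping.lookup t j)))"

definition total_deg :: "mpoly \<Rightarrow> ereal" where
  "total_deg F =
     (SUP t\<in>Poly_Mapping.keys F.
        ereal (real (\<Sum>j\<in>Poly_Mapping.keys t. Poly_Mapping.lookup t j)))"

definition system_deg :: "nat \<Rightarrow> (nat \<Rightarrow> mpoly) \<Rightarrow> ereal" where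
  "system_deg m F = Max ((\<lambda>i. total_deg (F i)) ` {0..m})"

text \<open>Only the entries with indices in \<open>{0..m}\<close> are meaningful.\<close>

definition exponent_matrix :: "nat \<Rightarrow> (nat \<Rightarrow> nat \<Rightarrow> nat) \<Rightarrow> bool" where
  "exponent_matrix m S \<longleftrightarrow>
     (\<forall>i\<le>m. S i i = 1) \<and> (\<forall>i\<le>m. \<forall>j<i. S i j = 0)"

definition poly_systems :: "nat \<Rightarrow> (nat \<Rightarrow> nat \<Rightarrow> nat) \<Rightarrow> nat \<Rightarrow> (nat \<Rightarrow> mpoly) set" where
  "poly_systems p S m =
     {F. (\<forall>i\<le>m. F i \<in> Fp_mpolys p {0..m}) \<and>
         (\<forall>i<m. \<exists>G\<in>Fp_mpolys p {i+1..m}. \<exists>H\<in>Fp_mpolys p {i+1..m}.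
            mpoly_cong p (F i) (Var i * G + H) \<and>
            (\<exists>g\<in>Fp p. \<exists>Gt\<in>Fp_mpolys p {i+1..m}.
               g \<noteq> 0 \<and>
               mpoly_cong p G (Const g * (\<Prod>j\<in>{i+1..m}. Var j ^ S i j) + Gt) \<and>
               (\<forall>j\<in>{i+1..m}. deg_in j Gt < ereal (real (S i j)))) \<and>
            (\<forall>j\<in>{i+1..m}. deg_in j H \<le> ereal (real (S i j)))) \<and>
         (\<exists>g\<in>Fp p. \<exists>h\<in>Fp p. g \<noteq> 0 \<and> mpoly_cong p (F m) (Const g * Var m + Const h))}"

text \<open>
  Vectors over the field are extensional functions on \<open>{0..m}\<close>, so that equality of
  vectors is equality of functions.
\<close>

definition Fp_vecs :: "nat \<Rightarrow> nat \<Rightarrow> (nat \<Rightarrow> int) set" where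
  "Fp_vecs p m = {0..m} \<rightarrow>\<^sub>E Fp p"

primrec orbit :: "nat \<Rightarrow> nat \<Rightarrow> (nat \<Rightarrow> mpoly) \<Rightarrow> (nat \<Rightarrow> int) \<Rightarrow> nat \<Rightarrow> nat \<Rightarrow> int" where
  "orbit p m F w0 0 = w0"
| "orbit p m F w0 (Suc n) = (\<lambda>i\<in>{0..m}. mpoly_eval (F i) (orbit p m F w0 n) mod int p)"

definition purely_periodic :: "(nat \<Rightarrow> 'a) \<Rightarrow> nat \<Rightarrow> bool" where
  "purely_periodic w \<tau> \<longleftrightarrow>
     0 < \<tau> \<and> (\<forall>n. w (n + \<tau>) = w n) \<and>
     (\<forall>t. 0 < t \<and> (\<forall>n. w (n + t) = w n) \<longrightarrow> \<tau> \<le> t)"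

definition e_mod :: "nat \<Rightarrow> int \<Rightarrow> complex" where
  "e_mod p z = exp (2 * of_real pi * \<i> * of_int z / of_nat p)"

end

theory Submission
  imports Defs "HOL-Analysis.Convex" "HOL-Computational_Algebra.Polynomial"
begin

text \<open>
  Let \<open>r\<close> be the least index with \<open>b r \<noteq> 0\<close>. The proof splits according to whether \<open>r < m\<close>.

  \<^emph>\<open>The case \<open>r < m\<close>.\<close> The sum is compared with its translates by \<open>k < K\<close>, where \<open>K\<close> is a small
  power of \<open>p\<close>, and Hoelder's inequality with a large even exponent \<open>2\<nu>\<close> replaces the sum over the
  orbit by a sum over all vectors; this is legitimate because the points of the orbit within one
  period are distinct. Expanding the power leaves complete sums whose phase is a combination of
  at most \<open>2\<nu>\<close> iterates. The iterates are \<open>F\<^sub>i\<^sup>(\<^sup>k\<^sup>) = X\<^sub>i G\<^sub>i\<^sub>,\<^sub>k + H\<^sub>i\<^sub>,\<^sub>k\<close> with \<open>G\<^sub>i\<^sub>,\<^sub>k\<close> and \<open>H\<^sub>i\<^sub>,\<^sub>k\<close>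
  free of \<open>X\<^sub>0, \<dots>, X\<^sub>i\<close> (lemma \<open>orbit_affine\<close>), so the phase is linear in \<open>X\<^sub>r\<close> and the sum over
  \<open>X\<^sub>r\<close> vanishes unless a combination of the \<open>G\<^sub>r\<^sub>,\<^sub>k\<close> does. The leading monomial of \<open>G\<^sub>r\<^sub>,\<^sub>k\<close> contains
  \<open>X\<^sub>r\<^sub>+\<^sub>1\<close> to the power \<open>k s\<^sub>r\<^sub>,\<^sub>r\<^sub>+\<^sub>1\<close>, which grows strictly with \<open>k\<close>; hence a combination that is not
  formally trivial is a nonzero polynomial. Its degree is polynomial in \<open>K\<close> because the exponent
  matrix is unipotent, so it has few zeros (\<open>schwartz_zippel\<close>), and the trivial combinations are the
  diagonal ones (\<open>moment_bound\<close>).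

  \<^emph>\<open>The case \<open>r = m\<close>.\<close> Only the last coordinate enters. It follows the affine recursion
  \<open>u \<mapsto> g u + h\<close>, so it carries no degree growth. The orbit is long compared with \<open>p\<^sup>m\<close>, so this
  coordinate takes at least \<open>p\<^sup>\<epsilon>\<close> values, and the sum over one period is either a vanishing sum over
  an arithmetic progression or a sum over a coset of a multiplicative subgroup \<open>H\<close> with
  \<open>|H| \<ge> p\<^sup>\<epsilon>\<close>. What is needed then is the theorem of Bourgain, Glibichuk and Konyagin, which is
  proved here as \<open>subgroup_char_sum_bound\<close>.

  \<^emph>\<open>Sums over subgroups.\<close> Suppose that the sum over \<open>H\<close> is large at some nonzero frequency, and let
  \<open>\<Lambda>\<close> be the set of frequencies where it is at least \<open>|H| p\<^sup>-\<^sup>\<eta>\<close>. This set is invariant under \<open>H\<close>, has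
  at least \<open>|H|\<close> elements, and by Parseval not many more than \<open>p / |H|\<close>. Of the differences of
  elements of \<open>\<Lambda>\<close> a proportion of at least \<open>p\<^sup>-\<^sup>3\<^sup>\<eta>\<close> lies in the set defined in the same way with \<open>3\<eta>\<close> in
  place of \<open>\<eta>\<close>, and a pigeonhole argument over the scales \<open>3\<^sup>i\<eta>\<close> makes the two sets almost equally
  large. The theorem of Balog, Szemeredi and Gowers yields a subset \<open>A\<close> of \<open>\<Lambda>\<close> of nearly full size
  with small difference set \<open>P = A - A\<close>, and invariance yields many \<open>h \<in> H\<close> for which \<open>h P\<close> is covered
  by few translates of \<open>P\<close>. This covering property passes to sums and products of multipliers, with
  slightly worse constants. Starting from at least \<open>p\<^sup>\<epsilon>\<^sup>/\<^sup>2\<close> such multipliers, boundedly many ring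
  operations produce the numerators and denominators of a set of quotients equal to the whole
  field (\<open>pivot_iterate\<close>). So \<open>A + \<xi> A\<close> is hardly larger than \<open>A\<close> for every \<open>\<xi>\<close>, which contradicts
  the average size of these sets (\<open>dilate_expansion\<close>).
\<close>

section \<open>Sumsets and difference sets\<close>

definition sumset :: "'a::ab_group_add set \<Rightarrow> 'a set \<Rightarrow> 'a set" (infixl "\<oplus>" 65) where
  "A \<oplus> B = (\<lambda>(a, b). a + b) ` (A \<times> B)"

definition diffset :: "'a::ab_group_add set \<Rightarrow> 'a set \<Rightarrow> 'a set" (infixl "\<ominus>" 65) where
  "A \<ominus> B = (\<lambda>(a, b). a - b) ` (A \<times> B)"

lemma finite_sumset [simp]: "finite A \<Longrightarrow> finite B \<Longrightarrow> finite (A \<oplus> B)"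
  by (simp add: sumset_def)

lemma finite_diffset [simp]: "finite A \<Longrightarrow> finite B \<Longrightarrow> finite (A \<ominus> B)"
  by (simp add: diffset_def)

lemma sumsetI [intro]: "a \<in> A \<Longrightarrow> b \<in> B \<Longrightarrow> a + b \<in> A \<oplus> B"
  by (auto simp: sumset_def)

lemma diffsetI [intro]: "a \<in> A \<Longrightarrow> b \<in> B \<Longrightarrow> a - b \<in> A \<ominus> B"
  by (auto simp: diffset_def)

lemma sumsetE [elim]: "x \<in> A \<oplus> B \<Longrightarrow> (\<And>a b. x = a + b \<Longrightarrow> a \<in> A \<Longrightarrow> b \<in> B \<Longrightarrow> P) \<Longrightarrow> P"
  by (auto simp: sumset_def)

lemma diffsetE [elim]: "x \<in> A \<ominus> B \<Longrightarrow> (\<And>a b. x = a - b \<Longrightarrow> a \<in> A \<Longrightarrow> b \<in> B \<Longrightarrow> P) \<Longrightarrow> P"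
  by (auto simp: diffset_def)

lemma sumset_mono: "A \<subseteq> A' \<Longrightarrow> B \<subseteq> B' \<Longrightarrow> A \<oplus> B \<subseteq> A' \<oplus> B'"
  by (auto simp: sumset_def)

lemma diffset_mono: "A \<subseteq> A' \<Longrightarrow> B \<subseteq> B' \<Longrightarrow> A \<ominus> B \<subseteq> A' \<ominus> B'"
  by (auto simp: diffset_def)

lemma sumset_assoc: "A \<oplus> B \<oplus> C = A \<oplus> (B \<oplus> C)"
  apply (auto simp: sumset_def image_iff)
   apply (metis add.assoc)
  by (metis add.assoc)

lemma sumset_commute: "A \<oplus> B = B \<oplus> A"
  by (auto simp: sumset_def image_iff) (metis add.commute)+

lemma card_sumset_le: "finite A \<Longrightarrow> finite B \<Longrightarrow> card (A \<oplus> B) \<le> card A * card B"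
  unfolding sumset_def by (metis card_cartesian_product card_image_le finite_cartesian_product)

lemma sumset_empty [simp]: "{} \<oplus> B = {}" "A \<oplus> {} = {}"
  by (auto simp: sumset_def)

section \<open>The inequalities of Ruzsa and Petridis\<close>

text \<open>
  Every \<open>d \<in> A \<ominus> C\<close> is \<open>a - c\<close> for a chosen pair, and \<open>d = (a - b) + (b - c)\<close> recovers \<open>d\<close> and then \<open>b\<close>
  from the two differences on the right.
\<close>

lemma ruzsa_triangle:
  assumes "finite A" "finite B" "finite C"
  shows "card B * card (A \<ominus> C) \<le> card (A \<ominus> B) * card (B \<ominus> C)"
proof -
  have "\<forall>d\<in>A \<ominus> C. \<exists>a c. a \<in> A \<and> c \<in> C \<and> d = a - c" by blast
  then obtain f g where fg: "\<And>d. d \<in> A \<ominus> C \<Longrightarrow> f d \<in> A \<and> g d \<in> C \<and> d = f d - g d"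
    by metis
  let ?\<phi> = "\<lambda>(b, d). (f d - b, b - g d)"
  have "inj_on ?\<phi> (B \<times> (A \<ominus> C))"
  proof (rule inj_onI, clarify)
    fix b d b' d' assume *: "b \<in> B" "d \<in> A \<ominus> C" "b' \<in> B" "d' \<in> A \<ominus> C"
      "f d - b = f d' - b'" "b - g d = b' - g d'"
    have "d = (f d - b) + (b - g d)" using fg[OF *(2)] by simp
    also have "\<dots> = (f d' - b') + (b' - g d')" using * by simp
    also have "\<dots> = d'" using fg[OF *(4)] by simp
    finally show "b = b' \<and> d = d'" using * by simp
  qed
  moreover have "?\<phi> ` (B \<times> (A \<ominus> C)) \<subseteq> (A \<ominus> B) \<times> (B \<ominus> C)"
    using fg by auto
  ultimately have "card (B \<times> (A \<ominus> C)) \<le> card ((A \<ominus> B) \<times> (B \<ominus> C))"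
    by (rule card_inj_on_le) (use assms in auto)
  then show ?thesis by (simp add: card_cartesian_product)
qed

text \<open>
  A maximal set of disjoint translates of \<open>A\<close> by elements of \<open>B\<close> gives \<open>X\<close>: any further translate by an
  element of \<open>B\<close> meets one of them, and two translates that meet differ by an element of \<open>A \<ominus> A\<close>.
\<close>

lemma ruzsa_covering:
  assumes "finite A" "A \<noteq> {}" "finite B"
  obtains X where "X \<subseteq> B" "card X * card A \<le> card (B \<oplus> A)" "B \<subseteq> X \<oplus> (A \<ominus> A)"
proof -
  define sep where "sep X \<longleftrightarrow> X \<subseteq> B \<and>
    (\<forall>x\<in>X. \<forall>y\<in>X. x \<noteq> y \<longrightarrow> (\<lambda>a. x + a) ` A \<inter> (\<lambda>a. y + a) ` A = {})" for X
  have "{X. sep X} \<subseteq> Pow B" by (auto simp: sep_def)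
  then have "finite {X. sep X}" using assms(3) by (meson finite_Pow_iff finite_subset)
  moreover have "{X. sep X} \<noteq> {}" using sep_def[of "{}"] by auto
  ultimately have M: "finite (card ` {X. sep X})" "card ` {X. sep X} \<noteq> {}" by auto
  obtain X where "sep X" "card X = Max (card ` {X. sep X})" using Max_in[OF M] by auto
  then have max: "card Y \<le> card X" if "sep Y" for Y using that M by (auto intro!: Max_ge)
  note X = \<open>sep X\<close>[unfolded sep_def]
  have finX: "finite X" using X assms finite_subset by blast
  have "card X * card A = card (X \<times> A)" by (simp add: card_cartesian_product)
  also have "\<dots> = card ((\<lambda>(x, a). x + a) ` (X \<times> A))"
  proof (rule card_image[symmetric], rule inj_onI, clarify)
    fix x a y b assume "x \<in> X" "a \<in> A" "y \<in> X" "b \<in> A" "x + a = y + b"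
    then have "x = y" using X by (metis IntI empty_iff imageI)
    then show "x = y \<and> a = b" using \<open>x + a = y + b\<close> by simp
  qed
  also have "\<dots> \<le> card (B \<oplus> A)" unfolding sumset_def
    by (rule card_mono) (use assms X in auto)
  finally have 1: "card X * card A \<le> card (B \<oplus> A)" .
  have 2: "B \<subseteq> X \<oplus> (A \<ominus> A)"
  proof
    fix b assume b: "b \<in> B"
    show "b \<in> X \<oplus> (A \<ominus> A)"
    proof (cases "b \<in> X")
      case True
      obtain a where "a \<in> A" using assms by blast
      then have "b + (a - a) \<in> X \<oplus> (A \<ominus> A)" using True by blast
      then show ?thesis by simp
    next
      case False
      have "\<not> sep (insert b X)"
        using max[of "insert b X"] False finX by auto
      then obtain x where x: "x \<in> X" "(\<lambda>a. x + a) ` A \<inter> (\<lambda>a. b + a) ` A \<noteq> {}"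
        using X b unfolding sep_def by auto
      then obtain a a' where "a \<in> A" "a' \<in> A" "x + a = b + a'" by auto
      then have "b = x + (a - a')" by (metis add_diff_cancel_right' add_diff_eq)
      then show ?thesis using x \<open>a \<in> A\<close> \<open>a' \<in> A\<close> by blast
    qed
  qed
  from that[OF _ 1 2] X show thesis by blast
qed

text \<open>
  The set \<open>X\<close> minimises the ratio \<open>|X \<oplus> B| / |X|\<close> among nonempty subsets of \<open>A\<close>. The inequality then
  follows by adding the elements of \<open>C\<close> one at a time: those \<open>x \<in> X\<close> whose translate \<open>x + B + c\<close> is
  already present form a set \<open>Z\<close>, and minimality gives \<open>|Z \<oplus> B| \<ge> (|X \<oplus> B| / |X|) |Z|\<close>.
\<close>

lemma petridis:
  assumes "finite A" "A \<noteq> {}" "finite B"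
  obtains X where "X \<subseteq> A" "X \<noteq> {}"
    "\<And>C. finite C \<Longrightarrow> card (X \<oplus> B \<oplus> C) * card A \<le> card (A \<oplus> B) * card (X \<oplus> C)"
proof -
  define r where "r X = real (card (X \<oplus> B)) / real (card X)" for X
  define S where "S = {X. X \<subseteq> A \<and> X \<noteq> {}}"
  have "finite S" "S \<noteq> {}" using assms unfolding S_def by auto
  then obtain X where XS: "X \<in> S" and min: "\<And>Y. Y \<in> S \<Longrightarrow> r X \<le> r Y"
    by (metis arg_min_if_finite(1) arg_min_least)
  have X: "X \<subseteq> A" "X \<noteq> {}" "finite X" using XS assms finite_subset unfolding S_def by auto
  have cX: "card X > 0" using X by (simp add: card_gt_0_iff)
  have Yle: "r X * real (card Y) \<le> real (card (Y \<oplus> B))" if "Y \<subseteq> A" for Y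
  proof (cases "Y = {}")
    case False
    then have "card Y > 0" using that assms by (meson card_gt_0_iff finite_subset)
    then show ?thesis using min[of Y] that False unfolding r_def[of Y] S_def
      by (simp add: field_simps)
  qed simp
  have XB: "real (card (X \<oplus> B)) = r X * real (card X)" using cX by (simp add: r_def)
  have r0: "r X \<ge> 0" by (simp add: r_def)
  have tr: "card ((\<lambda>y. y + c) ` Y) = card Y" for c :: 'a and Y
    by (simp add: card_image inj_on_def)
  have main: "finite C \<Longrightarrow> real (card (X \<oplus> B \<oplus> C)) \<le> r X * real (card (X \<oplus> C))" for C
  proof (induction C rule: finite_induct)
    case (insert c C)
    define Z where "Z = {x \<in> X. (\<lambda>y. y + c) ` ({x} \<oplus> B) \<subseteq> X \<oplus> B \<oplus> C}"
    have ZX: "Z \<subseteq> X" by (auto simp: Z_def)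
    then have finZ: "finite Z" using X finite_subset by blast
    \<comment> \<open>the new part of \<open>X \<oplus> B \<oplus> insert c C\<close> avoids the translate of \<open>Z \<oplus> B\<close>\<close>
    have "X \<oplus> B \<oplus> insert c C \<subseteq> (X \<oplus> B \<oplus> C) \<union> (\<lambda>y. y + c) ` ((X \<oplus> B) - (Z \<oplus> B))"
    proof
      fix w assume "w \<in> X \<oplus> B \<oplus> insert c C"
      then obtain x b c' where w: "w = x + b + c'" "x \<in> X" "b \<in> B" "c' \<in> insert c C" by blast
      show "w \<in> (X \<oplus> B \<oplus> C) \<union> (\<lambda>y. y + c) ` ((X \<oplus> B) - (Z \<oplus> B))"
      proof (cases "c' \<in> C \<or> w \<in> X \<oplus> B \<oplus> C")
        case True then show ?thesis using w by blast
      next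
        case False
        then have wc: "w = x + b + c" using w by auto
        have "x + b \<notin> Z \<oplus> B"
        proof
          assume "x + b \<in> Z \<oplus> B"
          then obtain z b' where "x + b = z + b'" "z \<in> Z" "b' \<in> B" by blast
          then have "w \<in> X \<oplus> B \<oplus> C" unfolding wc Z_def by (auto simp: subset_iff image_iff)
          then show False using False by blast
        qed
        then show ?thesis using w wc by blast
      qed
    qed
    then have "card (X \<oplus> B \<oplus> insert c C) \<le> card (X \<oplus> B \<oplus> C) + card ((\<lambda>y. y + c) ` ((X \<oplus> B) - (Z \<oplus> B)))"
      by (intro order.trans[OF card_mono card_Un_le]) (use insert X assms in auto)
    also have "\<dots> = card (X \<oplus> B \<oplus> C) + (card (X \<oplus> B) - card (Z \<oplus> B))"
      unfolding tr by (subst card_Diff_subset) (use finZ assms ZX in \<open>auto simp: sumset_mono\<close>)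
    finally have "real (card (X \<oplus> B \<oplus> insert c C)) \<le>
        real (card (X \<oplus> B \<oplus> C)) + (real (card (X \<oplus> B)) - real (card (Z \<oplus> B)))"
      using card_mono[OF _ sumset_mono[OF ZX order.refl[of B]]] X assms by simp
    also have "\<dots> \<le> r X * real (card (X \<oplus> C)) + (r X * real (card X) - r X * real (card Z))"
      using insert.IH Yle[OF order.trans[OF ZX X(1)]] XB by linarith
    also have "\<dots> = r X * (real (card (X \<oplus> C)) + (real (card X) - real (card Z)))"
      by (simp add: algebra_simps)
    also have "\<dots> \<le> r X * real (card (X \<oplus> insert c C))"
    proof (rule mult_left_mono[OF _ r0])
      define W where "W = {x \<in> X. x + c \<in> X \<oplus> C}"
      have "W \<subseteq> Z"
      proof
        fix x assume "x \<in> W"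
        then obtain x' c' where *: "x \<in> X" "x + c = x' + c'" "x' \<in> X" "c' \<in> C"
          unfolding W_def by blast
        have "x + b + c \<in> X \<oplus> B \<oplus> C" if "b \<in> B" for b
        proof -
          have "x + b + c = x' + b + c'" using *(2)
            by (metis (no_types, opaque_lifting) add.assoc add.commute)
          then show ?thesis using sumsetI[OF sumsetI[OF *(3) that] *(4)] by (simp only:)
        qed
        then show "x \<in> Z" using * unfolding Z_def by auto
      qed
      have sub: "(X \<oplus> C) \<union> (\<lambda>y. y + c) ` (X - W) \<subseteq> X \<oplus> insert c C" by auto
      have "(X \<oplus> C) \<inter> (\<lambda>y. y + c) ` (X - W) = {}" by (auto simp: W_def)
      then have "card (X \<oplus> C) + card (X - W) = card ((X \<oplus> C) \<union> (\<lambda>y. y + c) ` (X - W))"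
        using insert X by (subst card_Un_disjoint) (auto simp: tr)
      also have "\<dots> \<le> card (X \<oplus> insert c C)" using sub insert X by (intro card_mono) auto
      finally have 1: "card (X \<oplus> C) + card (X - W) \<le> card (X \<oplus> insert c C)" .
      have "card X - card Z \<le> card (X - W)"
        using diff_card_le_card_Diff[OF finite_subset[OF \<open>W \<subseteq> Z\<close> finZ], of X]
          card_mono[OF finZ \<open>W \<subseteq> Z\<close>] by linarith
      then show "real (card (X \<oplus> C)) + (real (card X) - real (card Z)) \<le> real (card (X \<oplus> insert c C))"
        using 1 card_mono[OF X(3) ZX] by linarith
    qed
    finally show ?case .
  qed simp
  have "card (X \<oplus> B \<oplus> C) * card A \<le> card (A \<oplus> B) * card (X \<oplus> C)" if "finite C" for C
  proof -
    have "real (card (X \<oplus> B \<oplus> C)) * card A \<le> r X * real (card (X \<oplus> C)) * card A"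
      using main[OF that] by (intro mult_right_mono) auto
    also have "\<dots> = (r X * card A) * real (card (X \<oplus> C))" by simp
    also have "\<dots> \<le> real (card (A \<oplus> B)) * real (card (X \<oplus> C))"
      using Yle[of A] by (intro mult_right_mono) auto
    finally show ?thesis by (metis of_nat_le_iff of_nat_mult)
  qed
  with that X show thesis by blast
qed

lemma card_diffset_swap: "card (A \<ominus> B) = card (B \<ominus> A)"
proof -
  have "B \<ominus> A = uminus ` (A \<ominus> B)"
    by (auto simp: diffset_def image_iff) (metis minus_diff_eq)+
  then show ?thesis by (simp add: card_image)
qed

lemma sumset_uminus: "A \<oplus> uminus ` B = A \<ominus> B"
  by (auto simp: diffset_def sumset_def image_iff) (metis diff_conv_add_uminus)+

text \<open>
  These are the two instances of the Pluennecke-Ruzsa inequalities that the covering arguments use.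
  Petridis' lemma with \<open>B = -A\<close> bounds \<open>X - A\<close>, \<open>X - 2A\<close> and \<open>X - 3A\<close> for one fixed \<open>X\<close>, and the triangle
  inequality removes \<open>X\<close>.
\<close>

lemma plunnecke_differences:
  fixes A :: "'a::ab_group_add set" and K :: real
  assumes A: "finite A" "A \<noteq> {}" and K: "real (card (A \<ominus> A)) \<le> K * card A" "K \<ge> 0"
  shows "real (card (A \<oplus> (A \<ominus> A))) \<le> K ^ 3 * card A"
    and "real (card ((A \<ominus> A) \<oplus> (A \<ominus> A) \<oplus> A)) \<le> K ^ 5 * card A"
proof -
  define B where "B = uminus ` A"
  have finB: "finite B" using A by (simp add: B_def)
  obtain X where X: "X \<subseteq> A" "X \<noteq> {}"
    and pet: "\<And>C. finite C \<Longrightarrow> card (X \<oplus> B \<oplus> C) * card A \<le> card (A \<oplus> B) * card (X \<oplus> C)"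
    using petridis[OF A finB] by metis
  have finX: "finite X" using X A finite_subset by blast
  have cA: "card A > 0" and cX: "card X > 0" using A X finX by (auto simp: card_gt_0_iff)
  have XA: "card X \<le> card A" using X A by (simp add: card_mono)
  have step: "real (card (X \<oplus> (B \<oplus> C))) \<le> K * card (X \<oplus> C)" if "finite C" for C
  proof -
    have "real (card (X \<oplus> (B \<oplus> C))) * card A \<le> real (card (A \<oplus> B)) * card (X \<oplus> C)"
      using pet[OF that] unfolding sumset_assoc by (metis of_nat_le_iff of_nat_mult)
    also have "\<dots> \<le> K * card A * card (X \<oplus> C)"
      using K(1) by (intro mult_right_mono) (auto simp: B_def sumset_uminus)
    finally have "real (card (X \<oplus> (B \<oplus> C))) * card A \<le> (K * card (X \<oplus> C)) * card A"
      by (simp add: mult_ac)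
    then show ?thesis using cA by simp
  qed
  have zero: "C \<oplus> {0} = C" for C :: "'a set" by (force simp: sumset_def image_iff)
  have 1: "real (card (X \<oplus> B)) \<le> K * card X" using step[of "{0}"] by (simp add: zero)
  have 2: "real (card (X \<oplus> (B \<oplus> B))) \<le> K ^ 2 * card X"
    using order.trans[OF step[OF finB] mult_left_mono[OF 1 K(2)]] by (simp add: power2_eq_square mult_ac)
  have 3: "real (card (X \<oplus> (B \<oplus> (B \<oplus> B)))) \<le> K ^ 3 * card X"
    using order.trans[OF step[of "B \<oplus> B"] mult_left_mono[OF 2 K(2)]] finB
    by (simp add: power2_eq_square power3_eq_cube mult_ac)
  have neg: "uminus ` (C \<oplus> D) = uminus ` C \<oplus> uminus ` D" for C D :: "'a set"
    by (force simp: sumset_def image_iff)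
  have d1: "X \<ominus> A = X \<oplus> B" by (simp add: B_def sumset_uminus)
  have d2: "X \<ominus> (A \<oplus> A) = X \<oplus> (B \<oplus> B)" by (simp add: B_def neg flip: sumset_uminus)
  have d3: "X \<ominus> (A \<oplus> (A \<oplus> A)) = X \<oplus> (B \<oplus> (B \<oplus> B))" by (simp add: B_def neg flip: sumset_uminus)
  have tri: "real (card (C \<ominus> D)) \<le> k * l * card A"
    if "real (card (X \<ominus> C)) \<le> k * card X" "real (card (X \<ominus> D)) \<le> l * card X" "finite C" "finite D"
      "k \<ge> 0" "l \<ge> 0" for C D and k l :: real
  proof -
    have "real (card X) * card (C \<ominus> D) \<le> real (card (C \<ominus> X)) * card (X \<ominus> D)"
      using ruzsa_triangle[OF that(3) finX that(4)] by (metis of_nat_le_iff of_nat_mult)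
    also have "\<dots> \<le> (k * card X) * (l * card X)"
      using that by (intro mult_mono) (auto simp: card_diffset_swap[of C])
    finally have "real (card X) * card (C \<ominus> D) \<le> real (card X) * (k * l * card X)" by (simp add: mult_ac)
    then have "card (C \<ominus> D) \<le> k * l * card X" using cX by simp
    also have "\<dots> \<le> k * l * card A" using XA that by (intro mult_left_mono) auto
    finally show ?thesis .
  qed
  have e1: "A \<oplus> (A \<ominus> A) = (A \<oplus> A) \<ominus> A"
    by (simp add: sumset_assoc flip: sumset_uminus)
  have e2: "(A \<ominus> A) \<oplus> (A \<ominus> A) \<oplus> A = (A \<oplus> (A \<oplus> A)) \<ominus> (A \<oplus> A)"
  proof -
    have "(A \<ominus> A) \<oplus> (A \<ominus> A) \<oplus> A = (A \<oplus> B) \<oplus> (A \<oplus> B) \<oplus> A" by (simp add: B_def sumset_uminus)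
    also have "\<dots> = A \<oplus> (A \<oplus> A) \<oplus> (B \<oplus> B)"
      by (metis (no_types, opaque_lifting) sumset_assoc sumset_commute)
    finally show ?thesis by (simp add: B_def neg flip: sumset_uminus)
  qed
  show "real (card (A \<oplus> (A \<ominus> A))) \<le> K ^ 3 * card A"
    unfolding e1 using tri[of "A \<oplus> A" "K^2" A K] 1 2 A K(2)
    by (simp add: d1 d2 power2_eq_square power3_eq_cube mult_ac)
  show "real (card ((A \<ominus> A) \<oplus> (A \<ominus> A) \<oplus> A)) \<le> K ^ 5 * card A"
    unfolding e2 using tri[of "A \<oplus> (A \<oplus> A)" "K^3" "A \<oplus> A" "K^2"] 2 3 A K(2)
    by (simp add: d2 d3 eval_nat_numeral mult_ac)
qed

section \<open>The theorem of Balog, Szemeredi and Gowers\<close>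

lemma real_card_of_bool: "finite S \<Longrightarrow> real (card {a \<in> S. P a}) = (\<Sum>a\<in>S. of_bool (P a))"
  by (simp add: Int_def)

text \<open>
  The relation \<open>a - b \<in> D\<close> is a dense graph on \<open>L\<close>. A vertex \<open>x\<close> chosen by averaging has a large
  neighbourhood \<open>U\<close> in which all but an eighth of the pairs have many common neighbours. The vertices of
  \<open>U\<close> that lie in few bad pairs form \<open>A\<close>: two of them are joined by many paths of length four through \<open>U\<close>,
  so each of their differences has many representations as an alternating sum of four elements of \<open>D\<close>,
  and there are few such differences.
\<close>

lemma balog_szemeredi_gowers:
  fixes L D :: "'a::ab_group_add set" and K :: real
  assumes L: "finite L" "L \<noteq> {}" and D: "finite D" "card D \<le> K * card L" and K: "K > 0"
    and dense: "real (card {(a, b) \<in> L \<times> L. a - b \<in> D}) \<ge> (real (card L))\<^sup>2 / K"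
  obtains A where "A \<subseteq> L" "card L \<le> 4 * K * card A" "card (A \<ominus> A) \<le> 4096 * K ^ 10 * card A"
proof -
  define n where "n = real (card L)"
  have n0: "n > 0" using L by (simp add: n_def card_gt_0_iff)
  define N where "N x = {a \<in> L. a - x \<in> D}" for x
  define codeg where "codeg a b = card {x \<in> L. a - x \<in> D \<and> b - x \<in> D}" for a b
  \<comment> \<open>a pair is bad if it has fewer than \<open>\<theta> n\<close> common neighbours; this \<open>\<theta>\<close> makes the
      bad pairs, weighted by \<open>8\<close>, at most half of the second moment of the degrees\<close>
  define \<theta> where "\<theta> = 1 / (16 * K\<^sup>2)"
  have th0: "\<theta> > 0" using K by (simp add: \<theta>_def)
  define bad where "bad a b \<longleftrightarrow> real (codeg a b) < \<theta> * n" for a b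
  define badp where "badp x = real (card {(a, b) \<in> L \<times> L. a \<in> N x \<and> b \<in> N x \<and> bad a b})" for x
  have finN: "finite (N x)" for x using L by (simp add: N_def)
  have Nsum: "real (card (N x)) = (\<Sum>a\<in>L. of_bool (a - x \<in> D))" for x
    unfolding N_def using L by (simp add: real_card_of_bool)
  have s1: "(\<Sum>x\<in>L. real (card (N x))) \<ge> n\<^sup>2 / K"
  proof -
    have "{(a, b) \<in> L \<times> L. a - b \<in> D} = {z \<in> L \<times> L. fst z - snd z \<in> D}" by auto
    then have "real (card {(a, b) \<in> L \<times> L. a - b \<in> D}) = (\<Sum>z\<in>L \<times> L. of_bool (fst z - snd z \<in> D))"
      using L real_card_of_bool[of "L \<times> L" "\<lambda>z. fst z - snd z \<in> D"] by simp
    also have "\<dots> = (\<Sum>a\<in>L. \<Sum>x\<in>L. of_bool (a - x \<in> D))"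
      by (simp add: sum.cartesian_product case_prod_beta)
    also have "\<dots> = (\<Sum>x\<in>L. real (card (N x)))" unfolding Nsum by (rule sum.swap)
    finally show ?thesis using dense by (simp add: n_def)
  qed
  have s2: "(\<Sum>x\<in>L. (real (card (N x)))\<^sup>2) \<ge> n ^ 3 / K\<^sup>2"
  proof -
    have "(n\<^sup>2 / K)\<^sup>2 \<le> (\<Sum>x\<in>L. real (card (N x)))\<^sup>2"
      using s1 K n0 by (intro power_mono) auto
    also have "\<dots> \<le> (\<Sum>x\<in>L. (real (card (N x)))\<^sup>2) * card L"
      by (rule sum_squared_le_sum_of_squares)
    finally have "n * (n ^ 3 / K\<^sup>2) \<le> n * (\<Sum>x\<in>L. (real (card (N x)))\<^sup>2)"
      by (simp add: n_def power_divide eval_nat_numeral mult_ac)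
    then show ?thesis using n0 by (rule mult_left_le_imp_le)
  qed
  have s3: "(\<Sum>x\<in>L. badp x) \<le> \<theta> * n ^ 3"
  proof -
    have "badp x = (\<Sum>a\<in>L. \<Sum>b\<in>L. of_bool (bad a b) * of_bool (a - x \<in> D \<and> b - x \<in> D))" for x
    proof -
      have "{(a, b) \<in> L \<times> L. a \<in> N x \<and> b \<in> N x \<and> bad a b} =
        {z \<in> L \<times> L. bad (fst z) (snd z) \<and> fst z - x \<in> D \<and> snd z - x \<in> D}" by (auto simp: N_def)
      then have "badp x = (\<Sum>z\<in>L \<times> L. of_bool (bad (fst z) (snd z) \<and> fst z - x \<in> D \<and> snd z - x \<in> D))"
        unfolding badp_def using L real_card_of_bool[of "L \<times> L"] by simp
      also have "\<dots> = (\<Sum>a\<in>L. \<Sum>b\<in>L. of_bool (bad a b) * of_bool (a - x \<in> D \<and> b - x \<in> D))"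
        by (simp add: sum.cartesian_product case_prod_beta of_bool_conj)
      finally show ?thesis .
    qed
    then have "(\<Sum>x\<in>L. badp x) =
        (\<Sum>x\<in>L. \<Sum>a\<in>L. \<Sum>b\<in>L. of_bool (bad a b) * of_bool (a - x \<in> D \<and> b - x \<in> D))" by simp
    also have "\<dots> = (\<Sum>a\<in>L. \<Sum>x\<in>L. \<Sum>b\<in>L. of_bool (bad a b) * of_bool (a - x \<in> D \<and> b - x \<in> D))"
      by (rule sum.swap)
    also have "\<dots> = (\<Sum>a\<in>L. \<Sum>b\<in>L. \<Sum>x\<in>L. of_bool (bad a b) * of_bool (a - x \<in> D \<and> b - x \<in> D))"
      by (intro sum.cong refl sum.swap)
    also have "\<dots> = (\<Sum>a\<in>L. \<Sum>b\<in>L. of_bool (bad a b) * real (codeg a b))"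
      unfolding codeg_def by (simp only: real_card_of_bool[OF L(1)] sum_distrib_left)
    also have "\<dots> \<le> (\<Sum>a\<in>L. \<Sum>b\<in>L. \<theta> * n)"
      by (intro sum_mono) (use th0 n0 in \<open>auto simp: bad_def\<close>)
    also have "\<dots> = \<theta> * n ^ 3" by (simp add: n_def eval_nat_numeral)
    finally show ?thesis .
  qed
  obtain x where x: "x \<in> L" "(real (card (N x)))\<^sup>2 - 8 * badp x \<ge> n\<^sup>2 / (2 * K\<^sup>2)"
  proof (rule ccontr)
    assume "\<not> thesis"
    then have "\<And>x. x \<in> L \<Longrightarrow> (real (card (N x)))\<^sup>2 - 8 * badp x < n\<^sup>2 / (2 * K\<^sup>2)"
      using that by force
    then have "(\<Sum>x\<in>L. (real (card (N x)))\<^sup>2 - 8 * badp x) < (\<Sum>x\<in>L. n\<^sup>2 / (2 * K\<^sup>2))"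
      using L by (intro sum_strict_mono) auto
    also have "\<dots> = n ^ 3 / (2 * K\<^sup>2)" by (simp add: n_def eval_nat_numeral)
    finally have "(\<Sum>x\<in>L. (real (card (N x)))\<^sup>2) - 8 * (\<Sum>x\<in>L. badp x) < n ^ 3 / (2 * K\<^sup>2)"
      by (simp add: sum_subtractf sum_distrib_left)
    moreover have "8 * (\<theta> * n ^ 3) = n ^ 3 / (2 * K\<^sup>2)" using K by (simp add: \<theta>_def field_simps)
    moreover have "n ^ 3 / K\<^sup>2 = 2 * (n ^ 3 / (2 * K\<^sup>2))" using K by (simp add: field_simps)
    ultimately show False using s2 s3 by linarith
  qed
  define U where "U = N x"
  define u where "u = real (card U)"
  have finU: "finite U" and UL: "U \<subseteq> L" using L by (auto simp: U_def N_def)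
  have ubad: "8 * badp x \<le> u\<^sup>2" and u2: "u\<^sup>2 \<ge> n\<^sup>2 / (2 * K\<^sup>2)"
  proof -
    have "badp x \<ge> 0" by (simp add: badp_def)
    moreover have "n\<^sup>2 / (2 * K\<^sup>2) \<ge> 0" by simp
    ultimately show "8 * badp x \<le> u\<^sup>2" "u\<^sup>2 \<ge> n\<^sup>2 / (2 * K\<^sup>2)"
      using x(2) unfolding u_def U_def by linarith+
  qed
  have un: "u \<ge> n / (2 * K)"
  proof (rule power2_le_imp_le)
    have "(n / (2 * K))\<^sup>2 = n\<^sup>2 / (4 * K\<^sup>2)" by (simp add: power_divide power_mult_distrib)
    also have "\<dots> \<le> n\<^sup>2 / (2 * K\<^sup>2)" using K by (intro divide_left_mono) auto
    finally show "(n / (2 * K))\<^sup>2 \<le> u\<^sup>2" using u2 by simp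
  qed (simp add: u_def)
  have u0: "u > 0" using un n0 K by (smt (verit) divide_pos_pos)
  define w where "w a = card {b \<in> U. bad a b}" for a
  define A where "A = {a \<in> U. real (w a) \<le> u / 4}"
  have AU: "A \<subseteq> U" by (auto simp: A_def)
  have finA: "finite A" using AU finU finite_subset by blast
  have wsum: "(\<Sum>a\<in>U. real (w a)) = badp x"
  proof -
    have "{(a, b) \<in> L \<times> L. a \<in> N x \<and> b \<in> N x \<and> bad a b} = (SIGMA a:U. {b \<in> U. bad a b})"
      using UL by (auto simp: U_def)
    then show ?thesis unfolding badp_def w_def using finU by (simp add: card_SigmaI)
  qed
  have cA: "real (card A) \<ge> u / 2"
  proof -
    have "real (card (U - A)) * (u / 4) = (\<Sum>a\<in>U - A. u / 4)" by simp
    also have "\<dots> \<le> (\<Sum>a\<in>U - A. real (w a))" by (intro sum_mono) (auto simp: A_def)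
    also have "\<dots> \<le> (\<Sum>a\<in>U. real (w a))" using finU by (intro sum_mono2) auto
    finally have "real (card (U - A)) * (u / 4) \<le> u\<^sup>2 / 8" using wsum ubad by linarith
    then have "real (card (U - A)) * u \<le> (u / 2) * u" by (simp add: power2_eq_square mult_ac)
    then have "real (card (U - A)) \<le> u / 2" using u0 by simp
    moreover have "card (U - A) = card U - card A" "card A \<le> card U"
      using AU finA finU by (simp_all add: card_Diff_subset card_mono)
    ultimately show ?thesis by (simp add: u_def of_nat_diff)
  qed
  \<comment> \<open>each difference of two elements of \<open>A\<close> is counted by many paths of length four\<close>
  define P where "P a a' = {(b, y, z). b \<in> U \<and> y \<in> L \<and> z \<in> L \<and> a - y \<in> D \<and> b - y \<in> D \<and> b - z \<in> D \<and> a' - z \<in> D}" for a a'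
  have finP: "finite (P a a')" for a a'
    by (rule finite_subset[of _ "U \<times> L \<times> L"]) (use finU L in \<open>auto simp: P_def\<close>)
  have cP: "real (card (P a a')) \<ge> u / 2 * (\<theta> * n)\<^sup>2" if "a \<in> A" "a' \<in> A" for a a'
  proof -
    define G where "G = {b \<in> U. \<not> bad a b \<and> \<not> bad a' b}"
    have finG: "finite G" using finU by (simp add: G_def)
    have "U \<subseteq> G \<union> ({b \<in> U. bad a b} \<union> {b \<in> U. bad a' b})" by (auto simp: G_def)
    then have "card U \<le> card (G \<union> ({b \<in> U. bad a b} \<union> {b \<in> U. bad a' b}))"
      using finU finG by (intro card_mono) auto
    also have "\<dots> \<le> card G + (w a + w a')"
      unfolding w_def by (intro order.trans[OF card_Un_le] add_left_mono card_Un_le)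
    finally have cG: "real (card G) \<ge> u / 2" using that by (simp add: u_def A_def)
    have sub: "(SIGMA b:G. {y \<in> L. a - y \<in> D \<and> b - y \<in> D} \<times> {z \<in> L. a' - z \<in> D \<and> b - z \<in> D}) \<subseteq> P a a'"
      by (auto simp: P_def G_def)
    have "u / 2 * (\<theta> * n)\<^sup>2 \<le> real (card G) * (\<theta> * n)\<^sup>2" using cG by (intro mult_right_mono) auto
    also have "\<dots> = (\<Sum>b\<in>G. (\<theta> * n) * (\<theta> * n))" by (simp add: power2_eq_square)
    also have "\<dots> \<le> (\<Sum>b\<in>G. real (codeg a b) * real (codeg a' b))"
      by (intro sum_mono mult_mono) (use th0 n0 in \<open>auto simp: G_def bad_def\<close>)
    also have "\<dots> = real (card (SIGMA b:G. {y \<in> L. a - y \<in> D \<and> b - y \<in> D} \<times> {z \<in> L. a' - z \<in> D \<and> b - z \<in> D}))"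
      using finG L by (subst card_SigmaI) (auto simp: codeg_def card_cartesian_product)
    also have "\<dots> \<le> real (card (P a a'))" using card_mono[OF finP sub] by simp
    finally show ?thesis .
  qed
  have "\<forall>d\<in>A \<ominus> A. \<exists>a a'. a \<in> A \<and> a' \<in> A \<and> d = a - a'" by blast
  then obtain f g where fg: "\<And>d. d \<in> A \<ominus> A \<Longrightarrow> f d \<in> A \<and> g d \<in> A \<and> d = f d - g d"
    by metis
  have finAA: "finite (A \<ominus> A)" using finA by simp
  define Q where "Q = (SIGMA d:A \<ominus> A. P (f d) (g d))"
  let ?\<phi> = "\<lambda>(d, b, y, z). (f d - y, b - y, b - z, g d - z)"
  have "inj_on ?\<phi> Q"
  proof (rule inj_onI)
    fix q q' assume q: "q \<in> Q" "q' \<in> Q" "?\<phi> q = ?\<phi> q'"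
    obtain d b y z d' b' y' z' where qq: "q = (d, b, y, z)" "q' = (d', b', y', z')"
      by (metis prod_cases4)
    have *: "(d, b, y, z) \<in> Q" "(d', b', y', z') \<in> Q"
      "f d - y = f d' - y'" "b - y = b' - y'" "b - z = b' - z'" "g d - z = g d' - z'"
      using q by (simp_all add: qq)
    have dd: "d \<in> A \<ominus> A" "d' \<in> A \<ominus> A" using * by (auto simp: Q_def)
    have "d = (f d - y) - (b - y) + (b - z) - (g d - z)" using fg[OF dd(1)] by (simp add: algebra_simps)
    also have "\<dots> = (f d' - y') - (b' - y') + (b' - z') - (g d' - z')" using * by simp
    also have "\<dots> = d'" using fg[OF dd(2)] by (simp add: algebra_simps)
    finally show "q = q'" using * by (simp add: qq)
  qed
  moreover have "?\<phi> ` Q \<subseteq> D \<times> D \<times> D \<times> D" by (auto simp: Q_def P_def)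
  ultimately have "card Q \<le> card (D \<times> D \<times> D \<times> D)"
    by (rule card_inj_on_le) (use D in auto)
  then have cQ: "real (card Q) \<le> real (card D) ^ 4"
    by (simp add: card_cartesian_product eval_nat_numeral flip: of_nat_mult)
  have "real (card (A \<ominus> A)) * (u / 2 * (\<theta> * n)\<^sup>2) = (\<Sum>d\<in>A \<ominus> A. u / 2 * (\<theta> * n)\<^sup>2)" by simp
  also have "\<dots> \<le> (\<Sum>d\<in>A \<ominus> A. real (card (P (f d) (g d))))"
    by (intro sum_mono cP) (use fg in auto)
  also have "\<dots> = real (card Q)" unfolding Q_def using finAA finP by (simp add: card_SigmaI)
  also have "\<dots> \<le> (K * n) ^ 4"
    by (rule order.trans[OF cQ]) (use D in \<open>auto simp: n_def intro!: power_mono\<close>)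
  finally have "real (card (A \<ominus> A)) * (u / 2 * (\<theta> * n)\<^sup>2) \<le> (K * n) ^ 4" .
  then have "real (card (A \<ominus> A)) * u * n\<^sup>2 \<le> (512 * K ^ 8 * n\<^sup>2) * n\<^sup>2"
    using K unfolding \<theta>_def by (simp add: field_simps eval_nat_numeral)
  then have "real (card (A \<ominus> A)) * u \<le> 512 * K ^ 8 * n\<^sup>2" using n0 by simp
  also have "\<dots> \<le> 512 * K ^ 8 * (2 * K * u)\<^sup>2"
    using un K n0 by (intro mult_left_mono power_mono) (auto simp: field_simps)
  also have "\<dots> = (2048 * K ^ 10 * u) * u" by (simp add: eval_nat_numeral)
  finally have "real (card (A \<ominus> A)) \<le> 2048 * K ^ 10 * u" using u0 by simp
  also have "\<dots> \<le> 2048 * K ^ 10 * (2 * card A)" using cA K by (intro mult_left_mono) auto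
  finally have 1: "real (card (A \<ominus> A)) \<le> 4096 * K ^ 10 * card A" by simp
  have "n \<le> 2 * K * u" using un K by (simp add: field_simps)
  also have "\<dots> \<le> 2 * K * (2 * card A)" using cA K by (intro mult_left_mono) auto
  finally have 2: "real (card L) \<le> 4 * K * card A" by (simp add: n_def)
  show thesis using that[of A] AU UL 1 2 by auto
qed

section \<open>Coverings by translates and almost stabilisers\<close>

text \<open>
  Counting translates, rather than bounding the cardinality of a sumset, makes the notion transitive
  and compatible with sums.
\<close>

definition covers :: "real \<Rightarrow> 'a::ab_group_add set \<Rightarrow> 'a set \<Rightarrow> bool" where
  "covers K S T \<longleftrightarrow> (\<exists>X. finite X \<and> real (card X) \<le> K \<and> S \<subseteq> X \<oplus> T)"

lemma covers_nonneg: "covers K S T \<Longrightarrow> K \<ge> 0"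
  unfolding covers_def by (meson of_nat_0_le_iff order_trans)

lemma covers_weaken: "covers K S T \<Longrightarrow> K \<le> K' \<Longrightarrow> S' \<subseteq> S \<Longrightarrow> covers K' S' T"
  unfolding covers_def by (meson order_trans)

lemma covers_trans:
  assumes "covers K S T" "covers L T U" shows "covers (K * L) S U"
proof -
  obtain X Y where *: "finite X" "real (card X) \<le> K" "S \<subseteq> X \<oplus> T" "finite Y" "real (card Y) \<le> L" "T \<subseteq> Y \<oplus> U"
    using assms unfolding covers_def by blast
  have "S \<subseteq> (X \<oplus> Y) \<oplus> U" using * sumset_mono[of X X T "Y \<oplus> U"] by (simp add: sumset_assoc)
  moreover have "real (card (X \<oplus> Y)) \<le> real (card X) * real (card Y)"
    using card_sumset_le[OF *(1,4)] by (metis of_nat_le_iff of_nat_mult)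
  moreover have "real (card X) * real (card Y) \<le> K * L" using * by (intro mult_mono) auto
  ultimately show ?thesis unfolding covers_def using * by (meson finite_sumset order_trans)
qed

lemma covers_sumset:
  assumes "covers K S T" "covers K' S' T'" shows "covers (K * K') (S \<oplus> S') (T \<oplus> T')"
proof -
  obtain X Y where *: "finite X" "real (card X) \<le> K" "S \<subseteq> X \<oplus> T" "finite Y" "real (card Y) \<le> K'" "S' \<subseteq> Y \<oplus> T'"
    using assms unfolding covers_def by blast
  have "S \<oplus> S' \<subseteq> (X \<oplus> T) \<oplus> (Y \<oplus> T')" using * by (intro sumset_mono)
  also have "\<dots> = (X \<oplus> Y) \<oplus> (T \<oplus> T')" by (metis sumset_assoc sumset_commute)
  finally have "S \<oplus> S' \<subseteq> (X \<oplus> Y) \<oplus> (T \<oplus> T')" .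
  moreover have "real (card (X \<oplus> Y)) \<le> real (card X) * real (card Y)"
    using card_sumset_le[OF *(1,4)] by (metis of_nat_le_iff of_nat_mult)
  moreover have "real (card X) * real (card Y) \<le> K * K'" using * by (intro mult_mono) auto
  ultimately show ?thesis unfolding covers_def using * by (meson finite_sumset order_trans)
qed

lemma image_mult_sumset: "(*) h ` (X \<oplus> T) = (*) h ` X \<oplus> (*) h ` T" for h :: "'a::comm_ring_1"
  by (force simp: sumset_def image_iff distrib_left)

lemma image_mult_diffset: "(*) h ` (X \<ominus> T) = (*) h ` X \<ominus> (*) h ` T" for h :: "'a::comm_ring_1"
  by (force simp: diffset_def image_iff right_diff_distrib)

lemma covers_image_mult:
  fixes h :: "'a::comm_ring_1"
  assumes "covers K S T" shows "covers K ((*) h ` S) ((*) h ` T)"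
proof -
  obtain X where *: "finite X" "real (card X) \<le> K" "S \<subseteq> X \<oplus> T" using assms unfolding covers_def by blast
  have "(*) h ` S \<subseteq> (*) h ` X \<oplus> (*) h ` T" using *(3) by (metis image_mono image_mult_sumset)
  moreover have "real (card ((*) h ` X)) \<le> K" using card_image_le[OF *(1), of "(*) h"] *(2) by linarith
  ultimately show ?thesis unfolding covers_def using * by blast
qed

lemma covers_card:
  assumes "covers K S T" "finite T" shows "real (card S) \<le> K * card T"
proof -
  obtain X where *: "finite X" "real (card X) \<le> K" "S \<subseteq> X \<oplus> T" using assms unfolding covers_def by blast
  have "card S \<le> card X * card T"
    using card_mono[OF _ *(3)] card_sumset_le[OF *(1) assms(2)] * assms by fastforce
  then have "real (card S) \<le> real (card X) * card T" by (metis of_nat_le_iff of_nat_mult)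
  also have "\<dots> \<le> K * card T" using * by (intro mult_right_mono) auto
  finally show ?thesis .
qed

text \<open>
  Ruzsa's covering lemma as a criterion for being covered by a difference set.
\<close>

lemma covers_of_card:
  fixes K :: real
  assumes "finite A" "A \<noteq> {}" "finite S" "real (card (S \<oplus> A)) \<le> K * card A"
  shows "covers K S (A \<ominus> A)"
proof -
  obtain X where X: "X \<subseteq> S" "card X * card A \<le> card (S \<oplus> A)" "S \<subseteq> X \<oplus> (A \<ominus> A)"
    using ruzsa_covering[OF assms(1-3)] by blast
  have "real (card X) * card A \<le> K * card A" using X(2) assms(4) by (metis of_nat_le_iff of_nat_mult order_trans)
  moreover have "card A > 0" using assms by (simp add: card_gt_0_iff)
  ultimately show ?thesis unfolding covers_def using X assms finite_subset[OF X(1)] by auto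
qed

text \<open>
  For fixed \<open>P\<close> with \<open>P + P\<close> covered by few translates of \<open>P\<close>, the multipliers \<open>h\<close> with this property form,
  up to a polynomial loss in \<open>K\<close>, a subring.
\<close>

definition almost_stabilises :: "real \<Rightarrow> 'a::comm_ring_1 \<Rightarrow> 'a set \<Rightarrow> bool" where
  "almost_stabilises K h P \<longleftrightarrow> covers K ((*) h ` P) P"

lemma almost_stabilises_mult:
  assumes "almost_stabilises K h P" "almost_stabilises K' h' P"
  shows "almost_stabilises (K * K') (h * h') P"
proof -
  have "covers (K' * K) ((*) h ` ((*) h' ` P)) P"
    using assms unfolding almost_stabilises_def by (meson covers_image_mult covers_trans)
  moreover have "(*) h ` ((*) h' ` P) = (*) (h * h') ` P" by (simp add: image_image mult.assoc)
  ultimately show ?thesis by (simp add: almost_stabilises_def mult.commute)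
qed

lemma almost_stabilises_add:
  assumes "almost_stabilises K h P" "almost_stabilises K' h' P" "covers L (P \<oplus> P) P"
  shows "almost_stabilises (K * K' * L) (h + h') P"
proof -
  have "covers (K * K') ((*) h ` P \<oplus> (*) h' ` P) (P \<oplus> P)"
    using assms covers_sumset unfolding almost_stabilises_def by blast
  then have "covers (K * K' * L) ((*) h ` P \<oplus> (*) h' ` P) P" using assms(3) covers_trans by blast
  moreover have "(*) (h + h') ` P \<subseteq> (*) h ` P \<oplus> (*) h' ` P" by (auto simp: distrib_right)
  ultimately show ?thesis unfolding almost_stabilises_def using covers_weaken by blast
qed

lemma almost_stabilises_uminus:
  assumes "almost_stabilises K h P" "uminus ` P = P"
  shows "almost_stabilises K (- h) P"
proof -
  have "(*) (- h) ` P = (*) h ` (uminus ` P)" by (simp add: image_image)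
  then show ?thesis using assms by (simp add: almost_stabilises_def)
qed

lemma almost_stabilises_diff:
  assumes "almost_stabilises K h P" "almost_stabilises K' h' P" "covers L (P \<oplus> P) P" "uminus ` P = P"
  shows "almost_stabilises (K * K' * L) (h - h') P"
  using almost_stabilises_add[OF assms(1) almost_stabilises_uminus[OF assms(2,4)] assms(3)] by simp

lemma uminus_diffset_self: "uminus ` (A \<ominus> A) = A \<ominus> A"
  by (auto simp: diffset_def image_iff) (metis minus_diff_eq)+

section \<open>Growth under sums and products in a prime field\<close>

text \<open>
  Cauchy-Schwarz over the fibres of \<open>f\<close>: a map with few collisions has a large image.
\<close>

lemma card_image_energy:
  assumes "finite S"
  shows "(card S)\<^sup>2 \<le> card (f ` S) * card {(s, t) \<in> S \<times> S. f s = f t}"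
proof -
  define g where "g y = {s \<in> S. f s = y}" for y
  have fg: "finite (g y)" for y using assms by (simp add: g_def)
  have S: "card S = (\<Sum>y\<in>f ` S. card (g y))"
    using sum.group[where g = f and h = "\<lambda>_. 1::nat", OF assms finite_imageI[OF assms] order.refl] by (simp add: g_def)
  have "{(s, t) \<in> S \<times> S. f s = f t} = (\<Union>y\<in>f ` S. g y \<times> g y)" by (auto simp: g_def)
  also have "card \<dots> = (\<Sum>y\<in>f ` S. card (g y \<times> g y))"
    by (rule card_UN_disjoint) (use assms fg in \<open>auto simp: g_def\<close>)
  finally have E: "card {(s, t) \<in> S \<times> S. f s = f t} = (\<Sum>y\<in>f ` S. (card (g y))\<^sup>2)"
    by (simp add: card_cartesian_product power2_eq_square)
  have "(real (card S))\<^sup>2 \<le> (\<Sum>y\<in>f ` S. (real (card (g y)))\<^sup>2) * card (f ` S)"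
    unfolding S of_nat_sum by (rule sum_squared_le_sum_of_squares)
  also have "\<dots> = real (card (f ` S) * card {(s, t) \<in> S \<times> S. f s = f t})" by (simp only: E of_nat_mult of_nat_sum of_nat_power mult.commute)
  finally show ?thesis unfolding of_nat_power[symmetric] of_nat_le_iff .
qed

text \<open>
  A field of prime order as a subset of a ring whose unit may differ from the unit \<open>e\<close> of the field.
  The order of the field can thus be an arbitrary prime inside a statement, which is impossible when
  the field is a type. Primality is expressed by \<open>e\<close> generating the additive group.
\<close>

locale embedded_prime_field =
  fixes F :: "'a::comm_ring_1 set" and e :: 'a
  assumes finite_F: "finite F"
    and e_in: "e \<in> F" and e_nonzero: "e \<noteq> 0"
    and diff_closed: "x \<in> F \<Longrightarrow> y \<in> F \<Longrightarrow> x - y \<in> F"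
    and mult_closed: "x \<in> F \<Longrightarrow> y \<in> F \<Longrightarrow> x * y \<in> F"
    and e_mult [simp]: "x \<in> F \<Longrightarrow> e * x = x"
    and inverse_ex: "x \<in> F \<Longrightarrow> x \<noteq> 0 \<Longrightarrow> \<exists>y\<in>F. x * y = e"
    and generated: "x \<in> F \<Longrightarrow> \<exists>n::nat. x = of_nat n * e"
begin

lemma zero_in: "0 \<in> F" using diff_closed[OF e_in e_in] by simp

lemma uminus_closed: "x \<in> F \<Longrightarrow> - x \<in> F" using diff_closed[OF zero_in, of x] by simp

lemma add_closed: "x \<in> F \<Longrightarrow> y \<in> F \<Longrightarrow> x + y \<in> F"
  using diff_closed[OF _ uminus_closed, of x y] by simp

lemma mult_eq_0: assumes "c \<in> F" "x \<in> F" "c * x = 0" "c \<noteq> 0" shows "x = 0"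
proof -
  obtain y where "y \<in> F" "c * y = e" using inverse_ex assms by blast
  then have "x = y * (c * x)" using assms e_mult[of x] by (metis mult.assoc mult.commute)
  then show ?thesis using assms by simp
qed

lemma mult_cancel: "c \<in> F \<Longrightarrow> c \<noteq> 0 \<Longrightarrow> x \<in> F \<Longrightarrow> y \<in> F \<Longrightarrow> c * x = c * y \<Longrightarrow> x = y"
  using mult_eq_0[of c "x - y"] diff_closed[of x y] by (simp add: right_diff_distrib)

lemma inj_mult: "c \<in> F \<Longrightarrow> c \<noteq> 0 \<Longrightarrow> A \<subseteq> F \<Longrightarrow> inj_on ((*) c) A"
  by (meson inj_onI mult_cancel subsetD)

lemma card_mult: "c \<in> F \<Longrightarrow> c \<noteq> 0 \<Longrightarrow> A \<subseteq> F \<Longrightarrow> card ((*) c ` A) = card A"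
  by (simp add: card_image inj_mult)

lemma card_F_ge_2: "card F \<ge> 2"
  using card_mono[OF finite_F, of "{0, e}"] zero_in e_in e_nonzero by auto

text \<open>
  The quotients of differences of elements of \<open>B\<close>. As soon as \<open>|B|\<^sup>2 > |F|\<close> they exhaust the field, since
  \<open>(b, b') \<mapsto> b + x b'\<close> cannot be injective.
\<close>

definition quotients :: "'a set \<Rightarrow> 'a set" where
  "quotients B = {x \<in> F. \<exists>b1\<in>B. \<exists>b2\<in>B. \<exists>b3\<in>B. \<exists>b4\<in>B. b3 \<noteq> b4 \<and> x * (b3 - b4) = b1 - b2}"

lemma of_nat_e_in: "of_nat n * e \<in> F"
  by (induction n) (auto simp: zero_in distrib_right intro: add_closed e_in)

text \<open>
  If the quotients are not the whole field, then walking from \<open>0\<close> in steps of \<open>e\<close> there is a quotient \<open>r\<close>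
  such that \<open>r + e\<close> is not one. For the latter the map \<open>(b, b') \<mapsto> b + (r + e) b'\<close> is injective, and
  multiplying it by the denominator of \<open>r\<close> leaves a polynomial expression in elements of \<open>B\<close>.
\<close>

lemma pivot:
  assumes B: "B \<subseteq> F" "card B \<ge> 2" and R: "quotients B \<noteq> F"
  obtains b1 b2 b3 b4 where "b1 \<in> B" "b2 \<in> B" "b3 \<in> B" "b4 \<in> B"
    "inj_on (\<lambda>(b, b'). (b3 - b4) * b + (b1 - b2 + (b3 - b4)) * b') (B \<times> B)"
proof -
  obtain c d where cd: "c \<in> B" "d \<in> B" "c \<noteq> d"
    using B(2) by (metis card_le_Suc0_iff_eq card.infinite not_less_eq_eq numeral_2_eq_2 zero_le)
  have "quotients B \<subseteq> F" by (auto simp: quotients_def)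
  then obtain x where "x \<in> F" "x \<notin> quotients B" using R by blast
  then have ex: "\<exists>n::nat. of_nat n * e \<notin> quotients B" using generated by metis
  define n where "n = (LEAST n::nat. of_nat n * e \<notin> quotients B)"
  have n: "of_nat n * e \<notin> quotients B" unfolding n_def using ex by (rule LeastI_ex)
  have "0 \<in> quotients B" unfolding quotients_def using zero_in cd by force
  then have "n \<noteq> 0" using n by (cases n) auto
  then obtain k where k: "n = Suc k" by (cases n) auto
  have kq: "of_nat k * e \<in> quotients B" using not_less_Least[of k "\<lambda>n. of_nat n * e \<notin> quotients B"] k
    unfolding n_def by auto
  define r where "r = of_nat k * e"
  obtain b1 b2 b3 b4 where b: "b1 \<in> B" "b2 \<in> B" "b3 \<in> B" "b4 \<in> B" "b3 \<noteq> b4" "r * (b3 - b4) = b1 - b2"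
    using kq unfolding quotients_def r_def by blast
  have rF: "r \<in> F" "r + e \<in> F" using of_nat_e_in e_in add_closed by (auto simp: r_def)
  have ren: "r + e \<notin> quotients B" using n k by (simp add: r_def distrib_right add.commute)
  have bF: "b3 - b4 \<in> F" "b3 - b4 \<noteq> 0" using b B diff_closed by auto
  have re: "b1 - b2 + (b3 - b4) = (b3 - b4) * (r + e)" using b(6) bF
    by (metis distrib_left e_mult mult.commute)
  have "inj_on (\<lambda>(b, b'). (b3 - b4) * b + (b1 - b2 + (b3 - b4)) * b') (B \<times> B)"
  proof (rule inj_onI)
    fix z w assume zw: "z \<in> B \<times> B" "w \<in> B \<times> B"
      "(\<lambda>(b, b'). (b3 - b4) * b + (b1 - b2 + (b3 - b4)) * b') z = (\<lambda>(b, b'). (b3 - b4) * b + (b1 - b2 + (b3 - b4)) * b') w"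
    obtain b b' c c' where zw': "z = (b, b')" "w = (c, c')" by fastforce
    have mem: "b \<in> B" "b' \<in> B" "c \<in> B" "c' \<in> B" using zw zw' by auto
    then have memF: "b \<in> F" "b' \<in> F" "c \<in> F" "c' \<in> F" using B by auto
    have "(b3 - b4) * (b + (r + e) * b') = (b3 - b4) * (c + (r + e) * c')"
      using zw(3) unfolding zw' re prod.case by (simp only: distrib_left[of _ b "(r + e) * b'"] distrib_left[of _ c "(r + e) * c'"] mult.assoc)
    then have "b + (r + e) * b' = c + (r + e) * c'"
      by (rule mult_cancel[OF bF, rotated 2]) (intro add_closed mult_closed memF rF)+
    then have *: "(r + e) * (c' - b') = b - c" by (simp add: algebra_simps)
    have "b' = c'"
    proof (rule ccontr)
      assume "b' \<noteq> c'"
      then have "\<exists>b1\<in>B. \<exists>b2\<in>B. \<exists>b3\<in>B. \<exists>b4\<in>B. b3 \<noteq> b4 \<and> (r + e) * (b3 - b4) = b1 - b2"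
        using * mem by (rule_tac x = b in bexI, rule_tac x = c in bexI, rule_tac x = c' in bexI,
            rule_tac x = b' in bexI) auto
      then show False using ren rF(2) unfolding quotients_def by blast
    qed
    then show "z = w" using * zw' by simp
  qed
  then show thesis by (rule that[OF b(1-4)])
qed

text \<open>
  Each application of the pivot squares the cardinality. A new element is built from eight factors taken
  from the old set with five additions or subtractions, so its covering number is at most
  \<open>M\<^sup>8 L\<^sup>5 \<le> M\<^sup>1\<^sup>3\<close>.
\<close>

lemma pivot_iterate:
  assumes PP: "covers L (P \<oplus> P) P" "uminus ` P = P"
  shows "B \<subseteq> F \<Longrightarrow> card B \<ge> 2 \<Longrightarrow> M \<ge> 1 \<Longrightarrow> L \<le> M \<Longrightarrow> (\<And>b. b \<in> B \<Longrightarrow> almost_stabilises M b P)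
    \<Longrightarrow> \<exists>B'\<subseteq>F. card B' \<ge> 2 \<and> (\<forall>b\<in>B'. almost_stabilises (M ^ (13 ^ j)) b P) \<and>
       (quotients B' = F \<or> card B' \<ge> card B ^ (2 ^ j))"
proof (induction j)
  case 0
  then show ?case by (intro exI[of _ B]) auto
next
  case (Suc j)
  obtain B' where B': "B' \<subseteq> F" "card B' \<ge> 2"
    and st: "\<And>b. b \<in> B' \<Longrightarrow> almost_stabilises (M ^ (13 ^ j)) b P"
    and alt: "quotients B' = F \<or> card B' \<ge> card B ^ (2 ^ j)"
    using Suc.IH[OF Suc.prems] by blast
  define N where "N = M ^ (13 ^ j)"
  have N: "N \<ge> 1" "M \<le> N" using Suc.prems(3) by (auto simp: N_def self_le_power)
  have L0: "L \<ge> 0" using PP covers_nonneg by blast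
  have LN: "L \<le> N" using N Suc.prems by linarith
  have N13: "M ^ (13 ^ Suc j) = N ^ 13" by (simp add: N_def power_mult[symmetric] mult.commute)
  show ?case
  proof (cases "quotients B' = F")
    case True
    have "N \<le> N ^ 13" using N by (simp add: self_le_power)
    then have "almost_stabilises (M ^ (13 ^ Suc j)) b P" if "b \<in> B'" for b
      using st[OF that] covers_weaken unfolding almost_stabilises_def N13 N_def[symmetric] by blast
    then show ?thesis using B' True by blast
  next
    case False
    obtain b1 b2 b3 b4 where b: "b1 \<in> B'" "b2 \<in> B'" "b3 \<in> B'" "b4 \<in> B'"
      and inj: "inj_on (\<lambda>(b, b'). (b3 - b4) * b + (b1 - b2 + (b3 - b4)) * b') (B' \<times> B')"
      using pivot[OF B' False] by metis
    define B'' where "B'' = (\<lambda>(b, b'). (b3 - b4) * b + (b1 - b2 + (b3 - b4)) * b') ` (B' \<times> B')"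
    have c: "card B'' = (card B')\<^sup>2"
      unfolding B''_def using card_image[OF inj] by (simp add: card_cartesian_product power2_eq_square)
    have st': "almost_stabilises N b P" if "b \<in> B'" for b using st[OF that] by (simp add: N_def)
    have 1: "almost_stabilises (M ^ (13 ^ Suc j)) x P" if "x \<in> B''" for x
    proof -
      obtain u v where x: "x = (b3 - b4) * u + (b1 - b2 + (b3 - b4)) * v" "u \<in> B'" "v \<in> B'"
        using \<open>x \<in> B''\<close> by (auto simp: B''_def)
      note d = almost_stabilises_diff[OF _ _ PP]
      have d1: "almost_stabilises (N * N * L) (b3 - b4) P" "almost_stabilises (N * N * L) (b1 - b2) P"
        using d st' b by auto
      have d2: "almost_stabilises ((N * N * L) * (N * N * L) * L) (b1 - b2 + (b3 - b4)) P"
        using almost_stabilises_add[OF d1(2,1) PP(1)] .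
      have *: "almost_stabilises (((N * N * L) * N) * (((N * N * L) * (N * N * L) * L) * N) * L) x P"
        unfolding x using almost_stabilises_add[OF almost_stabilises_mult[OF d1(1) st'[OF x(2)]]
          almost_stabilises_mult[OF d2 st'[OF x(3)]] PP(1)] .
      have "((N * N * L) * N) * (((N * N * L) * (N * N * L) * L) * N) * L = N ^ 8 * L ^ 5"
        by (simp add: eval_nat_numeral mult_ac)
      also have "\<dots> \<le> N ^ 8 * N ^ 5"
        using L0 LN N by (intro mult_left_mono power_mono) auto
      also have "N ^ 8 * N ^ 5 = N ^ 13" by (simp flip: power_add)
      finally show ?thesis
        unfolding N13 almost_stabilises_def
        by (rule covers_weaken[OF *[unfolded almost_stabilises_def] _ order.refl])
    qed
    have 2: "B'' \<subseteq> F" unfolding B''_def using B' b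
      by (auto intro!: add_closed mult_closed diff_closed)
    have "card B'' \<ge> card B ^ (2 ^ Suc j)"
    proof -
      have "card B ^ (2 ^ Suc j) = (card B ^ (2 ^ j))\<^sup>2" by (simp add: power_mult[symmetric] mult.commute)
      also have "\<dots> \<le> (card B')\<^sup>2" using alt False by (intro power_mono) auto
      finally show ?thesis by (simp add: c)
    qed
    moreover have "card B'' \<ge> 2" 
      unfolding c power2_eq_square using B'(2) le_square[of "card B'"] by linarith
    ultimately show ?thesis using 1 2 by blast
  qed
qed

text \<open>
  The collisions \<open>a + \<xi> b = a' + \<xi> b'\<close> number at most \<open>|F| |A|\<^sup>2 + |A|\<^sup>4\<close> when summed over all \<open>\<xi>\<close>, because
  \<open>b \<noteq> b'\<close> determines \<open>\<xi>\<close>. So some \<open>\<xi>\<close> has few collisions and \<open>A \<oplus> \<xi> A\<close> is large.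
\<close>

lemma dilate_expansion:
  assumes A: "A \<subseteq> F" "A \<noteq> {}" and T: "\<And>\<xi>. \<xi> \<in> F \<Longrightarrow> \<xi> \<noteq> 0 \<Longrightarrow> real (card (A \<oplus> (*) \<xi> ` A)) \<le> T"
  shows "min (real (card F)) ((real (card A))\<^sup>2) \<le> 4 * T"
proof -
  define q a where "q = real (card F)" and "a = real (card A)"
  have finA: "finite A" using A finite_F finite_subset by blast
  have q2: "q \<ge> 2" using card_F_ge_2 by (simp add: q_def)
  have a0: "a > 0" using A finA by (simp add: a_def card_gt_0_iff)
  have "e \<in> F" "e \<noteq> 0" using e_in e_nonzero by auto
  then have T0: "T \<ge> 0" using T[of e] by (meson of_nat_0_le_iff order_trans)
  define E where "E \<xi> = card {(s, t) \<in> (A \<times> A) \<times> (A \<times> A). fst s + \<xi> * snd s = fst t + \<xi> * snd t}" for \<xi>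
  have lower: "a ^ 4 \<le> T * real (E \<xi>)" if "\<xi> \<in> F" "\<xi> \<noteq> 0" for \<xi>
  proof -
    have im: "(\<lambda>s. fst s + \<xi> * snd s) ` (A \<times> A) = A \<oplus> (*) \<xi> ` A"
      by (force simp: sumset_def image_iff)
    have "(card (A \<times> A))\<^sup>2 \<le> card (A \<oplus> (*) \<xi> ` A) * E \<xi>"
      using card_image_energy[of "A \<times> A" "\<lambda>s. fst s + \<xi> * snd s"] finA by (simp add: im E_def)
    then have "(real (card (A \<times> A)))\<^sup>2 \<le> real (card (A \<oplus> (*) \<xi> ` A)) * real (E \<xi>)"
      by (metis of_nat_le_iff of_nat_mult of_nat_power)
    also have "\<dots> \<le> T * real (E \<xi>)" using T[OF that] by (intro mult_right_mono) auto
    finally show ?thesis by (simp add: a_def card_cartesian_product power_mult_distrib flip: power_add)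
  qed
  have upper: "(\<Sum>\<xi>\<in>F. real (E \<xi>)) \<le> q * a\<^sup>2 + a ^ 4"
  proof -
    let ?P = "(A \<times> A) \<times> (A \<times> A)"
    have "real (E \<xi>) = (\<Sum>z\<in>?P. of_bool (fst (fst z) + \<xi> * snd (fst z) = fst (snd z) + \<xi> * snd (snd z)))" for \<xi>
    proof -
      have "{(s, t) \<in> ?P. fst s + \<xi> * snd s = fst t + \<xi> * snd t} =
        {z \<in> ?P. fst (fst z) + \<xi> * snd (fst z) = fst (snd z) + \<xi> * snd (snd z)}" by auto
      then show ?thesis unfolding E_def using finA real_card_of_bool[of ?P] by simp
    qed
    then have "(\<Sum>\<xi>\<in>F. real (E \<xi>)) =
      (\<Sum>\<xi>\<in>F. \<Sum>z\<in>?P. of_bool (fst (fst z) + \<xi> * snd (fst z) = fst (snd z) + \<xi> * snd (snd z)))" by simp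
    also have "\<dots> = (\<Sum>z\<in>?P. \<Sum>\<xi>\<in>F. of_bool (fst (fst z) + \<xi> * snd (fst z) = fst (snd z) + \<xi> * snd (snd z)))"
      by (rule sum.swap)
    also have "\<dots> \<le> (\<Sum>z\<in>?P. q * of_bool (fst z = snd z) + 1)"
    proof (rule sum_mono)
      fix z assume z: "z \<in> ?P"
      let ?S = "{\<xi> \<in> F. fst (fst z) + \<xi> * snd (fst z) = fst (snd z) + \<xi> * snd (snd z)}"
      have "(\<Sum>\<xi>\<in>F. of_bool (fst (fst z) + \<xi> * snd (fst z) = fst (snd z) + \<xi> * snd (snd z))) = real (card ?S)"
        using finite_F by (simp add: real_card_of_bool)
      also have "\<dots> \<le> q * of_bool (fst z = snd z) + 1"
      proof (cases "fst z = snd z")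
        case True
        have "card ?S \<le> card F" using finite_F by (intro card_mono) auto
        then show ?thesis using True by (simp add: q_def)
      next
        case False
        have "x = y" if xy: "x \<in> ?S" "y \<in> ?S" for x y
        proof -
          define c where "c = snd (fst z) - snd (snd z)"
          have "snd (fst z) \<in> F" "snd (snd z) \<in> F" using z A by auto
          then have "c \<in> F" unfolding c_def by (rule diff_closed)
          have cx: "c * x = fst (snd z) - fst (fst z)" "c * y = fst (snd z) - fst (fst z)"
            using xy unfolding c_def by (auto simp: algebra_simps)
          have "c \<noteq> 0"
          proof
            assume "c = 0"
            then have "fst z = snd z" using cx(1) unfolding c_def by (auto simp: prod_eq_iff)
            then show False using False by blast
          qed
          then show "x = y" using mult_cancel[OF \<open>c \<in> F\<close>] xy cx by auto
        qed
        then have "card ?S \<le> Suc 0" using finite_F by (subst card_le_Suc0_iff_eq) auto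
        then show ?thesis using False by simp
      qed
      finally show "(\<Sum>\<xi>\<in>F. of_bool (fst (fst z) + \<xi> * snd (fst z) = fst (snd z) + \<xi> * snd (snd z))) \<le> q * of_bool (fst z = snd z) + 1" .
    qed
    also have "\<dots> = q * (\<Sum>z\<in>?P. of_bool (fst z = snd z)) + real (card ?P)"
      by (simp only: sum.distrib sum_distrib_left[symmetric]) simp
    also have "(\<Sum>z\<in>?P. of_bool (fst z = snd z) :: real) = real (card {z \<in> ?P. fst z = snd z})"
      using finA by (intro real_card_of_bool[symmetric]) auto
    also have "{z \<in> ?P. fst z = snd z} = (\<lambda>s. (s, s)) ` (A \<times> A)" by auto
    also have "card \<dots> = card (A \<times> A)" by (simp add: card_image inj_on_def)
    finally show ?thesis by (simp add: a_def card_cartesian_product power2_eq_square eval_nat_numeral mult_ac)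
  qed
  have "(q - 1) * a ^ 4 = (\<Sum>\<xi>\<in>F - {0}. a ^ 4)"
    using zero_in finite_F card_F_ge_2 by (simp add: card_Diff_singleton q_def of_nat_diff)
  also have "\<dots> \<le> (\<Sum>\<xi>\<in>F - {0}. T * real (E \<xi>))" using lower by (intro sum_mono) auto
  also have "\<dots> \<le> (\<Sum>\<xi>\<in>F. T * real (E \<xi>))" using T0 finite_F by (intro sum_mono2) auto
  also have "\<dots> = T * (\<Sum>\<xi>\<in>F. real (E \<xi>))" by (simp add: sum_distrib_left)
  also have "\<dots> \<le> T * (q * a\<^sup>2 + a ^ 4)" using upper T0 by (intro mult_left_mono)
  finally have "(q - 1) * a\<^sup>2 * a\<^sup>2 \<le> T * (q + a\<^sup>2) * a\<^sup>2" by (simp add: eval_nat_numeral algebra_simps)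
  then have "(q - 1) * a\<^sup>2 \<le> T * (q + a\<^sup>2)" using a0 by simp
  moreover have "q * a\<^sup>2 \<le> 2 * ((q - 1) * a\<^sup>2)"
    using mult_right_mono[of 2 q "a\<^sup>2"] q2 by (simp add: algebra_simps)
  ultimately have main: "q * a\<^sup>2 \<le> 2 * T * (q + a\<^sup>2)" by linarith
  show ?thesis
  proof (cases "q \<le> a\<^sup>2")
    case True
    have "q * a\<^sup>2 \<le> 2 * T * (a\<^sup>2 + a\<^sup>2)" using main True T0 by (smt (verit) mult_left_mono)
    then have "q * a\<^sup>2 \<le> (4 * T) * a\<^sup>2" by simp
    then have "q \<le> 4 * T" using a0 by simp
    then show ?thesis by (simp add: q_def)
  next
    case False
    have "q * a\<^sup>2 \<le> 2 * T * (q + q)" using main False T0 by (smt (verit) mult_left_mono)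
    then have "q * a\<^sup>2 \<le> q * (4 * T)" by (simp add: mult_ac)
    then have "a\<^sup>2 \<le> 4 * T" using q2 by simp
    then show ?thesis by (simp add: a_def)
  qed
qed

text \<open>
  The sum-product phenomenon in the form in which it is used: a set whose difference set is almost
  stabilised by more multipliers than the \<open>2\<^sup>j\<close>-th root of \<open>|F|\<close> has very few elements or almost \<open>|F|\<close>.
  Iterating the pivot reaches every \<open>\<xi> = u / v\<close> as a quotient of almost stabilisers, and
  \<open>|A \<oplus> \<xi> A| = |v A \<oplus> u A|\<close> is then small.
\<close>

lemma almost_stabilised_small_or_large:
  fixes M :: real
  assumes A: "A \<subseteq> F" "A \<noteq> {}" and M: "M \<ge> 1"
    and dbl: "real (card (A \<ominus> A)) \<le> M * card A" and PP: "covers M ((A \<ominus> A) \<oplus> (A \<ominus> A)) (A \<ominus> A)"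
    and B: "B \<subseteq> F" "card B \<ge> 2" "\<And>b. b \<in> B \<Longrightarrow> almost_stabilises M b (A \<ominus> A)"
    and j: "card B ^ (2 ^ j) > card F"
  shows "min (real (card F)) ((real (card A))\<^sup>2) \<le> 4 * (M ^ (8 * 13 ^ j) * card A)"
proof (rule dilate_expansion[OF A])
  fix \<xi> assume \<xi>: "\<xi> \<in> F" "\<xi> \<noteq> 0"
  define P where "P = A \<ominus> A"
  have finA: "finite A" using A finite_F finite_subset by blast
  have P: "uminus ` P = P" "finite P" using finA by (simp_all add: P_def uminus_diffset_self)
  have "\<exists>B'\<subseteq>F. card B' \<ge> 2 \<and> (\<forall>b\<in>B'. almost_stabilises (M ^ (13 ^ j)) b P) \<and>
      (quotients B' = F \<or> card B' \<ge> card B ^ (2 ^ j))"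
    by (rule pivot_iterate[OF PP[folded P_def] P(1) B(1,2) M order.refl]) (rule B(3)[folded P_def])
  then obtain B' where B': "B' \<subseteq> F" and st: "\<And>b. b \<in> B' \<Longrightarrow> almost_stabilises (M ^ (13 ^ j)) b P"
    and alt: "quotients B' = F \<or> card B' \<ge> card B ^ (2 ^ j)"
    by metis
  have "card B' \<le> card F" using B' finite_F by (simp add: card_mono)
  then have "quotients B' = F" using alt j by linarith
  then obtain b1 b2 b3 b4 where b: "b1 \<in> B'" "b2 \<in> B'" "b3 \<in> B'" "b4 \<in> B'" "b3 \<noteq> b4" "\<xi> * (b3 - b4) = b1 - b2"
    using \<xi> unfolding quotients_def by blast
  define u v N where "u = b1 - b2" and "v = b3 - b4" and "N = M ^ (13 ^ j)"
  have N: "N \<ge> 1" "M \<le> N" using M by (auto simp: N_def self_le_power)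
  have v: "v \<in> F" "v \<noteq> 0" using b B' diff_closed by (auto simp: v_def)
  have su: "almost_stabilises (N * N * M) u P" and sv: "almost_stabilises (N * N * M) v P"
    unfolding u_def v_def N_def using b st PP P by (auto simp: P_def intro!: almost_stabilises_diff)
  have "covers ((N * N * M) * (N * N * M)) ((*) v ` P \<oplus> (*) u ` P) (P \<oplus> P)"
    using su sv covers_sumset unfolding almost_stabilises_def by blast
  then have cov: "covers ((N * N * M) * (N * N * M) * M) ((*) v ` P \<oplus> (*) u ` P) P"
    using PP covers_trans unfolding P_def by blast
  obtain a where a: "a \<in> A" using A by blast
  define T where "T = A \<oplus> (*) \<xi> ` A"
  have TF: "T \<subseteq> F" using A \<xi> unfolding T_def by (auto elim!: sumsetE intro!: add_closed mult_closed)
  have "(\<lambda>x. x - (v * a + u * a)) ` ((*) v ` T) \<subseteq> (*) v ` P \<oplus> (*) u ` P"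
  proof
    fix y assume "y \<in> (\<lambda>x. x - (v * a + u * a)) ` ((*) v ` T)"
    then obtain s t where st: "s \<in> A" "t \<in> A" "y = v * (s + \<xi> * t) - (v * a + u * a)"
      by (auto simp: T_def)
    have "v * (\<xi> * t) = u * t" using b(6) by (metis mult.assoc mult.commute u_def v_def)
    then have "y = v * (s - a) + u * (t - a)" using st(3) by (simp add: algebra_simps)
    then show "y \<in> (*) v ` P \<oplus> (*) u ` P" using st a by (auto simp: P_def)
  qed
  then have "card ((\<lambda>x. x - (v * a + u * a)) ` ((*) v ` T)) \<le> card ((*) v ` P \<oplus> (*) u ` P)"
    using P(2) by (intro card_mono) auto
  moreover have "card ((\<lambda>x. x - (v * a + u * a)) ` ((*) v ` T)) = card T"
    using card_mult[OF v TF] by (simp add: card_image inj_on_def)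
  ultimately have "real (card T) \<le> real (card ((*) v ` P \<oplus> (*) u ` P))" by simp
  also have "\<dots> \<le> ((N * N * M) * (N * N * M) * M) * card P" by (rule covers_card[OF cov P(2)])
  also have "\<dots> \<le> ((N * N * M) * (N * N * M) * M) * (M * card A)"
    using dbl M N unfolding P_def by (intro mult_left_mono) auto
  also have "\<dots> = (N ^ 4 * M ^ 4) * card A" by (simp add: eval_nat_numeral)
  also have "\<dots> \<le> (N ^ 4 * N ^ 4) * card A"
    using M N by (intro mult_right_mono mult_left_mono power_mono) auto
  also have "N ^ 4 * N ^ 4 = M ^ (8 * 13 ^ j)" by (simp add: N_def mult.commute flip: power_add power_mult)
  finally show "real (card (A \<oplus> (*) \<xi> ` A)) \<le> M ^ (8 * 13 ^ j) * card A" by (simp add: T_def)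
qed

end

section \<open>The large spectrum of a multiplicative subgroup\<close>

locale prime_field_character = embedded_prime_field F e
  for F :: "'a::comm_ring_1 set" and e :: 'a +
  fixes \<chi> :: "'a \<Rightarrow> complex"
  assumes chi_add: "x \<in> F \<Longrightarrow> y \<in> F \<Longrightarrow> \<chi> (x + y) = \<chi> x * \<chi> y"
    and norm_chi [simp]: "x \<in> F \<Longrightarrow> norm (\<chi> x) = 1"
    and chi_orthogonal: "a \<in> F \<Longrightarrow> a \<noteq> 0 \<Longrightarrow> (\<Sum>x\<in>F. \<chi> (a * x)) = 0"
begin

lemma chi_0 [simp]: "\<chi> 0 = 1"
proof -
  have "\<chi> 0 * \<chi> 0 = \<chi> 0" using chi_add[OF zero_in zero_in] by simp
  moreover have "\<chi> 0 \<noteq> 0" using norm_chi[OF zero_in] by auto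
  ultimately show ?thesis by simp
qed

lemma chi_diff: assumes "x \<in> F" "y \<in> F" shows "\<chi> (x - y) = \<chi> x * cnj (\<chi> y)"
proof -
  have "\<chi> y * cnj (\<chi> y) = 1" using assms by (simp add: complex_norm_square[symmetric])
  moreover have "\<chi> x = \<chi> (x - y) * \<chi> y" using chi_add[OF diff_closed[OF assms] assms(2)] by simp
  ultimately show ?thesis by simp
qed

definition mult_subgroup :: "'a set \<Rightarrow> bool" where
  "mult_subgroup H \<longleftrightarrow> H \<subseteq> F \<and> 0 \<notin> H \<and> e \<in> H \<and> (\<forall>x\<in>H. \<forall>y\<in>H. x * y \<in> H)"

definition char_sum :: "'a set \<Rightarrow> 'a \<Rightarrow> complex" where
  "char_sum H a = (\<Sum>h\<in>H. \<chi> (a * h))"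

definition spectrum :: "'a set \<Rightarrow> real \<Rightarrow> 'a set" where
  "spectrum H t = {a \<in> F. norm (char_sum H a) \<ge> t * card H}"

lemma finite_spectrum [simp]: "finite (spectrum H t)"
  using finite_F by (simp add: spectrum_def)

lemma spectrum_subset: "spectrum H t \<subseteq> F" by (auto simp: spectrum_def)

lemma spectrum_antimono: "s \<le> t \<Longrightarrow> spectrum H t \<subseteq> spectrum H s"
  unfolding spectrum_def by (auto intro: order_trans[OF mult_right_mono])

lemma subgroup_mult_image:
  assumes "mult_subgroup H" "h \<in> H" shows "(*) h ` H = H"
proof -
  have H: "H \<subseteq> F" "finite H" "h \<in> F" "h \<noteq> 0"
    using assms finite_F finite_subset unfolding mult_subgroup_def by auto
  have "(*) h ` H \<subseteq> H" using assms unfolding mult_subgroup_def by auto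
  then show ?thesis using card_mult[OF H(3,4,1)] H(2) by (intro card_subset_eq) auto
qed

lemma subgroup_inverse:
  assumes "mult_subgroup H" "h \<in> H" obtains k where "k \<in> H" "k * h = e"
proof -
  have "e \<in> (*) h ` H" using subgroup_mult_image[OF assms] assms unfolding mult_subgroup_def by simp
  then show thesis using that by (auto simp: mult.commute)
qed

lemma char_sum_invariant:
  assumes "mult_subgroup H" "h \<in> H" "a \<in> F" shows "char_sum H (h * a) = char_sum H a"
proof -
  have H: "H \<subseteq> F" "h \<in> F" "h \<noteq> 0" using assms unfolding mult_subgroup_def by auto
  have "char_sum H a = (\<Sum>x\<in>(*) h ` H. \<chi> (a * x))"
    by (simp add: char_sum_def subgroup_mult_image[OF assms(1,2)])
  also have "\<dots> = (\<Sum>x\<in>H. \<chi> (a * (h * x)))" by (subst sum.reindex[OF inj_mult[OF H(2,3,1)]]) simp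
  finally show ?thesis by (simp add: char_sum_def mult_ac)
qed

lemma spectrum_invariant:
  assumes "mult_subgroup H" "h \<in> H" "a \<in> spectrum H t" shows "h * a \<in> spectrum H t"
  using assms char_sum_invariant[OF assms(1,2), of a] unfolding spectrum_def mult_subgroup_def
  by (auto intro: mult_closed)

lemma sum_norm_char_sum:
  assumes "H \<subseteq> F" shows "(\<Sum>a\<in>F. (norm (char_sum H a))\<^sup>2) = real (card F) * card H"
proof -
  have finH: "finite H" using assms finite_F finite_subset by blast
  have "complex_of_real (\<Sum>a\<in>F. (norm (char_sum H a))\<^sup>2) = (\<Sum>a\<in>F. char_sum H a * cnj (char_sum H a))"
    by (simp only: of_real_sum complex_norm_square)
  also have "\<dots> = (\<Sum>a\<in>F. \<Sum>h\<in>H. \<Sum>k\<in>H. \<chi> ((h - k) * a))"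
  proof (rule sum.cong[OF refl])
    fix a assume a: "a \<in> F"
    have "char_sum H a * cnj (char_sum H a) = (\<Sum>h\<in>H. \<Sum>k\<in>H. \<chi> (a * h) * cnj (\<chi> (a * k)))"
      by (simp add: char_sum_def sum_product)
    also have "\<dots> = (\<Sum>h\<in>H. \<Sum>k\<in>H. \<chi> ((h - k) * a))"
    proof (intro sum.cong refl)
      fix h k assume "h \<in> H" "k \<in> H"
      then have "a * h \<in> F" "a * k \<in> F" using a assms mult_closed by auto
      then show "\<chi> (a * h) * cnj (\<chi> (a * k)) = \<chi> ((h - k) * a)"
        by (simp add: chi_diff[symmetric] algebra_simps)
    qed
    finally show "char_sum H a * cnj (char_sum H a) = (\<Sum>h\<in>H. \<Sum>k\<in>H. \<chi> ((h - k) * a))" .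
  qed
  also have "\<dots> = (\<Sum>h\<in>H. \<Sum>a\<in>F. \<Sum>k\<in>H. \<chi> ((h - k) * a))" by (rule sum.swap)
  also have "\<dots> = (\<Sum>h\<in>H. \<Sum>k\<in>H. \<Sum>a\<in>F. \<chi> ((h - k) * a))" by (intro sum.cong refl sum.swap)
  also have "\<dots> = (\<Sum>h\<in>H. \<Sum>k\<in>H. if h = k then of_nat (card F) else 0)"
  proof (intro sum.cong refl)
    fix h k assume "h \<in> H" "k \<in> H"
    then have "h - k \<in> F" using assms diff_closed by blast
    then show "(\<Sum>a\<in>F. \<chi> ((h - k) * a)) = (if h = k then of_nat (card F) else 0)"
      using chi_orthogonal[of "h - k"] by auto
  qed
  also have "\<dots> = complex_of_real (real (card F) * card H)" using finH by simp
  finally show ?thesis by (simp only: of_real_eq_iff)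
qed

text \<open>
  Parseval's identity limits the number of large values.
\<close>

lemma card_spectrum:
  assumes "mult_subgroup H" "t > 0"
  shows "real (card (spectrum H t)) * t\<^sup>2 * card H \<le> card F"
proof -
  have H: "H \<subseteq> F" "e \<in> H" using assms by (auto simp: mult_subgroup_def)
  then have "card H > 0" using finite_F finite_subset card_gt_0_iff by blast
  have "real (card (spectrum H t)) * (t * card H)\<^sup>2 = (\<Sum>a\<in>spectrum H t. (t * card H)\<^sup>2)" by simp
  also have "\<dots> \<le> (\<Sum>a\<in>spectrum H t. (norm (char_sum H a))\<^sup>2)"
    using assms by (intro sum_mono power_mono) (auto simp: spectrum_def)
  also have "\<dots> \<le> (\<Sum>a\<in>F. (norm (char_sum H a))\<^sup>2)"
    using finite_F spectrum_subset by (intro sum_mono2) auto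
  also have "\<dots> = real (card F) * card H" by (rule sum_norm_char_sum[OF H(1)])
  finally have "(real (card (spectrum H t)) * t\<^sup>2 * card H) * card H \<le> real (card F) * card H"
    by (simp add: power_mult_distrib power2_eq_square mult_ac)
  then show ?thesis using \<open>card H > 0\<close> by simp
qed

text \<open>
  After multiplication by unimodular coefficients \<open>c a\<close> the values \<open>char_sum H a\<close>, \<open>a \<in> L\<close>, add up without
  cancellation. Exchanging the sums and applying Cauchy-Schwarz over \<open>H\<close> turns them into values at the
  differences \<open>a - b\<close>, whose average over \<open>L \<times> L\<close> is therefore large.
\<close>

lemma spectrum_differences:
  assumes H: "mult_subgroup H" and t: "t > 0" and L: "L \<subseteq> spectrum H t"
  shows "real (card {(a, b) \<in> L \<times> L. a - b \<in> spectrum H (t\<^sup>2 / 2)}) \<ge> t\<^sup>2 / 2 * (real (card L))\<^sup>2"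
proof -
  have HF: "H \<subseteq> F" "e \<in> H" using H by (auto simp: mult_subgroup_def)
  have finH: "finite H" using HF finite_F finite_subset by blast
  have cH: "real (card H) > 0" using finH HF by (auto simp: card_gt_0_iff)
  have LF: "L \<subseteq> F" using L spectrum_subset by blast
  have finL: "finite L" using LF finite_F finite_subset by blast
  define l n where "l = real (card L)" and "n = real (card H)"
  define c where "c a = cnj (sgn (char_sum H a))" for a
  have nc: "norm (c a) \<le> 1" for a by (simp add: c_def norm_sgn)
  have cS: "c a * char_sum H a = norm (char_sum H a)" for a
  proof (cases "char_sum H a = 0")
    case False
    define z where "z = char_sum H a"
    have "cnj (sgn z) * z = (z * cnj z) / norm z"
      by (simp add: sgn_div_norm scaleR_conv_of_real divide_inverse mult_ac)
    also have "\<dots> = norm z" using False by (simp add: complex_norm_square[symmetric] power2_eq_square z_def)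
    finally show ?thesis by (simp add: c_def z_def)
  qed simp
  have "l * (t * n) = (\<Sum>a\<in>L. t * n)" by (simp add: l_def)
  also have "\<dots> \<le> (\<Sum>a\<in>L. norm (char_sum H a))"
    using L by (intro sum_mono) (auto simp: spectrum_def n_def)
  also have "\<dots> \<le> norm (\<Sum>a\<in>L. complex_of_real (norm (char_sum H a)))"
    by (metis complex_Re_le_cmod Re_complex_of_real of_real_sum)
  also have "(\<Sum>a\<in>L. complex_of_real (norm (char_sum H a))) = (\<Sum>a\<in>L. \<Sum>h\<in>H. c a * \<chi> (a * h))"
    unfolding cS[symmetric] by (simp add: char_sum_def sum_distrib_left)
  also have "\<dots> = (\<Sum>h\<in>H. \<Sum>a\<in>L. c a * \<chi> (a * h))" by (rule sum.swap)
  also have "norm \<dots> \<le> (\<Sum>h\<in>H. norm (\<Sum>a\<in>L. c a * \<chi> (a * h)))" by (rule norm_sum)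
  finally have 1: "l * (t * n) \<le> (\<Sum>h\<in>H. norm (\<Sum>a\<in>L. c a * \<chi> (a * h)))" .
  have "(l * (t * n))\<^sup>2 \<le> (\<Sum>h\<in>H. norm (\<Sum>a\<in>L. c a * \<chi> (a * h)))\<^sup>2"
    using 1 t by (intro power_mono) (auto simp: l_def n_def)
  also have "\<dots> \<le> (\<Sum>h\<in>H. (norm (\<Sum>a\<in>L. c a * \<chi> (a * h)))\<^sup>2) * n"
    unfolding n_def by (rule sum_squared_le_sum_of_squares)
  also have "(\<Sum>h\<in>H. (norm (\<Sum>a\<in>L. c a * \<chi> (a * h)))\<^sup>2) \<le> (\<Sum>a\<in>L. \<Sum>b\<in>L. norm (char_sum H (a - b)))"
  proof -
    have "complex_of_real (\<Sum>h\<in>H. (norm (\<Sum>a\<in>L. c a * \<chi> (a * h)))\<^sup>2) =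
        (\<Sum>h\<in>H. \<Sum>a\<in>L. \<Sum>b\<in>L. c a * cnj (c b) * \<chi> ((a - b) * h))"
      unfolding of_real_sum
    proof (rule sum.cong[OF refl])
      fix h assume h: "h \<in> H"
      have "complex_of_real ((norm (\<Sum>a\<in>L. c a * \<chi> (a * h)))\<^sup>2) =
         (\<Sum>a\<in>L. \<Sum>b\<in>L. (c a * \<chi> (a * h)) * cnj (c b * \<chi> (b * h)))"
        by (simp only: complex_norm_square sum_product cnj_sum)
      also have "\<dots> = (\<Sum>a\<in>L. \<Sum>b\<in>L. c a * cnj (c b) * \<chi> ((a - b) * h))"
      proof (intro sum.cong refl)
        fix a b assume "a \<in> L" "b \<in> L"
        then have "a * h \<in> F" "b * h \<in> F" using LF HF h mult_closed by auto
        then have "\<chi> ((a - b) * h) = \<chi> (a * h) * cnj (\<chi> (b * h))"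
          unfolding left_diff_distrib by (rule chi_diff)
        then show "(c a * \<chi> (a * h)) * cnj (c b * \<chi> (b * h)) = c a * cnj (c b) * \<chi> ((a - b) * h)"
          by simp
      qed
      finally show "complex_of_real ((norm (\<Sum>a\<in>L. c a * \<chi> (a * h)))\<^sup>2) =
         (\<Sum>a\<in>L. \<Sum>b\<in>L. c a * cnj (c b) * \<chi> ((a - b) * h))" .
    qed
    also have "\<dots> = (\<Sum>a\<in>L. \<Sum>h\<in>H. \<Sum>b\<in>L. c a * cnj (c b) * \<chi> ((a - b) * h))" by (rule sum.swap)
    also have "\<dots> = (\<Sum>a\<in>L. \<Sum>b\<in>L. \<Sum>h\<in>H. c a * cnj (c b) * \<chi> ((a - b) * h))"
      by (intro sum.cong refl sum.swap)
    also have "\<dots> = (\<Sum>a\<in>L. \<Sum>b\<in>L. c a * cnj (c b) * char_sum H (a - b))"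
      by (simp add: char_sum_def sum_distrib_left)
    finally have eq: "complex_of_real (\<Sum>h\<in>H. (norm (\<Sum>a\<in>L. c a * \<chi> (a * h)))\<^sup>2) =
       (\<Sum>a\<in>L. \<Sum>b\<in>L. c a * cnj (c b) * char_sum H (a - b))" .
    have "(\<Sum>h\<in>H. (norm (\<Sum>a\<in>L. c a * \<chi> (a * h)))\<^sup>2) \<le> norm (complex_of_real (\<Sum>h\<in>H. (norm (\<Sum>a\<in>L. c a * \<chi> (a * h)))\<^sup>2))"
      by (simp only: norm_of_real abs_ge_self)
    also have "\<dots> \<le> (\<Sum>a\<in>L. \<Sum>b\<in>L. norm (c a * cnj (c b) * char_sum H (a - b)))"
      unfolding eq by (intro order.trans[OF norm_sum] sum_mono norm_sum)
    also have "\<dots> \<le> (\<Sum>a\<in>L. \<Sum>b\<in>L. norm (char_sum H (a - b)))"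
    proof (intro sum_mono)
      fix a b
      have "norm (c a) * norm (c b) \<le> 1 * 1" using nc by (intro mult_mono) auto
      then show "norm (c a * cnj (c b) * char_sum H (a - b)) \<le> norm (char_sum H (a - b))"
        by (simp add: norm_mult mult_left_le_one_le)
    qed
    finally show ?thesis .
  qed
  finally have "n * (l\<^sup>2 * t\<^sup>2 * n) \<le> n * (\<Sum>a\<in>L. \<Sum>b\<in>L. norm (char_sum H (a - b)))"
    by (simp add: n_def power_mult_distrib power2_eq_square mult_ac mult_right_mono)
  then have 2: "l\<^sup>2 * t\<^sup>2 * n \<le> (\<Sum>a\<in>L. \<Sum>b\<in>L. norm (char_sum H (a - b)))"
    using cH by (simp add: n_def)
  let ?E = "{(a, b) \<in> L \<times> L. a - b \<in> spectrum H (t\<^sup>2 / 2)}"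
  have norm_le: "norm (char_sum H a) \<le> n" if "a \<in> F" for a
    unfolding char_sum_def n_def using HF that mult_closed
    by (intro order.trans[OF norm_sum]) (simp add: subset_iff)
  have "(\<Sum>a\<in>L. \<Sum>b\<in>L. norm (char_sum H (a - b))) = (\<Sum>z\<in>L \<times> L. norm (char_sum H (fst z - snd z)))"
    by (simp add: sum.cartesian_product case_prod_beta)
  also have "\<dots> \<le> (\<Sum>z\<in>L \<times> L. n * of_bool (z \<in> ?E) + t\<^sup>2 / 2 * n)"
  proof (rule sum_mono)
    fix z assume z: "z \<in> L \<times> L"
    then have "fst z \<in> F" "snd z \<in> F" using LF by auto
    then have zF: "fst z - snd z \<in> F" by (rule diff_closed)
    show "norm (char_sum H (fst z - snd z)) \<le> n * of_bool (z \<in> ?E) + t\<^sup>2 / 2 * n"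
    proof (cases "z \<in> ?E")
      case True
      then show ?thesis using norm_le[OF zF] t cH by (simp add: n_def add_increasing2)
    next
      case False
      then have "fst z - snd z \<notin> spectrum H (t\<^sup>2 / 2)" using z by auto
      then show ?thesis using zF False by (simp add: spectrum_def n_def)
    qed
  qed
  also have "\<dots> = n * (\<Sum>z\<in>L \<times> L. of_bool (z \<in> ?E)) + t\<^sup>2 / 2 * n * l\<^sup>2"
    by (simp only: sum.distrib sum_distrib_left[symmetric]) (simp add: l_def card_cartesian_product power2_eq_square)
  also have "(\<Sum>z\<in>L \<times> L. of_bool (z \<in> ?E) :: real) = real (card {z \<in> L \<times> L. z \<in> ?E})"
    using finL by (intro real_card_of_bool[symmetric]) auto
  also have "{z \<in> L \<times> L. z \<in> ?E} = ?E" by auto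
  finally have "n * (t\<^sup>2 / 2 * l\<^sup>2) \<le> n * real (card ?E)" using 2 by (simp add: algebra_simps)
  then show ?thesis using cH unfolding n_def l_def by simp
qed

text \<open>
  The spectrum \<open>L\<close> and the spectrum with threshold \<open>t\<^sup>2 / 2\<close>, which contains many differences of \<open>L\<close>, have
  comparable size, so the theorem of Balog, Szemeredi and Gowers provides a subset \<open>A\<close> of \<open>L\<close> with small difference set.
  Since \<open>h A \<subseteq> L\<close> for all \<open>h \<in> H\<close> and \<open>A\<close> is a large part of \<open>L\<close>, many \<open>h A\<close> have a large intersection
  with \<open>A\<close>; such \<open>h\<close> almost stabilise \<open>A \<ominus> A\<close>. Every loss is a power of \<open>Q\<close>, and \<open>Q \<ge> 4096\<close> absorbs
  the numerical constants.
\<close>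

lemma spectrum_tiny_or_huge:
  fixes Q t :: real
  assumes H: "mult_subgroup H" and t: "t > 0" and L: "L = spectrum H t" "L \<noteq> {}"
    and Q: "Q \<ge> 4096" "1 / Q \<le> t\<^sup>2 / 2" and D: "real (card (spectrum H (t\<^sup>2 / 2))) \<le> Q * card L"
    and big: "real (card H) / Q ^ 3 \<ge> 2" "(real (card H) / Q ^ 3) ^ (2 ^ j) > card F"
  shows "card L \<le> Q ^ (440 * 13 ^ j + 3) \<or> card F \<le> Q ^ (440 * 13 ^ j + 1) * card L"
proof -
  have HF: "H \<subseteq> F" "e \<in> H" "0 \<notin> H" using H by (auto simp: mult_subgroup_def)
  have finH: "finite H" using HF finite_F finite_subset by blast
  have finL: "finite L" by (simp add: L)
  have Q0: "Q > 0" "Q \<ge> 1" using Q by auto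
  have "(real (card L))\<^sup>2 / Q \<le> t\<^sup>2 / 2 * (real (card L))\<^sup>2"
    using mult_right_mono[OF Q(2), of "(real (card L))\<^sup>2"] by simp
  then have dense: "real (card {(a, b) \<in> L \<times> L. a - b \<in> spectrum H (t\<^sup>2 / 2)}) \<ge> (real (card L))\<^sup>2 / Q"
    using spectrum_differences[OF H t order.refl, folded L(1)] by linarith
  obtain A where A: "A \<subseteq> L" "card L \<le> 4 * Q * card A" "card (A \<ominus> A) \<le> 4096 * Q ^ 10 * card A"
    using balog_szemeredi_gowers[OF finL L(2) finite_spectrum D Q0(1) dense] by blast
  define a where "a = real (card A)"
  have finA: "finite A" using A finL finite_subset by blast
  have AF: "A \<subseteq> F" using A L spectrum_subset by blast
  have Ane: "A \<noteq> {}" using A(2) L finL by auto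
  have a0: "a > 0" using Ane finA by (simp add: a_def card_gt_0_iff)
  have LA: "card L \<le> Q\<^sup>2 * a"
  proof -
    have "4 * Q * a \<le> Q * Q * a" using Q a0 by (intro mult_right_mono) auto
    then show ?thesis using A(2) by (simp add: a_def power2_eq_square)
  qed
  have AA: "card (A \<ominus> A) \<le> Q ^ 11 * a"
  proof -
    have "4096 * Q ^ 10 * a \<le> Q * Q ^ 10 * a" using Q a0 by (intro mult_right_mono) auto
    then show ?thesis using A(3) by (simp add: a_def flip: power_Suc)
  qed
  define P where "P = A \<ominus> A"
  have P: "finite P" "uminus ` P = P" using finA by (simp_all add: P_def uminus_diffset_self)
  have K11: "Q ^ 11 \<ge> 0" using Q0 by simp
  have AP: "real (card (A \<oplus> P)) \<le> Q ^ 33 * a" and PPA: "real (card (P \<oplus> P \<oplus> A)) \<le> Q ^ 55 * a"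
    using plunnecke_differences[OF finA Ane AA[unfolded a_def] K11] by (simp_all add: P_def a_def flip: power_mult)
  have PP: "covers (Q ^ 55) (P \<oplus> P) P"
    unfolding P_def by (rule covers_of_card[OF finA Ane]) (use PPA finA in \<open>auto simp: P_def a_def\<close>)
  \<comment> \<open>the dilates of \<open>A\<close> by \<open>H\<close> lie in \<open>L\<close>, which is not much larger than \<open>A\<close>, so they meet often;
      division by one of the two multipliers makes one of the two dilates equal to \<open>A\<close>\<close>
  define I where "I h = {x \<in> A. h * x \<in> A}" for h
  have finI: "finite (I h)" for h using finA by (simp add: I_def)
  have energy: "real (card H) * a\<^sup>2 \<le> card L * (\<Sum>h\<in>H. real (card (I h)))"
  proof -
    let ?f = "\<lambda>(h, x). h * x"
    let ?E = "{(s, u) \<in> (H \<times> A) \<times> (H \<times> A). ?f s = ?f u}"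
    have "?f ` (H \<times> A) \<subseteq> L" using A spectrum_invariant[OF H] by (auto simp: L)
    then have cL: "card (?f ` (H \<times> A)) \<le> card L" using finL by (simp add: card_mono)
    have "\<forall>h\<in>H. \<exists>k\<in>H. k * h = e" using subgroup_inverse[OF H] by metis
    then obtain iv where iv: "\<And>h. h \<in> H \<Longrightarrow> iv h \<in> H \<and> iv h * h = e" by metis
    define g :: "('a \<times> 'a) \<times> ('a \<times> 'a) \<Rightarrow> 'a \<times> ('a \<times> 'a)" where "g = (\<lambda>((h, x), (k, y)). (k, (iv k * h, x)))"
    have inj: "inj_on g ?E"
    proof (rule inj_onI)
      fix s u assume su: "s \<in> ?E" "u \<in> ?E" "g s = g u"
      obtain h x k y where s: "s = ((h, x), (k, y))" by (metis prod.exhaust)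
      obtain h' x' k' y' where u: "u = ((h', x'), (k', y'))" by (metis prod.exhaust)
      have mem: "h \<in> H" "x \<in> A" "k \<in> H" "y \<in> A" "h * x = k * y" "h' \<in> H" "x' \<in> A" "k' \<in> H" "y' \<in> A" "h' * x' = k' * y'"
        using su s u by auto
      have kk: "k' = k" "x' = x" "iv k * h = iv k * h'" using su(3) by (auto simp: g_def s u)
      have F: "h \<in> F" "h' \<in> F" "k \<in> F" "iv k \<in> F" "iv k \<noteq> 0" "k \<noteq> 0" "y \<in> F" "y' \<in> F" using mem HF iv[OF mem(3)] AF by auto
      have "h = h'" using mult_cancel[OF F(4,5,1,2)] kk by simp
      moreover have "y = y'" using mult_cancel[OF F(3,6,7,8)] mem kk \<open>h = h'\<close> by simp
      ultimately show "s = u" using kk s u by simp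
    qed
    have im: "g ` ?E \<subseteq> H \<times> (SIGMA h:H. I h)"
    proof
      fix z assume "z \<in> g ` ?E"
      then obtain h x k y where z: "z = (k, (iv k * h, x))" "h \<in> H" "x \<in> A" "k \<in> H" "y \<in> A" "h * x = k * y"
        by (auto simp: g_def)
      have "iv k * h * x = (iv k * k) * y" using z(6) by (simp add: mult.assoc)
      also have "\<dots> = e * y" using iv[OF z(4)] by simp
      also have "\<dots> = y" using z(5) AF by (intro e_mult) auto
      finally have "iv k * h * x \<in> A" using z by simp
      moreover have "iv k * h \<in> H" using iv z H by (auto simp: mult_subgroup_def)
      ultimately show "z \<in> H \<times> (SIGMA h:H. I h)" using z by (auto simp: I_def)
    qed
    have "card ?E \<le> card (H \<times> (SIGMA h:H. I h))"
      by (rule card_inj_on_le[OF inj im]) (use finH finI in auto)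
    also have "\<dots> = card H * (\<Sum>h\<in>H. card (I h))"
      using finH finI by (simp add: card_cartesian_product card_SigmaI)
    finally have cE: "card ?E \<le> card H * (\<Sum>h\<in>H. card (I h))" .
    have "(card (H \<times> A))\<^sup>2 \<le> card (?f ` (H \<times> A)) * card ?E"
      by (rule card_image_energy) (use finH finA in auto)
    also have "\<dots> \<le> card L * (card H * (\<Sum>h\<in>H. card (I h)))" by (rule mult_mono[OF cL cE]) auto
    finally have "(real (card (H \<times> A)))\<^sup>2 \<le> real (card L * (card H * (\<Sum>h\<in>H. card (I h))))"
      by (metis of_nat_le_iff of_nat_power)
    then have "real (card H) * (real (card H) * a\<^sup>2) \<le> real (card H) * (card L * (\<Sum>h\<in>H. real (card (I h))))"
      by (simp add: a_def card_cartesian_product power2_eq_square mult_ac)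
    moreover have "real (card H) > 0" using finH HF by (auto simp: card_gt_0_iff)
    ultimately show ?thesis by (rule mult_left_le_imp_le)
  qed
  define B where "B = {h \<in> H. real (card (I h)) \<ge> a / (2 * Q\<^sup>2)}"
  have BH: "B \<subseteq> H" by (auto simp: B_def)
  have finB: "finite B" using BH finH finite_subset by blast
  have cB: "real (card H) / Q ^ 3 \<le> card B"
  proof -
    have Ia: "real (card (I h)) \<le> a" for h unfolding a_def by (simp add: card_mono finA I_def)
    have "(\<Sum>h\<in>H. real (card (I h))) \<le> (\<Sum>h\<in>H. a * of_bool (h \<in> B) + a / (2 * Q\<^sup>2))"
      by (intro sum_mono) (use Ia a0 in \<open>auto simp: B_def add_increasing2\<close>)
    also have "\<dots> = a * card B + card H * (a / (2 * Q\<^sup>2))"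
    proof -
      have "{h \<in> H. h \<in> B} = B" using BH by auto
      then have "(\<Sum>h\<in>H. of_bool (h \<in> B) :: real) = card B" using real_card_of_bool[OF finH, of "\<lambda>h. h \<in> B"] by simp
      then show ?thesis by (simp only: sum.distrib sum_distrib_left[symmetric]) simp
    qed
    finally have "(\<Sum>h\<in>H. real (card (I h))) \<le> a * card B + card H * (a / (2 * Q\<^sup>2))" .
    then have "real (card H) * a\<^sup>2 \<le> (Q\<^sup>2 * a) * (a * card B + card H * (a / (2 * Q\<^sup>2)))"
      using energy LA a0 Q0 by (smt (verit) mult_mono of_nat_0_le_iff sum_nonneg)
    also have "\<dots> = a\<^sup>2 * (Q\<^sup>2 * card B + card H / 2)" using Q0 by (simp add: field_simps power2_eq_square)
    finally have "a\<^sup>2 * real (card H) \<le> a\<^sup>2 * (Q\<^sup>2 * card B + card H / 2)" by (simp add: mult.commute)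
    then have "real (card H) \<le> Q\<^sup>2 * card B + card H / 2" using a0 by simp
    then have "real (card H) \<le> 2 * Q\<^sup>2 * card B" by simp
    also have "\<dots> \<le> Q * Q\<^sup>2 * card B" using Q by (intro mult_right_mono) auto
    also have "\<dots> = card B * Q ^ 3" by (simp add: power2_eq_square power3_eq_cube)
    finally show ?thesis using Q0 by (simp add: divide_le_eq)
  qed
  have stab: "almost_stabilises (Q ^ 55) h P" if h: "h \<in> B" for h
  proof -
    have hF: "h \<in> F" "h \<noteq> 0" using h BH HF by auto
    define X where "X = (*) h ` I h"
    have XA: "X \<subseteq> A" "X \<subseteq> (*) h ` A" by (auto simp: X_def I_def)
    have finX: "finite X" using finI by (simp add: X_def)
    have IF: "I h \<subseteq> F" using AF by (auto simp: I_def)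
    have cX: "card X = card (I h)" unfolding X_def by (rule card_mult[OF hF IF])
    have hP: "uminus ` ((*) h ` P) = (*) h ` P"
      using P(2) by (metis (no_types, lifting) image_cong image_image mult_minus_right)
    have "card X * card (A \<ominus> (*) h ` P) \<le> card (A \<ominus> X) * card (X \<ominus> (*) h ` P)"
      using finA finX P by (intro ruzsa_triangle) auto
    also have "\<dots> \<le> card (A \<ominus> A) * card (A \<oplus> P)"
    proof (rule mult_mono)
      show "card (A \<ominus> X) \<le> card (A \<ominus> A)" using XA finA by (intro card_mono diffset_mono) auto
      have "card (X \<ominus> (*) h ` P) \<le> card ((*) h ` A \<ominus> (*) h ` P)"
        using XA finA P by (intro card_mono diffset_mono) auto
      also have "\<dots> \<le> card (A \<ominus> P)" unfolding image_mult_diffset[symmetric]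
        using finA P by (intro card_image_le) auto
      also have "A \<ominus> P = A \<oplus> P" using sumset_uminus[of A P] P by simp
      finally show "card (X \<ominus> (*) h ` P) \<le> card (A \<oplus> P)" .
    qed auto
    finally have "real (card X) * card (A \<ominus> (*) h ` P) \<le> real (card (A \<ominus> A)) * card (A \<oplus> P)"
      by (metis of_nat_le_iff of_nat_mult)
    also have "\<dots> \<le> (Q ^ 11 * a) * (Q ^ 33 * a)" using AA AP a0 Q0 by (intro mult_mono) auto
    also have "\<dots> = Q ^ 44 * a\<^sup>2" by (simp add: power2_eq_square mult_ac flip: power_add)
    finally have 1: "real (card X) * card (A \<ominus> (*) h ` P) \<le> Q ^ 44 * a\<^sup>2" .
    have "a / (2 * Q\<^sup>2) * card (A \<ominus> (*) h ` P) \<le> real (card X) * card (A \<ominus> (*) h ` P)"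
      using h by (intro mult_right_mono) (auto simp: B_def cX)
    then have "a / (2 * Q\<^sup>2) * card (A \<ominus> (*) h ` P) \<le> Q ^ 44 * a\<^sup>2" using 1 by linarith
    then have "a * real (card (A \<ominus> (*) h ` P)) \<le> a * (2 * Q\<^sup>2 * Q ^ 44 * a)"
      using Q0 by (simp add: field_simps power2_eq_square)
    then have "card (A \<ominus> (*) h ` P) \<le> 2 * Q\<^sup>2 * Q ^ 44 * a" using a0 by (rule mult_left_le_imp_le)
    also have "\<dots> \<le> Q * Q\<^sup>2 * Q ^ 44 * a" using Q a0 by (intro mult_right_mono) auto
    also have "Q * Q\<^sup>2 * Q ^ 44 = Q ^ 47" by (simp add: eval_nat_numeral)
    also have "Q ^ 47 * a \<le> Q ^ 55 * a" using Q0 a0 by (intro mult_right_mono power_increasing) auto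
    also have "A \<ominus> (*) h ` P = (*) h ` P \<oplus> A" using sumset_uminus[of A "(*) h ` P"] hP by (simp add: sumset_commute)
    finally have 2: "real (card ((*) h ` P \<oplus> A)) \<le> Q ^ 55 * card A" by (simp add: a_def)
    show ?thesis unfolding almost_stabilises_def
      using covers_of_card[OF finA Ane _ 2] P(1) by (simp add: P_def)
  qed
  have B2: "B \<subseteq> F" "card B \<ge> 2" using BH HF cB big(1) by auto
  have "real (card F) < (real (card B)) ^ (2 ^ j)"
    using cB big Q0 by (smt (verit) power_mono)
  then have Bj: "card B ^ (2 ^ j) > card F" by (metis of_nat_less_iff of_nat_power)
  have M1: "Q ^ 55 \<ge> 1" using Q0 by simp
  have dbl: "real (card (A \<ominus> A)) \<le> Q ^ 55 * card A"
  proof -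
    have "Q ^ 11 * a \<le> Q ^ 55 * a" using Q0 a0 by (intro mult_right_mono power_increasing) auto
    then show ?thesis using AA by (simp add: a_def)
  qed
  define c :: nat where "c = 440 * 13 ^ j"
  have "min (real (card F)) (a\<^sup>2) \<le> 4 * ((Q ^ 55) ^ (8 * 13 ^ j) * a)"
    unfolding a_def using almost_stabilised_small_or_large[OF AF Ane M1 dbl _ B2 _ Bj] PP stab by (simp add: P_def)
  also have "(Q ^ 55) ^ (8 * 13 ^ j) = Q ^ c" by (simp add: c_def flip: power_mult)
  also have "4 * (Q ^ c * a) \<le> Q * (Q ^ c * a)" using Q a0 by (intro mult_right_mono) auto
  finally have "min (real (card F)) (a\<^sup>2) \<le> Q ^ (c + 1) * a" by (simp add: mult_ac)
  then consider "a\<^sup>2 \<le> Q ^ (c + 1) * a" | "real (card F) \<le> Q ^ (c + 1) * a" by linarith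
  then show ?thesis
  proof cases
    case 1
    then have "a \<le> Q ^ (c + 1)" using a0 by (simp add: power2_eq_square)
    then have "Q\<^sup>2 * a \<le> Q\<^sup>2 * Q ^ (c + 1)" by (intro mult_left_mono) auto
    also have "\<dots> = Q ^ (c + 3)" by (simp add: power2_eq_square power3_eq_cube power_add)
    finally have "card L \<le> Q ^ (c + 3)" using LA by linarith
    then show ?thesis by (simp add: c_def)
  next
    case 2
    have "a \<le> card L" using A finL by (simp add: a_def card_mono)
    then have "Q ^ (c + 1) * a \<le> Q ^ (c + 1) * card L" using Q0 by (intro mult_left_mono) auto
    then have "card F \<le> Q ^ (c + 1) * card L" using 2 by linarith
    then show ?thesis by (simp add: c_def)
  qed
qed

end

section \<open>Character sums over subgroups\<close>

text \<open>
  Along the thresholds \<open>p\<^sup>-\<^sup>\<eta>, p\<^sup>-\<^sup>3\<^sup>\<eta>, p\<^sup>-\<^sup>9\<^sup>\<eta>, \<dots>\<close> the spectra increase; in \<open>J\<close> steps they cannot grow each time by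
  a factor \<open>p\<^sup>\<kappa>\<close> with \<open>J \<kappa> \<ge> 1\<close>. At a scale without growth the preceding lemma applies, and both of its
  alternatives contradict \<open>|H| \<le> |\<Lambda>| \<le> p\<^sup>1\<^sup>+\<^sup>\<kappa> / |H|\<close>, as \<open>|H| \<ge> p\<^sup>\<epsilon>\<close>.
\<close>

lemma (in prime_field_character) char_sum_lt:
  fixes \<epsilon> \<kappa> \<eta> :: real and j J :: nat
  assumes H: "mult_subgroup H" and eps: "\<epsilon> > 0" and big: "real (card H) \<ge> real (card F) powr \<epsilon>"
    and a: "a \<in> F" "a \<noteq> 0" and j: "2 ^ j * \<epsilon> > 2"
    and kappa: "\<kappa> = \<epsilon> / (500 * 13 ^ j)" and J: "real J * \<kappa> \<ge> 1" and eta: "\<eta> = \<kappa> / 3 ^ J"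
    and q: "real (card F) powr \<kappa> \<ge> 4096" "real (card F) powr \<eta> \<ge> 2"
  shows "norm (char_sum H a) < real (card F) powr (- \<eta>) * card H"
proof (rule ccontr)
  assume neg: "\<not> norm (char_sum H a) < real (card F) powr (- \<eta>) * card H"
  define q where "q = real (card F)"
  have q2: "q \<ge> 2" using card_F_ge_2 by (simp add: q_def)
  then have q1: "q > 1" "q > 0" "q \<ge> 1" by auto
  have k0: "\<kappa> > 0" using eps by (simp add: kappa)
  have e0: "\<eta> > 0" using k0 by (simp add: eta)
  have HF: "H \<subseteq> F" "e \<in> H" "0 \<notin> H" using H by (auto simp: mult_subgroup_def)
  have finH: "finite H" using HF finite_F finite_subset by blast
  define Q where "Q = q powr \<kappa>"
  have Q: "Q \<ge> 4096" using q by (simp add: Q_def q_def)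
  have Qpow: "Q ^ n = q powr (n * \<kappa>)" for n
    using q1 by (simp add: Q_def powr_powr mult.commute flip: powr_realpow)
  define T where "T i = q powr (- (3 ^ i * \<eta>))" for i :: nat
  have T0: "T i > 0" for i using q1 by (simp add: T_def)
  define L where "L i = spectrum H (T i)" for i
  have Tstep: "T (Suc i) \<le> (T i)\<^sup>2 / 2" for i
  proof -
    have "2 \<le> q powr \<eta>" using q by (simp add: q_def)
    also have "\<dots> \<le> q powr (3 ^ i * \<eta>)" using q1 e0 by (intro powr_mono) auto
    finally have *: "2 \<le> q powr (3 ^ i * \<eta>)" .
    have "(T i)\<^sup>2 = q powr (- (2 * (3 ^ i * \<eta>)))"
      unfolding T_def power2_eq_square by (simp add: mult_ac flip: powr_add)
    also have "\<dots> = T (Suc i) * q powr (3 ^ i * \<eta>)"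
      unfolding T_def by (simp add: mult_ac flip: powr_add)
    also have "\<dots> \<ge> T (Suc i) * 2" using * T0[of "Suc i"] by (intro mult_left_mono) auto
    finally show ?thesis by simp
  qed
  have TQ: "1 / Q \<le> (T i)\<^sup>2 / 2" if "i < J" for i
  proof -
    have "(3::real) ^ Suc i \<le> 3 ^ J" using that by (intro power_increasing) auto
    then have "3 ^ Suc i * \<eta> \<le> \<kappa>" using mult_right_mono[of "3 ^ Suc i" "3 ^ J" \<eta>] e0 by (simp add: eta)
    then have "q powr (- \<kappa>) \<le> T (Suc i)" unfolding T_def using q1 by (intro powr_mono) auto
    then show ?thesis using Tstep[of i] by (simp add: Q_def powr_minus_divide)
  qed
  have aT: "a \<in> spectrum H (T 0)" using neg a by (simp add: spectrum_def T_def q_def)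
  have cL: "real (card H) \<le> card (L i)" for i
  proof -
    have "T i \<le> T 0" unfolding T_def using q1 e0 by (intro powr_mono) auto
    then have "a \<in> L i" using aT spectrum_antimono unfolding L_def by blast
    then have "(*) a ` H \<subseteq> L i" using spectrum_invariant[OF H] by (auto simp: L_def mult.commute)
    then have "card ((*) a ` H) \<le> card (L i)" by (intro card_mono) (auto simp: L_def)
    then show ?thesis using card_mult[OF a HF(1)] by simp
  qed
  have Hq: "real (card H) \<ge> q powr \<epsilon>" using big by (simp add: q_def)
  have j13: "(13::real) ^ j \<ge> 1" by simp
  have "(6::real) \<le> 500 * 13 ^ j" using j13 by linarith
  then have "\<kappa> \<le> \<epsilon> / 6" unfolding kappa using eps by (intro divide_left_mono) auto
  then have k3: "6 * \<kappa> \<le> \<epsilon>" by simp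
  have H3: "q powr (\<epsilon> / 2) \<le> real (card H) / Q ^ 3"
  proof -
    have "q powr (\<epsilon> / 2) * Q ^ 3 = q powr (\<epsilon> / 2 + 3 * \<kappa>)" by (simp add: Qpow powr_add)
    also have "\<dots> \<le> q powr \<epsilon>" using q1 k3 by (intro powr_mono) auto
    finally show ?thesis using Hq Q by (simp add: pos_le_divide_eq)
  qed
  have big1: "real (card H) / Q ^ 3 \<ge> 2"
  proof -
    have "Q \<le> q powr (\<epsilon> / 2)" unfolding Q_def using q1 k3 k0 by (intro powr_mono) auto
    then show ?thesis using H3 Q by linarith
  qed
  have big2: "(real (card H) / Q ^ 3) ^ (2 ^ j) > card F"
  proof -
    have "q < q powr (\<epsilon> / 2 * 2 ^ j)" using powr_less_mono[of 1 "\<epsilon> / 2 * 2 ^ j" q] q1 j by (simp add: mult.commute)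
    also have "\<dots> = (q powr (\<epsilon> / 2)) ^ (2 ^ j)"
      using q1 by (simp add: powr_powr flip: powr_realpow)
    also have "\<dots> \<le> (real (card H) / Q ^ 3) ^ (2 ^ j)" using H3 by (intro power_mono) auto
    finally show ?thesis by (simp add: q_def)
  qed
  have cardH2: "real (card H) \<ge> 2"
  proof -
    have "2 * Q ^ 3 \<le> real (card H)" using big1 Q by (simp add: pos_le_divide_eq)
    moreover have "Q ^ 3 \<ge> 1" using Q by simp
    ultimately show ?thesis by linarith
  qed
  have "\<exists>i<J. real (card (L (Suc i))) \<le> Q * card (L i)"
  proof (rule ccontr)
    assume "\<not> ?thesis"
    then have gr: "\<And>i. i < J \<Longrightarrow> real (card (L (Suc i))) > Q * card (L i)" by force
    have "i \<le> J \<Longrightarrow> real (card (L i)) \<ge> 2 * Q ^ i" for i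
    proof (induction i)
      case 0 then show ?case using cL[of 0] cardH2 by simp
    next
      case (Suc i)
      then have "2 * Q ^ Suc i \<le> Q * card (L i)" using Q by simp
      then show ?case using gr[of i] Suc.prems by linarith
    qed
    then have "2 * Q ^ J \<le> card (L J)" by simp
    also have "\<dots> \<le> q" using card_mono[OF finite_F spectrum_subset] by (simp add: L_def q_def)
    finally have "2 * Q ^ J \<le> q" .
    moreover have "q \<le> Q ^ J" unfolding Qpow using powr_mono[of 1 "J * \<kappa>" q] J q1 by simp
    ultimately show False using q1 by linarith
  qed
  then obtain i where i: "i < J" "real (card (L (Suc i))) \<le> Q * card (L i)" by blast
  have "spectrum H ((T i)\<^sup>2 / 2) \<subseteq> L (Suc i)" unfolding L_def by (rule spectrum_antimono[OF Tstep])
  then have "card (spectrum H ((T i)\<^sup>2 / 2)) \<le> card (L (Suc i))" by (intro card_mono) (simp add: L_def)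
  then have D: "real (card (spectrum H ((T i)\<^sup>2 / 2))) \<le> Q * card (L i)" using i(2) by linarith
  have Lne: "L i \<noteq> {}" using cL[of i] cardH2 by auto
  define c :: nat where "c = 440 * 13 ^ j"
  have kc: "\<kappa> * (c + 3) < \<epsilon>"
  proof -
    have "real (c + 3) = 440 * 13 ^ j + 3" by (simp add: c_def)
    then have "real (c + 3) < 500 * 13 ^ j" using j13 by linarith
    then show ?thesis unfolding kappa using eps by (simp add: pos_divide_less_eq)
  qed
  have "card (L i) \<le> Q ^ (c + 3) \<or> card F \<le> Q ^ (c + 1) * card (L i)"
    unfolding c_def
    by (rule spectrum_tiny_or_huge[OF H T0[of i] L_def[of i] Lne Q TQ[OF i(1)] D big1 big2])
  then consider "card (L i) \<le> Q ^ (c + 3)" | "card F \<le> Q ^ (c + 1) * card (L i)"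
    by linarith
  then show False
  proof cases
    case 1
    have "q powr \<epsilon> \<le> q powr ((c + 3) * \<kappa>)" using 1 cL[of i] Hq Qpow[of "c + 3"] by linarith
    then have "\<epsilon> \<le> (c + 3) * \<kappa>" using q1 by simp
    then show False using kc by (simp add: mult.commute)
  next
    case 2
    have "card (L i) * (T i)\<^sup>2 * card H \<le> q" using card_spectrum[OF H T0[of i]] by (simp add: L_def q_def)
    moreover have "2 * (1 / Q) \<le> (T i)\<^sup>2" using TQ[OF i(1)] by simp
    moreover have "1 / Q \<ge> 0" using Q by simp
    ultimately have "card (L i) * (1 / Q) * (q powr \<epsilon>) \<le> q"
      using Hq by (smt (verit) mult_mono mult_nonneg_nonneg of_nat_0_le_iff powr_ge_zero)
    then have "card (L i) * q powr \<epsilon> \<le> q * Q" using Q by (simp add: field_simps)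
    then have "Q ^ (c + 1) * (card (L i) * q powr \<epsilon>) \<le> Q ^ (c + 1) * (q * Q)"
      using Q by (intro mult_left_mono) auto
    moreover have "q * q powr \<epsilon> \<le> Q ^ (c + 1) * card (L i) * q powr \<epsilon>"
      using 2 by (intro mult_right_mono) (auto simp: q_def)
    ultimately have "q * q powr \<epsilon> \<le> q * Q ^ (c + 2)" by (simp add: mult_ac)
    then have "q powr \<epsilon> \<le> q powr ((c + 2) * \<kappa>)" using q1 Qpow[of "c + 2"] by simp
    then have "\<epsilon> \<le> (c + 2) * \<kappa>" using q1 by simp
    then show False using kc k0 by (simp add: algebra_simps)
  qed
qed

text \<open>
  The theorem of Bourgain, Glibichuk and Konyagin on exponential sums over multiplicative subgroups.
  The constant \<open>C\<close> takes care of the fields that are too small for the preceding lemma.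
\<close>

theorem subgroup_char_sum_bound:
  fixes \<epsilon> :: real
  assumes eps: "\<epsilon> > 0"
  shows "\<exists>\<delta>>0. \<exists>C\<ge>1::real. \<forall>(F :: 'a::comm_ring_1 set) e \<chi> H a.
    prime_field_character F e \<chi> \<longrightarrow> H \<subseteq> F \<longrightarrow> 0 \<notin> H \<longrightarrow> e \<in> H \<longrightarrow> (\<forall>x\<in>H. \<forall>y\<in>H. x * y \<in> H) \<longrightarrow>
    real (card H) \<ge> real (card F) powr \<epsilon> \<longrightarrow> a \<in> F \<longrightarrow> a \<noteq> 0 \<longrightarrow>
    norm (\<Sum>h\<in>H. \<chi> (a * h)) \<le> C * card H * real (card F) powr (- \<delta>)"
proof -
  obtain j where j: "2 / \<epsilon> < 2 ^ j" using real_arch_pow[of 2 "2 / \<epsilon>"] by auto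
  have j2: "2 ^ j * \<epsilon> > 2" using j eps by (simp add: field_simps)
  \<comment> \<open>both alternatives for the size of the spectrum lose at most \<open>Q ^ (440 * 13 ^ j + 3)\<close>,
      which for this \<open>\<kappa>\<close> stays below \<open>p\<^sup>\<epsilon>\<close>\<close>
  define \<kappa> where "\<kappa> = \<epsilon> / (500 * 13 ^ j)"
  have k0: "\<kappa> > 0" using eps by (simp add: \<kappa>_def)
  obtain J :: nat where "1 / \<kappa> < J" using reals_Archimedean2 by blast
  then have J: "real J * \<kappa> \<ge> 1" using k0 by (simp add: field_simps)
  define \<eta> where "\<eta> = \<kappa> / 3 ^ J"
  have e0: "\<eta> > 0" using k0 by (simp add: \<eta>_def)
  define q0 where "q0 = max (4096 powr (1 / \<kappa>)) (2 powr (1 / \<eta>))"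
  have q0: "q0 \<ge> 1"
  proof -
    have "(1::real) \<le> 2 powr (1 / \<eta>)" using e0 by (intro ge_one_powr_ge_zero) auto
    then show ?thesis unfolding q0_def by linarith
  qed
  define C where "C = q0 powr \<eta>"
  have C1: "C \<ge> 1" unfolding C_def using q0 e0 by (intro ge_one_powr_ge_zero) auto
  have main: "norm (\<Sum>h\<in>H. \<chi> (a * h)) \<le> C * card H * real (card F) powr (- \<eta>)"
    if "prime_field_character F e \<chi>" and H: "H \<subseteq> F" "0 \<notin> H" "e \<in> H" "\<forall>x\<in>H. \<forall>y\<in>H. x * y \<in> H"
      and big: "real (card H) \<ge> real (card F) powr \<epsilon>" and a: "a \<in> F" "a \<noteq> 0"
    for F :: "'a set" and e \<chi> H a
  proof -
    interpret prime_field_character F e \<chi> by (rule that(1))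
    have mH: "mult_subgroup H" using H by (simp add: mult_subgroup_def)
    have q2: "real (card F) \<ge> 2" using card_F_ge_2 by simp
    show ?thesis
    proof (cases "real (card F) \<ge> q0")
      case True
      have "4096 = (4096 powr (1 / \<kappa>)) powr \<kappa>" using k0 by (simp add: powr_powr)
      also have "\<dots> \<le> real (card F) powr \<kappa>" using True k0 by (intro powr_mono2) (auto simp: q0_def)
      finally have 1: "real (card F) powr \<kappa> \<ge> 4096" .
      have "2 = (2 powr (1 / \<eta>)) powr \<eta>" using e0 by (simp add: powr_powr)
      also have "\<dots> \<le> real (card F) powr \<eta>" using True e0 by (intro powr_mono2) (auto simp: q0_def)
      finally have 2: "real (card F) powr \<eta> \<ge> 2" .
      have "norm (\<Sum>h\<in>H. \<chi> (a * h)) \<le> 1 * card H * real (card F) powr (- \<eta>)"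
        using char_sum_lt[OF mH eps big a j2 \<kappa>_def J \<eta>_def 1 2] by (simp add: char_sum_def mult.commute)
      also have "\<dots> \<le> C * card H * real (card F) powr (- \<eta>)"
        using mult_right_mono[OF C1, of "real (card H)"] by (intro mult_right_mono) auto
      finally show ?thesis .
    next
      case False
      have "norm (\<Sum>h\<in>H. \<chi> (a * h)) \<le> (\<Sum>h\<in>H. 1)"
        by (rule order.trans[OF norm_sum]) (use H a mult_closed in \<open>simp add: subset_iff\<close>)
      also have "\<dots> = 1 * real (card H)" by simp
      also have "\<dots> \<le> (C * real (card F) powr (- \<eta>)) * card H"
      proof (rule mult_right_mono)
        have "real (card F) powr \<eta> \<le> C" unfolding C_def using False e0 by (intro powr_mono2) auto
        then show "1 \<le> C * real (card F) powr (- \<eta>)"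
          using q2 by (simp add: powr_minus_divide pos_le_divide_eq)
      qed simp
      finally show ?thesis by (simp add: mult_ac)
    qed
  qed
  show ?thesis
    by (intro exI[of _ \<eta>] exI[of _ C] conjI allI impI e0 C1) (rule main; assumption)
qed

section \<open>Additive characters modulo a prime\<close>

lemma e_mod_cis: "e_mod p z = cis (2 * pi * of_int z / of_nat p)"
  by (simp add: e_mod_def cis_conv_exp mult_ac)

lemma e_mod_add: "e_mod p (a + b) = e_mod p a * e_mod p b"
  by (simp add: e_mod_cis cis_mult add_divide_distrib distrib_left)

lemma e_mod_0 [simp]: "e_mod p 0 = 1" by (simp add: e_mod_def)

lemma norm_e_mod [simp]: "norm (e_mod p z) = 1" by (simp add: e_mod_cis)

lemma e_mod_uminus: "e_mod p (- z) = cnj (e_mod p z)"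
  by (simp add: e_mod_cis cis_cnj)

lemma e_mod_diff: "e_mod p (a - b) = e_mod p a * cnj (e_mod p b)"
  using e_mod_add[of p a "- b"] by (simp add: e_mod_uminus)

lemma e_mod_sum: "e_mod p (\<Sum>i\<in>A. f i) = (\<Prod>i\<in>A. e_mod p (f i))"
  by (induction A rule: infinite_finite_induct) (auto simp: e_mod_add)

lemma e_mod_eq_1: assumes "p > 0" shows "e_mod p z = 1 \<longleftrightarrow> int p dvd z"
proof
  assume "int p dvd z"
  then obtain k where k: "z = int p * k" by blast
  have "cis (2 * pi * of_int k) = 1" by (rule cis_multiple_2pi) auto
  then show "e_mod p z = 1" using assms k by (simp add: e_mod_cis mult.assoc)
next
  assume "e_mod p z = 1"
  then have "cos (2 * pi * of_int z / of_nat p) = 1" by (metis e_mod_cis cis.sel(1) one_complex.sel(1))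
  then obtain n :: int where "2 * pi * of_int z / of_nat p = of_int n * 2 * pi"
    using cos_one_2pi_int by blast
  then have "real_of_int z = real_of_int (n * int p)" using assms by (simp add: field_simps)
  then have "z = n * int p" by (simp only: of_int_eq_iff)
  then show "int p dvd z" by simp
qed

lemma e_mod_cong: assumes "p > 0" "[a = b] (mod int p)" shows "e_mod p a = e_mod p b"
proof -
  have "e_mod p (a - b) = 1" using assms by (simp add: e_mod_eq_1 cong_iff_dvd_diff)
  then show ?thesis using e_mod_add[of p "a - b" b] by simp
qed

lemma e_mod_mult_nat: "e_mod p (a * int n) = e_mod p a ^ n"
  by (induction n) (auto simp: distrib_left e_mod_add)

lemma sum_e_mod_nat:
  assumes "p > 0" shows "(\<Sum>n<p. e_mod p (a * int n)) = (if int p dvd a then of_nat p else 0)"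
proof (cases "int p dvd a")
  case True
  then show ?thesis using assms by (simp add: e_mod_mult_nat e_mod_eq_1[THEN iffD2])
next
  case False
  have "e_mod p a ^ p = 1" using e_mod_mult_nat[of p a p] assms e_mod_eq_1[of p "a * int p"] by simp
  moreover have "e_mod p a \<noteq> 1" using False assms by (simp add: e_mod_eq_1)
  ultimately show ?thesis using False by (simp add: e_mod_mult_nat geometric_sum)
qed

lemma sum_e_mod_Fp:
  assumes "p > 0" shows "(\<Sum>x\<in>Fp p. e_mod p (a * x)) = (if int p dvd a then of_nat p else 0)"
proof -
  have "Fp p = int ` {..<p}" by (auto simp: Fp_def image_iff) (metis lessThan_iff nat_int nat_less_iff zle_int zero_le_imp_eq_int of_nat_less_iff)
  then show ?thesis by (simp add: sum.reindex sum_e_mod_nat assms)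
qed

section \<open>All prime fields inside one commutative ring\<close>

text \<open>
  This ring is the product of the rings \<open>\<int>/q\<close> over all natural numbers \<open>q\<close>. The factor with \<open>q = p\<close> is a
  copy of the field with \<open>p\<close> elements, so one type contains all prime fields.
\<close>

quotient_type residues = "nat \<Rightarrow> int" / "\<lambda>f g. \<forall>q. [f q = g q] (mod int q)"
  by (intro equivpI reflpI sympI transpI) (auto intro: cong_sym cong_trans)

instantiation residues :: comm_ring_1
begin

lift_definition zero_residues :: residues is "\<lambda>_. 0" .
lift_definition one_residues :: residues is "\<lambda>_. 1" .
lift_definition plus_residues :: "residues \<Rightarrow> residues \<Rightarrow> residues" is "\<lambda>f g q. f q + g q"
  by (auto intro: cong_add)
lift_definition minus_residues :: "residues \<Rightarrow> residues \<Rightarrow> residues" is "\<lambda>f g q. f q - g q"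
  by (auto intro: cong_diff)
lift_definition uminus_residues :: "residues \<Rightarrow> residues" is "\<lambda>f q. - f q"
  by (auto simp: cong_minus_minus_iff)
lift_definition times_residues :: "residues \<Rightarrow> residues \<Rightarrow> residues" is "\<lambda>f g q. f q * g q"
  by (auto intro: cong_mult)

instance
proof
  show "(0 :: residues) \<noteq> 1"
  proof transfer
    have "\<not> [0 = 1] (mod int 0)" by (simp add: cong_def)
    then show "\<not> (\<forall>q. [0 = 1] (mod int q))" by blast
  qed
qed (transfer; simp add: algebra_simps)+

end

lift_definition residue_at :: "nat \<Rightarrow> int \<Rightarrow> residues" is "\<lambda>p k q. if q = p then k else 0" .

lemma residue_at_eq_iff: "residue_at p a = residue_at p b \<longleftrightarrow> [a = b] (mod int p)"
  by transfer auto

lemma residue_at_add: "residue_at p (a + b) = residue_at p a + residue_at p b"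
  by transfer auto

lemma residue_at_diff: "residue_at p (a - b) = residue_at p a - residue_at p b"
  by transfer auto

lemma residue_at_mult: "residue_at p (a * b) = residue_at p a * residue_at p b"
  by transfer auto

lemma residue_at_0 [simp]: "residue_at p 0 = 0"
  by transfer auto

lemma residue_at_of_nat: "residue_at p (int n) = of_nat n * residue_at p 1"
  by (induction n) (auto simp: residue_at_add distrib_right)

lemma residue_at_eq_0_iff: "residue_at p a = 0 \<longleftrightarrow> int p dvd a"
  using residue_at_eq_iff[of p a 0] by (simp add: cong_0_iff)

text \<open>
  Well defined on the copy of the field with \<open>p\<close> elements, since \<open>e_mod p k\<close> depends only on \<open>k\<close> modulo \<open>p\<close>.
\<close>

definition residue_char :: "nat \<Rightarrow> residues \<Rightarrow> complex" where
  "residue_char p x = e_mod p (SOME k. residue_at p k = x)"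

lemma residue_char_at: "p > 0 \<Longrightarrow> residue_char p (residue_at p k) = e_mod p k"
  unfolding residue_char_def
  by (rule e_mod_cong) (auto simp: residue_at_eq_iff intro: someI2[of _ k])

lemma range_residue_at: assumes "p > 0"
  shows "range (residue_at p) = residue_at p ` Fp p" "inj_on (residue_at p) (Fp p)"
proof -
  have "residue_at p k = residue_at p (k mod int p)" for k by (simp add: residue_at_eq_iff)
  moreover have "k mod int p \<in> Fp p" for k using assms by (simp add: Fp_def)
  ultimately show "range (residue_at p) = residue_at p ` Fp p" by blast
  show "inj_on (residue_at p) (Fp p)"
    by (auto simp: inj_on_def residue_at_eq_iff Fp_def cong_def)
qed

lemma card_Fp [simp]: "card (Fp p) = p" and finite_Fp [simp]: "finite (Fp p)"
  by (simp_all add: Fp_def)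

lemma residue_field_character:
  assumes p: "prime p"
  shows "prime_field_character (range (residue_at p)) (residue_at p 1) (residue_char p)"
proof unfold_locales
  have p0: "p > 0" using p prime_gt_0_nat by blast
  note R = range_residue_at[OF p0]
  show "finite (range (residue_at p))" by (simp add: R)
  show "residue_at p 1 \<noteq> 0" using p by (auto simp: residue_at_eq_0_iff)
  show "x - y \<in> range (residue_at p)" "x * y \<in> range (residue_at p)"
    if "x \<in> range (residue_at p)" "y \<in> range (residue_at p)" for x y
    using that by (auto simp flip: residue_at_diff residue_at_mult)
  show "residue_at p 1 * x = x" if "x \<in> range (residue_at p)" for x
    using that by (auto simp flip: residue_at_mult)
  show "\<exists>y\<in>range (residue_at p). x * y = residue_at p 1" if x: "x \<in> range (residue_at p)" "x \<noteq> 0" for x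
  proof -
    obtain k where k: "x = residue_at p k" using x by auto
    then have "\<not> int p dvd k" using x by (simp add: residue_at_eq_0_iff)
    then have "coprime k (int p)" using p by (metis coprime_commute prime_imp_coprime prime_nat_int_transfer)
    then obtain l where "[k * l = 1] (mod int p)" using cong_solve_coprime_int by blast
    then have "x * residue_at p l = residue_at p 1" by (simp add: k residue_at_eq_iff flip: residue_at_mult)
    then show ?thesis by blast
  qed
  show "\<exists>n. x = of_nat n * residue_at p 1" if x: "x \<in> range (residue_at p)" for x
  proof -
    obtain k where k: "k \<in> Fp p" "x = residue_at p k" using x R by auto
    then have "x = residue_at p (int (nat k))" by (simp add: Fp_def)
    then have "x = of_nat (nat k) * residue_at p 1" by (simp only: residue_at_of_nat)
    then show ?thesis by blast
  qed
  show "residue_char p (x + y) = residue_char p x * residue_char p y"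
    if "x \<in> range (residue_at p)" "y \<in> range (residue_at p)" for x y
    using that p0 by (auto simp: residue_char_at e_mod_add simp flip: residue_at_add)
  show "norm (residue_char p x) = 1" if "x \<in> range (residue_at p)" for x
    using that p0 by (auto simp: residue_char_at)
  show "(\<Sum>x\<in>range (residue_at p). residue_char p (a * x)) = 0"
    if a: "a \<in> range (residue_at p)" "a \<noteq> 0" for a
  proof -
    obtain k where k: "a = residue_at p k" using a by auto
    have "(\<Sum>x\<in>range (residue_at p). residue_char p (a * x)) = (\<Sum>x\<in>Fp p. e_mod p (k * x))"
      by (simp add: R sum.reindex[OF R(2)] k residue_char_at p0 flip: residue_at_mult)
    then show ?thesis using a by (simp add: sum_e_mod_Fp p0 k residue_at_eq_0_iff)
  qed
qed auto

text \<open>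
  The subgroup bound for the group of powers of \<open>g\<close> modulo \<open>p\<close>, whose order is \<open>T\<close>.
\<close>

theorem power_orbit_sum_bound:
  fixes \<epsilon> :: real
  assumes "\<epsilon> > 0"
  shows "\<exists>\<delta>>0. \<exists>C\<ge>1::real. \<forall>(p::nat) (g::int) (a::int) (T::nat).
    prime p \<longrightarrow> \<not> int p dvd g \<longrightarrow> \<not> int p dvd a \<longrightarrow> T > 0 \<longrightarrow> [g ^ T = 1] (mod int p) \<longrightarrow>
    inj_on (\<lambda>i. g ^ i mod int p) {..<T} \<longrightarrow> real T \<ge> real p powr \<epsilon> \<longrightarrow>
    norm (\<Sum>i<T. e_mod p (a * g ^ i)) \<le> C * T * real p powr (- \<delta>)"
proof -
  obtain \<delta> C where d: "\<delta> > 0" "C \<ge> (1::real)" and bound: "\<And>(F :: residues set) e \<chi> H a.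
    prime_field_character F e \<chi> \<Longrightarrow> H \<subseteq> F \<Longrightarrow> 0 \<notin> H \<Longrightarrow> e \<in> H \<Longrightarrow> (\<forall>x\<in>H. \<forall>y\<in>H. x * y \<in> H) \<Longrightarrow>
    real (card H) \<ge> real (card F) powr \<epsilon> \<Longrightarrow> a \<in> F \<Longrightarrow> a \<noteq> 0 \<Longrightarrow>
    norm (\<Sum>h\<in>H. \<chi> (a * h)) \<le> C * card H * real (card F) powr (- \<delta>)"
    using subgroup_char_sum_bound[OF assms, where 'a = residues] by blast
  have "norm (\<Sum>i<T. e_mod p (a * g ^ i)) \<le> C * T * real p powr (- \<delta>)"
    if p: "prime p" and g: "\<not> int p dvd g" and a: "\<not> int p dvd a" and T: "T > 0" "[g ^ T = 1] (mod int p)"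
      and inj: "inj_on (\<lambda>i. g ^ i mod int p) {..<T}" and big: "real T \<ge> real p powr \<epsilon>"
    for p T :: nat and g a :: int
  proof -
    have p0: "p > 0" using p prime_gt_0_nat by blast
    define H where "H = (\<lambda>i. residue_at p (g ^ i)) ` {..<T}"
    have injH: "inj_on (\<lambda>i. residue_at p (g ^ i)) {..<T}"
      using inj by (simp add: inj_on_def residue_at_eq_iff cong_def)
    have cH: "card H = T" by (simp add: H_def card_image[OF injH])
    have cF: "card (range (residue_at p)) = p"
      by (simp add: range_residue_at[OF p0] card_image)
    have red: "residue_at p (g ^ n) \<in> H" for n
    proof -
      have "[g ^ n = (g ^ T) ^ (n div T) * g ^ (n mod T)] (mod int p)"
        by (simp flip: power_mult power_add)
      also have "[(g ^ T) ^ (n div T) * g ^ (n mod T) = 1 ^ (n div T) * g ^ (n mod T)] (mod int p)"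
        using T by (intro cong_mult cong_pow) auto
      finally have "residue_at p (g ^ n) = residue_at p (g ^ (n mod T))" by (simp add: residue_at_eq_iff)
      then show ?thesis using T by (simp add: H_def)
    qed
    have "norm (\<Sum>h\<in>H. residue_char p (residue_at p a * h)) \<le> C * card H * real (card (range (residue_at p))) powr (- \<delta>)"
    proof (rule bound[OF residue_field_character[OF p]])
      show "H \<subseteq> range (residue_at p)" by (auto simp: H_def)
      show "0 \<notin> H" using g p by (auto simp: H_def residue_at_eq_0_iff prime_dvd_power_iff dest!: prime_dvd_power[rotated] sym[of 0])
      show "residue_at p 1 \<in> H" using red[of 0] by simp
      show "\<forall>x\<in>H. \<forall>y\<in>H. x * y \<in> H"
        using red by (auto simp: H_def simp flip: residue_at_mult power_add)
      show "real (card (range (residue_at p))) powr \<epsilon> \<le> real (card H)" using big by (simp add: cH cF)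
      show "residue_at p a \<noteq> 0" using a by (simp add: residue_at_eq_0_iff)
    qed auto
    also have "(\<Sum>h\<in>H. residue_char p (residue_at p a * h)) = (\<Sum>i<T. e_mod p (a * g ^ i))"
      unfolding H_def by (simp add: sum.reindex[OF injH] residue_char_at p0 flip: residue_at_mult)
    finally show ?thesis by (simp add: cH cF)
  qed
  then show ?thesis using d by (intro exI[of _ \<delta>] exI[of _ C] conjI allI impI) auto
qed

section \<open>Evaluation of polynomials in several variables\<close>

abbreviation lookup where "lookup \<equiv> Poly_Mapping.lookup"
abbreviation keys where "keys \<equiv> Poly_Mapping.keys"

definition monomial_eval :: "(nat \<Rightarrow> int) \<Rightarrow> (nat \<Rightarrow>\<^sub>0 nat) \<Rightarrow> int" where
  "monomial_eval x t = (\<Prod>j\<in>keys t. x j ^ lookup t j)"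

lemma monomial_eval_superset:
  assumes "finite V" "keys t \<subseteq> V" shows "monomial_eval x t = (\<Prod>j\<in>V. x j ^ lookup t j)"
  unfolding monomial_eval_def
  by (rule prod.mono_neutral_left) (use assms in \<open>auto simp: in_keys_iff\<close>)

lemma monomial_eval_0 [simp]: "monomial_eval x 0 = 1"
  by (simp add: monomial_eval_def)

lemma monomial_eval_add: "monomial_eval x (s + t) = monomial_eval x s * monomial_eval x t"
proof -
  let ?V = "keys s \<union> keys t"
  have "keys (s + t) \<subseteq> ?V" by (rule keys_add)
  then show ?thesis
    by (simp add: monomial_eval_superset[of ?V] lookup_add power_add prod.distrib)
qed

lemma mpoly_eval_superset:
  assumes "finite A" "keys F \<subseteq> A" shows "mpoly_eval F x = (\<Sum>t\<in>A. lookup F t * monomial_eval x t)"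
  unfolding mpoly_eval_def monomial_eval_def
  by (rule sum.mono_neutral_left) (use assms in \<open>auto simp: in_keys_iff\<close>)

lemma mpoly_eval_0 [simp]: "mpoly_eval 0 x = 0"
  by (simp add: mpoly_eval_def)

lemma mpoly_eval_add: "mpoly_eval (F + G) x = mpoly_eval F x + mpoly_eval G x"
proof -
  let ?A = "keys F \<union> keys G"
  have "keys (F + G) \<subseteq> ?A" by (rule keys_add)
  then show ?thesis
    by (simp add: mpoly_eval_superset[of ?A] lookup_add distrib_right sum.distrib)
qed

lemma mpoly_eval_sum: "mpoly_eval (\<Sum>i\<in>I. f i) x = (\<Sum>i\<in>I. mpoly_eval (f i) x)"
  by (induction I rule: infinite_finite_induct) (auto simp: mpoly_eval_add)

lemma mpoly_eval_single: "mpoly_eval (Poly_Mapping.single t c) x = c * monomial_eval x t"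
  by (subst mpoly_eval_superset[of "{t}"]) auto

lemma mpoly_eq_sum_single: "(F :: mpoly) = (\<Sum>t\<in>keys F. Poly_Mapping.single t (lookup F t))"
proof (rule poly_mapping_eqI)
  fix k
  have "lookup (\<Sum>t\<in>keys F. Poly_Mapping.single t (lookup F t)) k = (\<Sum>t\<in>keys F. if t = k then lookup F t else 0)"
    by (simp add: lookup_sum lookup_single when_def)
  also have "\<dots> = lookup F k" by (simp add: sum.delta in_keys_iff)
  finally show "lookup F k = lookup (\<Sum>t\<in>keys F. Poly_Mapping.single t (lookup F t)) k" by simp
qed

lemma mpoly_mult_eq: "(F :: mpoly) * G =
  (\<Sum>s\<in>keys F. \<Sum>t\<in>keys G. Poly_Mapping.single (s + t) (lookup F s * lookup G t))"
  by (subst mpoly_eq_sum_single[of F], subst mpoly_eq_sum_single[of G]) (simp add: sum_product mult_single)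

lemma mpoly_eval_mult: "mpoly_eval (F * G) x = mpoly_eval F x * mpoly_eval G x"
proof -
  have "mpoly_eval F x * mpoly_eval G x =
    (\<Sum>s\<in>keys F. \<Sum>t\<in>keys G. (lookup F s * monomial_eval x s) * (lookup G t * monomial_eval x t))"
    by (simp add: mpoly_eval_superset[OF finite_keys order.refl] sum_product)
  also have "\<dots> = mpoly_eval (F * G) x"
    by (simp add: mpoly_mult_eq mpoly_eval_sum mpoly_eval_single monomial_eval_add mult_ac)
  finally show ?thesis by simp
qed

lemma mpoly_eval_Const [simp]: "mpoly_eval (Const c) x = c"
  by (simp add: Const_def mpoly_eval_single)

lemma mpoly_eval_Var [simp]: "mpoly_eval (Var j) x = x j"
  by (simp add: Var_def mpoly_eval_single monomial_eval_def)

lemma mpoly_eval_1 [simp]: "mpoly_eval 1 x = 1"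
proof -
  have "(1 :: mpoly) = Const 1" by (simp add: Const_def)
  then show ?thesis by (metis mpoly_eval_Const)
qed

lemma keys_Const: "keys (Const c) \<subseteq> {0}" and lookup_Const_0 [simp]: "lookup (Const c) 0 = c"
  by (simp_all add: Const_def)

lemma keys_Var [simp]: "keys (Var i) = {Poly_Mapping.single i 1}"
  and lookup_Var [simp]: "lookup (Var i) (Poly_Mapping.single i 1) = 1"
  by (simp_all add: Var_def)

lemma mpoly_eval_power: "mpoly_eval (F ^ n) x = mpoly_eval F x ^ n"
  by (induction n) (simp_all add: mpoly_eval_mult)

lemma mpoly_eval_prod: "mpoly_eval (\<Prod>i\<in>I. f i) x = (\<Prod>i\<in>I. mpoly_eval (f i) x)"
  by (induction I rule: infinite_finite_induct) (simp_all add: mpoly_eval_mult)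

lemma mpoly_eval_cong_poly:
  assumes "mpoly_cong p F G" shows "[mpoly_eval F x = mpoly_eval G x] (mod int p)"
proof -
  let ?A = "keys F \<union> keys G"
  have "mpoly_eval F x = (\<Sum>t\<in>?A. lookup F t * monomial_eval x t)"
    "mpoly_eval G x = (\<Sum>t\<in>?A. lookup G t * monomial_eval x t)"
    by (rule mpoly_eval_superset; simp)+
  then show ?thesis using assms by (auto simp: mpoly_cong_def intro!: cong_sum cong_mult)
qed

lemma mpoly_eval_cong_point:
  assumes "\<And>t j. t \<in> keys F \<Longrightarrow> j \<in> keys t \<Longrightarrow> [x j = y j] (mod int p)"
  shows "[mpoly_eval F x = mpoly_eval F y] (mod int p)"
  unfolding mpoly_eval_def by (intro cong_sum cong_mult cong_prod cong_pow cong_refl) (use assms in auto)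

section \<open>Functions with a dominating monomial\<close>

text \<open>
  Componentwise comparison of exponent vectors, that is, divisibility of monomials.
\<close>

definition monomial_le :: "(nat \<Rightarrow>\<^sub>0 nat) \<Rightarrow> (nat \<Rightarrow>\<^sub>0 nat) \<Rightarrow> bool" where
  "monomial_le s t \<longleftrightarrow> (\<forall>j. lookup s j \<le> lookup t j)"

lemma monomial_le_refl [simp]: "monomial_le t t" by (simp add: monomial_le_def)
lemma monomial_le_0 [simp]: "monomial_le 0 t" by (simp add: monomial_le_def)
lemma monomial_le_trans: "monomial_le s t \<Longrightarrow> monomial_le t u \<Longrightarrow> monomial_le s u"
  unfolding monomial_le_def by (meson order_trans)
lemma monomial_le_add: "monomial_le s t \<Longrightarrow> monomial_le s' t' \<Longrightarrow> monomial_le (s + s') (t + t')"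
  by (simp add: monomial_le_def lookup_add add_mono)
lemma monomial_le_add_right: "monomial_le s (s + t)" "monomial_le s (t + s)" by (simp_all add: monomial_le_def lookup_add)
lemma monomial_le_sum: "(\<And>i. i \<in> I \<Longrightarrow> monomial_le (f i) (g i)) \<Longrightarrow> monomial_le (\<Sum>i\<in>I. f i) (\<Sum>i\<in>I. g i)"
  by (simp add: monomial_le_def lookup_sum sum_mono)
lemma monomial_le_antisym: "monomial_le s t \<Longrightarrow> monomial_le t s \<Longrightarrow> s = t"
  unfolding monomial_le_def by (intro poly_mapping_eqI) (simp add: order.antisym)
lemma monomial_le_keys: "monomial_le s t \<Longrightarrow> keys s \<subseteq> keys t"
  unfolding monomial_le_def by (auto simp: in_keys_iff) (metis order_less_le_trans)

lemma monomial_le_add_eqD: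
  assumes "monomial_le s s'" "monomial_le t t'" "s + t = s' + t'" shows "s = s'" "t = t'"
proof -
  have "lookup s j = lookup s' j \<and> lookup t j = lookup t' j" for j
  proof -
    have "lookup s j + lookup t j = lookup s' j + lookup t' j" using assms(3) by (metis lookup_add)
    moreover have "lookup s j \<le> lookup s' j" "lookup t j \<le> lookup t' j" using assms by (auto simp: monomial_le_def)
    ultimately show ?thesis by linarith
  qed
  then show "s = s'" "t = t'" by (auto intro: poly_mapping_eqI)
qed

definition exponent_scale :: "nat \<Rightarrow> (nat \<Rightarrow>\<^sub>0 nat) \<Rightarrow> (nat \<Rightarrow>\<^sub>0 nat)" where
  "exponent_scale n t = (\<Sum>_<n. t)"

lemma lookup_exponent_scale [simp]: "lookup (exponent_scale n t) j = n * lookup t j"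
  by (simp only: exponent_scale_def lookup_sum) simp

lemma exponent_scale_0 [simp]: "exponent_scale 0 t = 0" by (simp add: exponent_scale_def)
lemma exponent_scale_Suc: "exponent_scale (Suc n) t = t + exponent_scale n t"
  by (rule poly_mapping_eqI) (simp add: lookup_add)

text \<open>
  A function on integer points that is represented modulo \<open>p\<close> by a polynomial all of whose monomials
  divide the monomial with exponent \<open>t\<close>. Working with functions avoids composing polynomials formally.
\<close>

definition dominated :: "nat \<Rightarrow> (nat \<Rightarrow>\<^sub>0 nat) \<Rightarrow> ((nat \<Rightarrow> int) \<Rightarrow> int) \<Rightarrow> bool" where
  "dominated p t f \<longleftrightarrow> (\<exists>P. (\<forall>u\<in>keys P. monomial_le u t) \<and> (\<forall>x. [f x = mpoly_eval P x] (mod int p)))"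

text \<open>
  In addition the monomial with exponent \<open>t\<close> itself occurs. This is stronger than having \<open>t\<close> as the
  largest monomial in some term order, and it is stable under products and triangular substitutions.
\<close>

definition has_leading :: "nat \<Rightarrow> (nat \<Rightarrow>\<^sub>0 nat) \<Rightarrow> ((nat \<Rightarrow> int) \<Rightarrow> int) \<Rightarrow> bool" where
  "has_leading p t f \<longleftrightarrow> (\<exists>P. (\<forall>u\<in>keys P. monomial_le u t) \<and> \<not> int p dvd lookup P t \<and>
     (\<forall>x. [f x = mpoly_eval P x] (mod int p)))"

lemma has_leading_imp_dominated: "has_leading p t f \<Longrightarrow> dominated p t f" unfolding has_leading_def dominated_def by blast

lemma dominated_mono: "dominated p s f \<Longrightarrow> monomial_le s t \<Longrightarrow> dominated p t f"
  unfolding dominated_def by (meson monomial_le_trans)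

lemma has_leading_cong: "has_leading p t f \<Longrightarrow> (\<And>x. [g x = f x] (mod int p)) \<Longrightarrow> has_leading p t g"
  unfolding has_leading_def by (meson cong_trans)

lemma dominated_const: "dominated p t (\<lambda>_. c)"
  unfolding dominated_def using keys_Const[of c] by (intro exI[of _ "Const c"]) auto

lemma has_leading_const: "\<not> int p dvd c \<Longrightarrow> has_leading p 0 (\<lambda>_. c)"
  unfolding has_leading_def using keys_Const[of c] by (intro exI[of _ "Const c"]) auto

lemma has_leading_var: "p > 1 \<Longrightarrow> has_leading p (Poly_Mapping.single i 1) (\<lambda>x. x i)"
  unfolding has_leading_def by (intro exI[of _ "Var i"]) (auto simp del: One_nat_def)

lemma dominated_add: assumes "dominated p t f" "dominated p t g" shows "dominated p t (\<lambda>x. f x + g x)"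
proof -
  obtain P Q where P: "\<forall>u\<in>keys P. monomial_le u t" "\<forall>x. [f x = mpoly_eval P x] (mod int p)"
    and Q: "\<forall>u\<in>keys Q. monomial_le u t" "\<forall>x. [g x = mpoly_eval Q x] (mod int p)"
    using assms unfolding dominated_def by blast
  have "\<forall>u\<in>keys (P + Q). monomial_le u t" using P Q keys_add[of P Q] by blast
  moreover have "[f x + g x = mpoly_eval (P + Q) x] (mod int p)" for x
    using P Q by (simp add: mpoly_eval_add cong_add)
  ultimately show ?thesis unfolding dominated_def by blast
qed

lemma dominated_sum: "(\<And>i. i \<in> I \<Longrightarrow> dominated p t (f i)) \<Longrightarrow> dominated p t (\<lambda>x. \<Sum>i\<in>I. f i x)"
  by (induction I rule: infinite_finite_induct) (auto intro: dominated_add dominated_const)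

lemma keys_mult_monomial_le:
  assumes "\<forall>u\<in>keys P. monomial_le u s" "\<forall>u\<in>keys Q. monomial_le u t"
  shows "\<forall>u\<in>keys ((P :: mpoly) * Q). monomial_le u (s + t)"
  using keys_mult[of P Q] assms by (fastforce intro: monomial_le_add)

lemma dominated_mult: assumes "dominated p s f" "dominated p t g" shows "dominated p (s + t) (\<lambda>x. f x * g x)"
proof -
  obtain P Q where P: "\<forall>u\<in>keys P. monomial_le u s" "\<forall>x. [f x = mpoly_eval P x] (mod int p)"
    and Q: "\<forall>u\<in>keys Q. monomial_le u t" "\<forall>x. [g x = mpoly_eval Q x] (mod int p)"
    using assms unfolding dominated_def by blast
  have "[f x * g x = mpoly_eval (P * Q) x] (mod int p)" for x
    using P Q by (simp add: mpoly_eval_mult cong_mult)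
  then show ?thesis unfolding dominated_def using keys_mult_monomial_le[OF P(1) Q(1)] by blast
qed

text \<open>
  A product of monomials below \<open>s\<close> and \<open>t\<close> can only equal the monomial \<open>s + t\<close> if both factors are maximal.
\<close>

lemma lookup_mult_top:
  assumes "\<forall>u\<in>keys P. monomial_le u s" "\<forall>u\<in>keys Q. monomial_le u t"
  shows "lookup ((P :: mpoly) * Q) (s + t) = lookup P s * lookup Q t"
proof -
  have "lookup (P * Q) (s + t) =
    (\<Sum>a\<in>keys P. \<Sum>b\<in>keys Q. if a + b = s + t then lookup P a * lookup Q b else 0)"
    by (simp add: mpoly_mult_eq lookup_sum lookup_single when_def)
  also have "\<dots> = (\<Sum>a\<in>keys P. \<Sum>b\<in>keys Q. if a = s then (if b = t then lookup P a * lookup Q b else 0) else 0)"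
  proof (intro sum.cong refl)
    fix a b assume "a \<in> keys P" "b \<in> keys Q"
    then have "a + b = s + t \<longleftrightarrow> a = s \<and> b = t" using assms monomial_le_add_eqD by blast
    then show "(if a + b = s + t then lookup P a * lookup Q b else 0) =
      (if a = s then (if b = t then lookup P a * lookup Q b else 0) else 0)" by simp
  qed
  also have "\<dots> = (\<Sum>a\<in>keys P. if a = s then (\<Sum>b\<in>keys Q. if b = t then lookup P a * lookup Q b else 0) else 0)"
    by (intro sum.cong refl) simp
  also have "\<dots> = lookup P s * lookup Q t" by (simp add: sum.delta in_keys_iff)
  finally show ?thesis .
qed

lemma has_leading_mult:
  assumes p: "prime p" and "has_leading p s f" "has_leading p t g" shows "has_leading p (s + t) (\<lambda>x. f x * g x)"
proof -
  obtain P Q where P: "\<forall>u\<in>keys P. monomial_le u s" "\<not> int p dvd lookup P s" "\<forall>x. [f x = mpoly_eval P x] (mod int p)"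
    and Q: "\<forall>u\<in>keys Q. monomial_le u t" "\<not> int p dvd lookup Q t" "\<forall>x. [g x = mpoly_eval Q x] (mod int p)"
    using assms unfolding has_leading_def by blast
  have "[f x * g x = mpoly_eval (P * Q) x] (mod int p)" for x
    using P Q by (simp add: mpoly_eval_mult cong_mult)
  moreover have "\<not> int p dvd lookup (P * Q) (s + t)"
    unfolding lookup_mult_top[OF P(1) Q(1)] using P Q p by (simp add: prime_dvd_mult_iff)
  ultimately show ?thesis unfolding has_leading_def using keys_mult_monomial_le[OF P(1) Q(1)] by blast
qed

lemma has_leading_power: "prime p \<Longrightarrow> has_leading p t f \<Longrightarrow> has_leading p (exponent_scale n t) (\<lambda>x. f x ^ n)"
proof (induction n)
  case 0
  have "\<not> int p dvd 1" using 0 by (auto dest: prime_gt_1_nat)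
  then show ?case using has_leading_const by simp
next
  case (Suc n)
  then show ?case using has_leading_mult[of p t f "exponent_scale n t" "\<lambda>x. f x ^ n"] by (simp add: exponent_scale_Suc)
qed

lemma has_leading_prod: "prime p \<Longrightarrow> (\<And>i. i \<in> I \<Longrightarrow> has_leading p (t i) (f i)) \<Longrightarrow> has_leading p (\<Sum>i\<in>I. t i) (\<lambda>x. \<Prod>i\<in>I. f i x)"
proof (induction I rule: infinite_finite_induct)
  case (infinite A)
  have "\<not> int p dvd 1" using infinite by (auto dest: prime_gt_1_nat)
  then show ?case using has_leading_const infinite by simp
next
  case empty
  have "\<not> int p dvd 1" using empty by (auto dest: prime_gt_1_nat)
  then show ?case using has_leading_const by simp
next
  case (insert i I)
  then show ?case using has_leading_mult[of p "t i" "f i" "\<Sum>i\<in>I. t i" "\<lambda>x. \<Prod>i\<in>I. f i x"] by simp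
qed

lemma dominated_power: "dominated p t f \<Longrightarrow> dominated p (exponent_scale n t) (\<lambda>x. f x ^ n)"
proof (induction n)
  case 0 then show ?case using dominated_const by simp
next
  case (Suc n)
  then show ?case using dominated_mult[of p t f "exponent_scale n t" "\<lambda>x. f x ^ n"] by (simp add: exponent_scale_Suc)
qed

lemma dominated_prod: "(\<And>i. i \<in> I \<Longrightarrow> dominated p (t i) (f i)) \<Longrightarrow> dominated p (\<Sum>i\<in>I. t i) (\<lambda>x. \<Prod>i\<in>I. f i x)"
proof (induction I rule: infinite_finite_induct)
  case (insert i I)
  then show ?case using dominated_mult[of p "t i" "f i" "\<Sum>i\<in>I. t i" "\<lambda>x. \<Prod>i\<in>I. f i x"] by simp
qed (simp_all add: dominated_const)

lemma has_leading_add_dominated: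
  assumes "has_leading p t f" "dominated p s g" "monomial_le s t" "s \<noteq> t" shows "has_leading p t (\<lambda>x. f x + g x)"
proof -
  obtain P Q where P: "\<forall>u\<in>keys P. monomial_le u t" "\<not> int p dvd lookup P t" "\<forall>x. [f x = mpoly_eval P x] (mod int p)"
    and Q: "\<forall>u\<in>keys Q. monomial_le u s" "\<forall>x. [g x = mpoly_eval Q x] (mod int p)"
    using assms unfolding has_leading_def dominated_def by blast
  have "t \<notin> keys Q" using Q assms monomial_le_antisym by blast
  then have "lookup (P + Q) t = lookup P t" by (simp add: lookup_add in_keys_iff)
  moreover have "\<forall>u\<in>keys (P + Q). monomial_le u t" using P Q keys_add[of P Q] assms(3) monomial_le_trans by blast
  moreover have "[f x + g x = mpoly_eval (P + Q) x] (mod int p)" for x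
    using P Q by (simp add: mpoly_eval_add cong_add)
  ultimately show ?thesis unfolding has_leading_def using P(2) by metis
qed

lemma dominated_compose:
  assumes f: "\<And>j. j \<in> V \<Longrightarrow> dominated p (M j) (f j)" and V: "finite V"
    and u: "\<And>u. u \<in> keys P \<Longrightarrow> keys u \<subseteq> V \<and> monomial_le (\<Sum>j\<in>V. exponent_scale (lookup u j) (M j)) T"
  shows "dominated p T (\<lambda>x. mpoly_eval P (\<lambda>j. f j x))"
proof -
  have "dominated p T (\<lambda>x. lookup P u * monomial_eval (\<lambda>j. f j x) u)" if "u \<in> keys P" for u
  proof -
    have "dominated p (0 + (\<Sum>j\<in>V. exponent_scale (lookup u j) (M j))) (\<lambda>x. lookup P u * (\<Prod>j\<in>V. f j x ^ lookup u j))"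
      by (intro dominated_mult dominated_prod dominated_power dominated_const f)
    then show ?thesis using u[OF that] V dominated_mono by (simp add: monomial_eval_superset)
  qed
  then have "dominated p T (\<lambda>x. \<Sum>u\<in>keys P. lookup P u * monomial_eval (\<lambda>j. f j x) u)" by (rule dominated_sum)
  then show ?thesis by (simp add: mpoly_eval_superset[OF finite_keys order.refl])
qed

section \<open>Counting zeros modulo a prime\<close>

lemma card_roots_le:
  assumes p: "prime p" shows "degree q \<le> n \<Longrightarrow> \<not> int p dvd coeff q n \<Longrightarrow> card {x \<in> Fp p. int p dvd poly q x} \<le> n"
proof (induction n arbitrary: q)
  case 0
  then obtain c where "q = [:c:]" using degree_eq_zeroE by blast
  then show ?case using 0 by simp
next
  case (Suc n)
  show ?case
  proof (cases "\<exists>r\<in>Fp p. int p dvd poly q r")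
    case False
    then have E: "{x \<in> Fp p. int p dvd poly q x} = {}" by blast
    show ?thesis unfolding E by simp
  next
    case True
    then obtain r where r: "r \<in> Fp p" "int p dvd poly q r" by blast
    define s where "s = synthetic_div q r"
    have qs: "q = [:-r, 1:] * s + [:poly q r:]" unfolding s_def by (rule synthetic_div_correct'[symmetric])
    have ds: "degree s \<le> n" using Suc.prems(1) by (simp add: s_def degree_synthetic_div)
    have "coeff q (Suc n) = coeff ([:-r, 1:] * s) (Suc n) + coeff [:poly q r:] (Suc n)"
      by (subst qs) (simp only: coeff_add)
    also have "\<dots> = coeff s n"
      using ds by (simp add: coeff_eq_0)
    finally have "\<not> int p dvd coeff s n" using Suc.prems(2) by simp
    then have IH: "card {x \<in> Fp p. int p dvd poly s x} \<le> n" using Suc.IH ds by blast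
    have "{x \<in> Fp p. int p dvd poly q x} \<subseteq> insert r {x \<in> Fp p. int p dvd poly s x}"
    proof
      fix x assume x: "x \<in> {x \<in> Fp p. int p dvd poly q x}"
      show "x \<in> insert r {x \<in> Fp p. int p dvd poly s x}"
      proof (cases "x = r")
        case False
        have "poly q x = (x - r) * poly s x + poly q r" by (subst qs) (simp add: algebra_simps)
        then have "int p dvd (x - r) * poly s x" using x r
          by (metis (no_types, lifting) dvd_add_left_iff mem_Collect_eq)
        moreover have "\<not> int p dvd x - r"
        proof
          assume "int p dvd x - r"
          then have "[x = r] (mod int p)" by (simp add: cong_iff_dvd_diff)
          then show False using False x r by (simp add: Fp_def cong_def)
        qed
        ultimately show ?thesis using x p by (simp add: prime_dvd_mult_iff)
      qed simp
    qed
    then have "card {x \<in> Fp p. int p dvd poly q x} \<le> card (insert r {x \<in> Fp p. int p dvd poly s x})"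
      by (intro card_mono) auto
    also have "\<dots> \<le> Suc (card {x \<in> Fp p. int p dvd poly s x})" by (rule card_insert_le_m1) auto
    finally show ?thesis using IH by linarith
  qed
qed

text \<open>
  The zero count by induction on the set of variables. Expanding in powers of \<open>x v\<close>, the coefficient of
  the highest power is a polynomial of the same shape in the other variables; where it does not vanish
  there are at most \<open>ex u0 v\<close> roots \<open>x v\<close>. Indexing the monomials by an arbitrary finite set \<open>S\<close> means that
  passing to this coefficient only shrinks \<open>S\<close>.
\<close>

lemma schwartz_zippel_indexed:
  fixes ex :: "'i \<Rightarrow> nat \<Rightarrow> nat" and c :: "'i \<Rightarrow> int"
  assumes p: "prime p" and V: "finite V"
  shows "finite S \<Longrightarrow> u0 \<in> S \<Longrightarrow> \<not> int p dvd c u0 \<Longrightarrow> (\<And>u j. u \<in> S \<Longrightarrow> j \<in> V \<Longrightarrow> ex u j \<le> ex u0 j) \<Longrightarrow>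
    (\<And>u. u \<in> S \<Longrightarrow> u \<noteq> u0 \<Longrightarrow> \<exists>j\<in>V. ex u j \<noteq> ex u0 j) \<Longrightarrow>
    p * card {x \<in> PiE V (\<lambda>_. Fp p). int p dvd (\<Sum>u\<in>S. c u * (\<Prod>j\<in>V. x j ^ ex u j))}
      \<le> (\<Sum>j\<in>V. ex u0 j) * p ^ card V"
  using V
proof (induction V arbitrary: S rule: finite_induct)
  case empty
  then have "S = {u0}" by auto
  then show ?case using empty by simp
next
  case (insert v W)
  define n where "n = ex u0 v"
  define S' where "S' = {u \<in> S. ex u v = n}"
  define f where "f x = (\<Sum>u\<in>S. c u * (\<Prod>j\<in>insert v W. x j ^ ex u j))" for x :: "nat \<Rightarrow> int"
  define g where "g x = (\<Sum>u\<in>S'. c u * (\<Prod>j\<in>W. x j ^ ex u j))" for x :: "nat \<Rightarrow> int"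
  let ?Z = "{x \<in> PiE (insert v W) (\<lambda>_. Fp p). int p dvd f x}"
  let ?Z' = "{x \<in> PiE W (\<lambda>_. Fp p). int p dvd g x}"
  have finPi: "finite (PiE W (\<lambda>_. Fp p))" using insert by (intro finite_PiE) auto
  have IH: "p * card ?Z' \<le> (\<Sum>j\<in>W. ex u0 j) * p ^ card W"
    unfolding g_def
  proof (rule insert.IH)
    show "\<exists>j\<in>W. ex u j \<noteq> ex u0 j" if "u \<in> S'" "u \<noteq> u0" for u
      using insert.prems(5)[of u] that by (auto simp: S'_def n_def)
  qed (use insert.prems in \<open>auto simp: S'_def n_def\<close>)
  define R where "R y = {a \<in> Fp p. int p dvd f (y(v := a))}" for y
  have fin_R: "finite (R y)" for y by (simp add: R_def)
  have R1: "card (R y) \<le> p" for y using card_mono[of "Fp p" "R y"] by (auto simp: R_def)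
  have R2: "card (R y) \<le> n" if "\<not> int p dvd g y" for y
  proof -
    define q where "q = (\<Sum>u\<in>S. monom (c u * (\<Prod>j\<in>W. y j ^ ex u j)) (ex u v))"
    have "f (y(v := a)) = poly q a" for a
    proof -
      have "(\<Prod>j\<in>W. (y(v := a)) j ^ ex u j) = (\<Prod>j\<in>W. y j ^ ex u j)" for u
        using insert.hyps(2) by (intro prod.cong) auto
      then show ?thesis
        using insert.hyps by (simp add: f_def q_def poly_sum poly_monom mult_ac)
    qed
    moreover have "degree q \<le> n" unfolding q_def
      using insert.prems by (intro degree_sum_le order.trans[OF degree_monom_le]) (auto simp: n_def)
    moreover have "coeff q n = g y"
      using insert.prems(1) by (simp add: q_def g_def coeff_sum S'_def sum.If_cases Int_def conj_commute)
    ultimately show ?thesis unfolding R_def using card_roots_le[OF p, of q n] that by simp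
  qed
  have "?Z \<subseteq> (\<lambda>(y, a). y(v := a)) ` (SIGMA y:PiE W (\<lambda>_. Fp p). R y)"
  proof
    fix x assume x: "x \<in> ?Z"
    have "x = (x(v := undefined))(v := x v)" by simp
    moreover have "x(v := undefined) \<in> PiE W (\<lambda>_. Fp p)"
      using x insert.hyps(2) by (auto simp: PiE_iff extensional_def)
    moreover have "x v \<in> R (x(v := undefined))" using x by (auto simp: R_def PiE_iff)
    ultimately show "x \<in> (\<lambda>(y, a). y(v := a)) ` (SIGMA y:PiE W (\<lambda>_. Fp p). R y)"
      by (metis (no_types, lifting) SigmaI case_prod_conv image_eqI)
  qed
  then have "card ?Z \<le> card ((\<lambda>(y, a). y(v := a)) ` (SIGMA y:PiE W (\<lambda>_. Fp p). R y))"
    using finPi fin_R by (intro card_mono finite_imageI finite_SigmaI) auto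
  also have "\<dots> \<le> card (SIGMA y:PiE W (\<lambda>_. Fp p). R y)"
    using finPi fin_R by (intro card_image_le finite_SigmaI) auto
  also have "\<dots> = (\<Sum>y\<in>PiE W (\<lambda>_. Fp p). card (R y))" using finPi fin_R by (simp add: card_SigmaI)
  also have "\<dots> \<le> (\<Sum>y\<in>PiE W (\<lambda>_. Fp p). p * of_bool (int p dvd g y) + n)"
    by (rule sum_mono) (use R1 R2 in \<open>auto simp: of_bool_def intro: trans_le_add1\<close>)
  also have "\<dots> = p * card ?Z' + n * p ^ card W"
  proof -
    have "(\<Sum>y\<in>PiE W (\<lambda>_. Fp p). of_bool (int p dvd g y)) = card ?Z'"
      using finPi by (simp add: Int_def)
    then show ?thesis using insert.hyps(1)
      by (simp add: sum.distrib card_PiE flip: sum_distrib_left)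
  qed
  also have "\<dots> \<le> (\<Sum>j\<in>W. ex u0 j) * p ^ card W + n * p ^ card W" using IH by simp
  finally have "card ?Z \<le> (\<Sum>j\<in>insert v W. ex u0 j) * p ^ card W"
    using insert.hyps by (simp add: n_def algebra_simps)
  then have "p * card ?Z \<le> p * ((\<Sum>j\<in>insert v W. ex u0 j) * p ^ card W)" by (rule mult_le_mono2)
  then show ?case using insert.hyps unfolding f_def by (simp add: mult_ac)
qed

lemma schwartz_zippel:
  assumes p: "prime p" and V: "finite V" "keys t \<subseteq> V" and f: "has_leading p t f"
  shows "p * card {x \<in> PiE V (\<lambda>_. Fp p). int p dvd f x} \<le> (\<Sum>j\<in>V. lookup t j) * p ^ card V"
proof -
  obtain P where P: "\<forall>u\<in>keys P. monomial_le u t" "\<not> int p dvd lookup P t" "\<forall>x. [f x = mpoly_eval P x] (mod int p)"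
    using f unfolding has_leading_def by blast
  have kV: "keys u \<subseteq> V" if "u \<in> keys P" for u using P(1) that V monomial_le_keys by blast
  have "int p dvd f x \<longleftrightarrow> int p dvd (\<Sum>u\<in>keys P. lookup P u * (\<Prod>j\<in>V. x j ^ lookup u j))" for x
  proof -
    have "mpoly_eval P x = (\<Sum>u\<in>keys P. lookup P u * (\<Prod>j\<in>V. x j ^ lookup u j))"
      unfolding mpoly_eval_superset[OF finite_keys order.refl]
      by (intro sum.cong refl arg_cong2[where f = "(*)"] monomial_eval_superset V kV)
    then show ?thesis using P(3) cong_dvd_iff by metis
  qed
  moreover have "p * card {x \<in> PiE V (\<lambda>_. Fp p). int p dvd (\<Sum>u\<in>keys P. lookup P u * (\<Prod>j\<in>V. x j ^ lookup u j))}
     \<le> (\<Sum>j\<in>V. lookup t j) * p ^ card V"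
  proof (rule schwartz_zippel_indexed[OF p V(1)])
    have "t \<in> keys P" using P(2) by (metis dvd_0_right in_keys_iff)
    then show "t \<in> keys P" .
    show "\<exists>j\<in>V. lookup u j \<noteq> lookup t j" if u: "u \<in> keys P" "u \<noteq> t" for u
    proof (rule ccontr)
      assume "\<not> ?thesis"
      then have eq: "\<And>j. j \<in> V \<Longrightarrow> lookup u j = lookup t j" by blast
      have "lookup u j = lookup t j" for j
      proof (cases "j \<in> V")
        case False
        then have "j \<notin> keys u" "j \<notin> keys t" using kV[OF u(1)] V(2) by auto
        then show ?thesis by (simp add: in_keys_iff)
      qed (rule eq)
      then show False using u by (metis poly_mapping_eqI)
    qed
  qed (use P in \<open>auto simp: monomial_le_def\<close>)
  ultimately show ?thesis by simp
qed

section \<open>Degree growth of the iterates\<close>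

text \<open>
  The exponent vector of the leading monomial of \<open>G\<^sub>i\<^sub>,\<^sub>k\<close>, where \<open>F\<^sub>i\<^sup>(\<^sup>k\<^sup>) = X\<^sub>i G\<^sub>i\<^sub>,\<^sub>k + H\<^sub>i\<^sub>,\<^sub>k\<close>. Together with the
  exponent \<open>1\<close> of \<open>X\<^sub>i\<close> it is the row \<open>i\<close> of the matrix power \<open>S\<^sup>k\<close>; the recursion reflects
  \<open>F\<^sub>i\<^sup>(\<^sup>k\<^sup>+\<^sup>1\<^sup>) = F\<^sub>i\<^sup>(\<^sup>k\<^sup>) G\<^sub>i(F\<^sup>(\<^sup>k\<^sup>)) + H\<^sub>i(F\<^sup>(\<^sup>k\<^sup>))\<close>.
\<close>

primrec growth_exponent :: "nat \<Rightarrow> (nat \<Rightarrow> nat \<Rightarrow> nat) \<Rightarrow> nat \<Rightarrow> nat \<Rightarrow> (nat \<Rightarrow>\<^sub>0 nat)" where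
  "growth_exponent m S 0 i = 0"
| "growth_exponent m S (Suc k) i = growth_exponent m S k i +
     (\<Sum>j\<in>{i+1..m}. exponent_scale (S i j) (Poly_Mapping.single j 1 + growth_exponent m S k j))"

lemma growth_exponent_support: "j \<notin> {i+1..m} \<Longrightarrow> lookup (growth_exponent m S k i) j = 0"
proof (induction k arbitrary: i)
  case (Suc k)
  then show ?case by (auto simp: lookup_add lookup_sum lookup_single when_def)
qed simp

lemma keys_growth_exponent: "keys (growth_exponent m S k i) \<subseteq> {i+1..m}"
proof
  fix j assume "j \<in> keys (growth_exponent m S k i)"
  then show "j \<in> {i+1..m}" using growth_exponent_support[of j i m S k] by (cases "j \<in> {i+1..m}") (auto simp: in_keys_iff)
qed

text \<open>
  For a unipotent triangular matrix the entries of \<open>S\<^sup>k\<close> next to the diagonal grow linearly in \<open>k\<close>.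
\<close>

lemma growth_exponent_next:
  assumes "i < m" shows "lookup (growth_exponent m S k i) (i + 1) = k * S i (i + 1)"
proof (induction k)
  case (Suc k)
  have "(\<Sum>j\<in>{i+1..m}. S i j * (lookup (Poly_Mapping.single j 1) (i + 1) + lookup (growth_exponent m S k j) (i + 1)))
     = (\<Sum>j\<in>{i+1..m}. if j = i + 1 then S i j else 0)"
    by (intro sum.cong refl) (auto simp: growth_exponent_support lookup_single when_def)
  also have "\<dots> = S i (i + 1)" using assms by (simp add: sum.delta)
  finally show ?case using Suc by (simp add: lookup_add lookup_sum)
qed simp

lemma growth_exponent_mono: "k \<le> k' \<Longrightarrow> monomial_le (growth_exponent m S k i) (growth_exponent m S k' i)"
proof (induction rule: dec_induct)
  case (step n)
  have "monomial_le (growth_exponent m S n i) (growth_exponent m S (Suc n) i)"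
    by (simp add: monomial_le_add_right)
  then show ?case using step monomial_le_trans by blast
qed simp

text \<open>
  The degrees grow only polynomially: row \<open>i\<close> is driven by the rows below it, whose growth has a smaller
  exponent.
\<close>

lemma growth_exponent_total:
  assumes d: "\<And>i. i < m \<Longrightarrow> (\<Sum>j\<in>{i+1..m}. S i j) \<le> d"
  shows "i \<le> m \<Longrightarrow> 1 + (\<Sum>l\<in>{0..m}. lookup (growth_exponent m S k i) l) \<le> (1 + d * k) ^ (m - i)"
proof (induction k arbitrary: i)
  case 0 then show ?case by simp
next
  case (Suc k)
  show ?case
  proof (cases "i = m")
    case True
    then show ?thesis using Suc.IH[of m] by simp
  next
    case False
    then obtain n where n: "m - i = Suc n" using Suc.prems by (metis Suc_diff_Suc le_neq_implies_less)
    have "(\<Sum>l\<in>{0..m}. lookup (growth_exponent m S (Suc k) i) l) = (\<Sum>l\<in>{0..m}. lookup (growth_exponent m S k i) l) +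
      (\<Sum>l\<in>{0..m}. \<Sum>j\<in>{i+1..m}. S i j * (lookup (Poly_Mapping.single j 1) l + lookup (growth_exponent m S k j) l))"
      by (simp add: lookup_add lookup_sum sum.distrib)
    also have "(\<Sum>l\<in>{0..m}. \<Sum>j\<in>{i+1..m}. S i j * (lookup (Poly_Mapping.single j 1) l + lookup (growth_exponent m S k j) l))
      = (\<Sum>j\<in>{i+1..m}. \<Sum>l\<in>{0..m}. S i j * (lookup (Poly_Mapping.single j 1) l + lookup (growth_exponent m S k j) l))"
      by (rule sum.swap)
    also have "\<dots> = (\<Sum>j\<in>{i+1..m}. S i j * (1 + (\<Sum>l\<in>{0..m}. lookup (growth_exponent m S k j) l)))"
    proof (intro sum.cong refl)
      fix j assume "j \<in> {i+1..m}"
      then have "(\<Sum>l\<in>{0..m}. lookup (Poly_Mapping.single j 1) l) = (1 :: nat)"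
        by (simp add: lookup_single when_def sum.delta)
      then show "(\<Sum>l\<in>{0..m}. S i j * (lookup (Poly_Mapping.single j 1) l + lookup (growth_exponent m S k j) l))
         = S i j * (1 + (\<Sum>l\<in>{0..m}. lookup (growth_exponent m S k j) l))"
        by (simp only: sum_distrib_left[symmetric] sum.distrib)
    qed
    also have "\<dots> \<le> (\<Sum>j\<in>{i+1..m}. S i j * (1 + d * k) ^ n)"
    proof (intro sum_mono mult_left_mono)
      fix j assume j: "j \<in> {i+1..m}"
      then have "1 + (\<Sum>l\<in>{0..m}. lookup (growth_exponent m S k j) l) \<le> (1 + d * k) ^ (m - j)" using Suc.IH by simp
      also have "\<dots> \<le> (1 + d * k) ^ n" using j n by (intro power_increasing) auto
      finally show "1 + (\<Sum>l\<in>{0..m}. lookup (growth_exponent m S k j) l) \<le> (1 + d * k) ^ n" .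
    qed simp
    also have "\<dots> = (\<Sum>j\<in>{i+1..m}. S i j) * (1 + d * k) ^ n" by (simp add: sum_distrib_right)
    also have "\<dots> \<le> d * (1 + d * k) ^ n" using d[of i] False Suc.prems by (intro mult_right_mono) auto
    finally have "1 + (\<Sum>l\<in>{0..m}. lookup (growth_exponent m S (Suc k) i) l) \<le>
       (1 + d * k) ^ Suc n + d * (1 + d * k) ^ n" using Suc.IH[of i] Suc.prems n by simp
    also have "\<dots> = (1 + d * Suc k) * (1 + d * k) ^ n" by (simp add: algebra_simps)
    also have "\<dots> \<le> (1 + d * Suc k) * (1 + d * Suc k) ^ n" by (intro mult_left_mono power_mono) auto
    finally show ?thesis by (simp add: n)
  qed
qed

lemma prod_Var_power: "finite I \<Longrightarrow>
  (\<Prod>j\<in>I. Var j ^ n j) = Poly_Mapping.single (\<Sum>j\<in>I. exponent_scale (n j) (Poly_Mapping.single j 1)) 1"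
proof (induction I rule: finite_induct)
  case (insert i I)
  have "Var i ^ k = Poly_Mapping.single (exponent_scale k (Poly_Mapping.single i 1)) 1" for k
    by (induction k) (simp_all add: Var_def mult_single exponent_scale_Suc)
  then show ?case using insert by (simp add: mult_single)
qed simp

lemma deg_in_less_imp: "deg_in j F < ereal (real n) \<Longrightarrow> u \<in> keys F \<Longrightarrow> lookup u j < n"
proof -
  assume a: "deg_in j F < ereal (real n)" and u: "u \<in> keys F"
  have "ereal (real (lookup u j)) \<le> deg_in j F" unfolding deg_in_def using u by (rule SUP_upper)
  then have "ereal (real (lookup u j)) < ereal (real n)" using a by (rule le_less_trans)
  then show "lookup u j < n" by simp
qed

lemma deg_in_le_imp: "deg_in j F \<le> ereal (real n) \<Longrightarrow> u \<in> keys F \<Longrightarrow> lookup u j \<le> n"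
proof -
  assume a: "deg_in j F \<le> ereal (real n)" and u: "u \<in> keys F"
  have "ereal (real (lookup u j)) \<le> deg_in j F" unfolding deg_in_def using u by (rule SUP_upper)
  then have "ereal (real (lookup u j)) \<le> ereal (real n)" using a by (rule order.trans)
  then show "lookup u j \<le> n" by simp
qed

lemma total_deg_ge: "u \<in> keys F \<Longrightarrow> ereal (real (\<Sum>j\<in>keys u. lookup u j)) \<le> total_deg F"
  unfolding total_deg_def by (rule SUP_upper)

lemma Fp_nonzero_not_dvd: "g \<in> Fp p \<Longrightarrow> g \<noteq> 0 \<Longrightarrow> \<not> int p dvd g"
  by (auto simp: Fp_def dest: zdvd_imp_le)

text \<open>
  The shape of one row of the system as congruences between polynomial functions. The last conclusion
  bounds the exponents by the degree of the system: the monomial of \<open>X\<^sub>i G\<^sub>i\<close> with coefficient \<open>g\<close> cannot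
  cancel, since every other monomial of \<open>G\<^sub>i\<close> has a smaller degree in \<open>X\<^sub>i\<^sub>+\<^sub>1\<close> and \<open>H\<^sub>i\<close> does not contain \<open>X\<^sub>i\<close>.
\<close>

lemma poly_systems_row:
  assumes F: "F \<in> poly_systems p S m" and i: "i < m" and p: "p > 0"
  obtains G H Gt g where "\<And>x. [mpoly_eval (F i) x = x i * mpoly_eval G x + mpoly_eval H x] (mod int p)"
    "\<And>x. [mpoly_eval G x = g * (\<Prod>j\<in>{i+1..m}. x j ^ S i j) + mpoly_eval Gt x] (mod int p)"
    "\<not> int p dvd g"
    "\<And>u. u \<in> keys Gt \<Longrightarrow> keys u \<subseteq> {i+1..m} \<and> (\<forall>j\<in>{i+1..m}. lookup u j < S i j)"
    "\<And>u. u \<in> keys H \<Longrightarrow> keys u \<subseteq> {i+1..m} \<and> (\<forall>j\<in>{i+1..m}. lookup u j \<le> S i j)"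
    "ereal (real (1 + (\<Sum>j\<in>{i+1..m}. S i j))) \<le> total_deg (F i)"
proof -
  let ?I = "{i+1..m}"
  obtain G H g Gt where GH: "G \<in> Fp_mpolys p ?I" "H \<in> Fp_mpolys p ?I" "mpoly_cong p (F i) (Var i * G + H)"
    and g: "g \<in> Fp p" "g \<noteq> 0" and Gt: "Gt \<in> Fp_mpolys p ?I"
      "mpoly_cong p G (Const g * (\<Prod>j\<in>?I. Var j ^ S i j) + Gt)"
      "\<forall>j\<in>?I. deg_in j Gt < ereal (real (S i j))" and H: "\<forall>j\<in>?I. deg_in j H \<le> ereal (real (S i j))"
    using F i unfolding poly_systems_def by blast
  have gp: "\<not> int p dvd g" using g by (rule Fp_nonzero_not_dvd)
  have Gtk: "keys u \<subseteq> ?I \<and> (\<forall>j\<in>?I. lookup u j < S i j)" if "u \<in> keys Gt" for u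
    using Gt that deg_in_less_imp by (auto simp: Fp_mpolys_def)
  have Hk: "keys u \<subseteq> ?I \<and> (\<forall>j\<in>?I. lookup u j \<le> S i j)" if "u \<in> keys H" for u
    using GH(2) H that deg_in_le_imp by (auto simp: Fp_mpolys_def)
  have c1: "[mpoly_eval (F i) x = x i * mpoly_eval G x + mpoly_eval H x] (mod int p)" for x
    using mpoly_eval_cong_poly[OF GH(3)] by (simp add: mpoly_eval_add mpoly_eval_mult)
  have c2: "[mpoly_eval G x = g * (\<Prod>j\<in>?I. x j ^ S i j) + mpoly_eval Gt x] (mod int p)" for x
    using mpoly_eval_cong_poly[OF Gt(2)]
    by (simp add: mpoly_eval_add mpoly_eval_mult mpoly_eval_prod mpoly_eval_power)
  \<comment> \<open>the dominating monomial of the row occurs in \<open>F i\<close>\<close>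
  define t where "t = (\<Sum>j\<in>?I. exponent_scale (S i j) (Poly_Mapping.single j 1))"
  have lt: "lookup t l = (if l \<in> ?I then S i l else 0)" for l
    by (simp add: t_def lookup_sum lookup_single when_def sum.delta if_distrib[of "(*) _"] cong: if_cong)
  have "t \<notin> keys Gt"
  proof
    assume "t \<in> keys Gt"
    moreover have "i + 1 \<in> ?I" using i by simp
    ultimately have "lookup t (i + 1) < S i (i + 1)" using Gtk by blast
    then show False using i by (simp add: lt)
  qed
  moreover have "lookup (Const g * (\<Prod>j\<in>?I. Var j ^ S i j)) t = g"
    unfolding prod_Var_power[OF finite_atLeastAtMost] Const_def mult_single t_def[symmetric] by simp
  ultimately have "[lookup G t = g] (mod int p)"
    using Gt(2) unfolding mpoly_cong_def by (metis add.right_neutral in_keys_iff lookup_add)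
  moreover have "lookup (Var i * G + H) (Poly_Mapping.single i 1 + t) = lookup G t"
  proof -
    have "lookup (Var i * G) (Poly_Mapping.single i 1 + t) = (\<Sum>b\<in>keys G. if b = t then lookup G b else 0)"
      unfolding mpoly_mult_eq keys_Var lookup_sum by (simp add: lookup_single when_def Var_def)
    also have "\<dots> = lookup G t" by (simp add: in_keys_iff)
    finally have 1: "lookup (Var i * G) (Poly_Mapping.single i 1 + t) = lookup G t" .
    have "i \<in> keys (Poly_Mapping.single i 1 + t)" by (simp add: in_keys_iff lookup_add)
    then have "Poly_Mapping.single i 1 + t \<notin> keys H" using Hk by fastforce
    then show ?thesis using 1 by (simp add: lookup_add in_keys_iff)
  qed
  ultimately have "[lookup (F i) (Poly_Mapping.single i 1 + t) = g] (mod int p)"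
    using GH(3) unfolding mpoly_cong_def by (metis cong_trans)
  then have "Poly_Mapping.single i 1 + t \<in> keys (F i)"
    using gp cong_dvd_iff by (metis dvd_0_right in_keys_iff)
  moreover have "(\<Sum>j\<in>keys (Poly_Mapping.single i 1 + t). lookup (Poly_Mapping.single i 1 + t) j) = 1 + (\<Sum>j\<in>?I. S i j)"
  proof -
    have "(\<Sum>j\<in>keys (Poly_Mapping.single i 1 + t). lookup (Poly_Mapping.single i 1 + t) j) =
      (\<Sum>j\<in>insert i ?I. lookup (Poly_Mapping.single i 1 + t) j)"
      by (rule sum.mono_neutral_left) (auto simp: in_keys_iff lookup_add lt lookup_single when_def split: if_splits)
    also have "\<dots> = 1 + (\<Sum>j\<in>?I. S i j)"
      by (simp add: lookup_add lt lookup_single when_def)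
    finally show ?thesis .
  qed
  ultimately have "ereal (real (1 + (\<Sum>j\<in>?I. S i j))) \<le> total_deg (F i)" using total_deg_ge by metis
  from c1 c2 gp Gtk Hk this show thesis by (rule that)
qed

lemma row_sum_le_degree:
  assumes F: "F \<in> poly_systems p S m" and i: "i < m" and p: "p > 0" and d: "system_deg m F = ereal (real d)"
  shows "(\<Sum>j\<in>{i+1..m}. S i j) \<le> d"
proof -
  have "ereal (real (1 + (\<Sum>j\<in>{i+1..m}. S i j))) \<le> total_deg (F i)"
    by (rule poly_systems_row[OF F i p])
  also have "\<dots> \<le> system_deg m F" unfolding system_deg_def using i by (intro Max_ge) auto
  finally have "1 + (\<Sum>j\<in>{i+1..m}. S i j) \<le> d" unfolding d ereal_less_eq of_nat_le_iff .
  then show ?thesis by simp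
qed

definition lead_exponent :: "nat \<Rightarrow> (nat \<Rightarrow> nat \<Rightarrow> nat) \<Rightarrow> nat \<Rightarrow> nat \<Rightarrow> (nat \<Rightarrow>\<^sub>0 nat)" where
  "lead_exponent m S k i = Poly_Mapping.single i 1 + growth_exponent m S k i"

lemma has_leading_affine:
  assumes p: "prime p" and G: "has_leading p (growth_exponent m S k i) G" and H: "dominated p (growth_exponent m S k i) H"
    and f: "\<And>x. [f x = x i * G x + H x] (mod int p)"
  shows "has_leading p (lead_exponent m S k i) f"
proof -
  have "has_leading p (Poly_Mapping.single i 1 + growth_exponent m S k i) (\<lambda>x. x i * G x)"
    using has_leading_mult[OF p has_leading_var G] prime_gt_1_nat[OF p] by blast
  moreover have "lookup (growth_exponent m S k i) i = 0" by (rule growth_exponent_support) simp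
  then have "growth_exponent m S k i \<noteq> Poly_Mapping.single i 1 + growth_exponent m S k i"
    by (metis add_is_0 lookup_add lookup_single_eq zero_neq_one)
  ultimately have "has_leading p (lead_exponent m S k i) (\<lambda>x. x i * G x + H x)"
    unfolding lead_exponent_def using H monomial_le_add_right(2) by (intro has_leading_add_dominated) auto
  then show ?thesis using f by (rule has_leading_cong)
qed

text \<open>
  The triangular shape persists under iteration, and so does the leading monomial. In the inductive step
  the substitution of the \<open>k\<close>-th iterates into \<open>G\<^sub>i\<close> keeps the leading monomial leading, because in every
  other monomial of \<open>G\<^sub>i\<close> the variable \<open>X\<^sub>i\<^sub>+\<^sub>1\<close> has a smaller exponent and only the iterate of \<open>F\<^sub>i\<^sub>+\<^sub>1\<close>
  contains this variable.
\<close>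

lemma orbit_affine:
  assumes p: "prime p" and F: "F \<in> poly_systems p S m" and S: "\<And>i. i < m \<Longrightarrow> S i (i + 1) \<noteq> 0"
  shows "i \<le> m \<Longrightarrow> \<exists>G H. has_leading p (growth_exponent m S k i) G \<and> dominated p (growth_exponent m S k i) H \<and>
    (\<forall>x. [orbit p m F x k i = x i * G x + H x] (mod int p))"
proof (induction k arbitrary: i)
  case 0
  have "has_leading p 0 (\<lambda>_. 1)" using p by (intro has_leading_const) (auto dest: prime_gt_1_nat)
  then show ?case by (intro exI[of _ "\<lambda>_. 1"] exI[of _ "\<lambda>_. 0"]) (auto intro: dominated_const)
next
  case (Suc k)
  have p0: "p > 0" using p prime_gt_0_nat by blast
  obtain G0 H0 where GH0: "has_leading p (growth_exponent m S k i) G0" "dominated p (growth_exponent m S k i) H0"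
    "\<And>x. [orbit p m F x k i = x i * G0 x + H0 x] (mod int p)" using Suc by blast
  have lead: "has_leading p (lead_exponent m S k j) (\<lambda>x. orbit p m F x k j)" if j: "j \<le> m" for j
  proof -
    obtain G H where "has_leading p (growth_exponent m S k j) G" "dominated p (growth_exponent m S k j) H"
      "\<forall>x. [orbit p m F x k j = x j * G x + H x] (mod int p)" using Suc.IH[OF j] by blast
    then show ?thesis by (intro has_leading_affine[OF p, where G = G and H = H]) auto
  qed
  have orb: "[orbit p m F x (Suc k) i = mpoly_eval (F i) (orbit p m F x k)] (mod int p)" for x
    using Suc.prems by simp
  show ?case
  proof (cases "i = m")
    case True
    obtain g h where g: "g \<in> Fp p" "g \<noteq> 0" "mpoly_cong p (F m) (Const g * Var m + Const h)"
      using F unfolding poly_systems_def by blast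
    have gp: "\<not> int p dvd g" using g by (simp add: Fp_nonzero_not_dvd)
    have E: "growth_exponent m S (Suc k) i = growth_exponent m S k i" using True by simp
    have "has_leading p (0 + growth_exponent m S k i) (\<lambda>x. g * G0 x)"
      by (rule has_leading_mult[OF p has_leading_const[OF gp] GH0(1)])
    moreover have "dominated p (growth_exponent m S k i) (\<lambda>x. g * H0 x + h)"
      using dominated_mult[OF dominated_const[of p 0 g] GH0(2)] by (intro dominated_add dominated_const) simp
    moreover have "[orbit p m F x (Suc k) i = x i * (g * G0 x) + (g * H0 x + h)] (mod int p)" for x
    proof -
      have "[mpoly_eval (F m) (orbit p m F x k) = g * orbit p m F x k m + h] (mod int p)"
        using mpoly_eval_cong_poly[OF g(3), of "orbit p m F x k"] by (simp add: mpoly_eval_add mpoly_eval_mult)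
      also have "[g * orbit p m F x k m + h = g * (x i * G0 x + H0 x) + h] (mod int p)"
        using GH0(3)[of x] True by (intro cong_add cong_mult) auto
      also have "g * (x i * G0 x + H0 x) + h = x i * (g * G0 x) + (g * H0 x + h)" by (simp add: algebra_simps)
      finally show ?thesis using orb[of x] True cong_trans by blast
    qed
    ultimately show ?thesis unfolding E by (intro exI[of _ "\<lambda>x. g * G0 x"] exI[of _ "\<lambda>x. g * H0 x + h"]) auto
  next
    case False
    then have i: "i < m" using Suc.prems by simp
    let ?I = "{i+1..m}"
    obtain G H Gt g where
      FE: "\<And>x. [mpoly_eval (F i) x = x i * mpoly_eval G x + mpoly_eval H x] (mod int p)"
      and GE: "\<And>x. [mpoly_eval G x = g * (\<Prod>j\<in>?I. x j ^ S i j) + mpoly_eval Gt x] (mod int p)"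
      and gp: "\<not> int p dvd g"
      and Gtk: "\<And>u. u \<in> keys Gt \<Longrightarrow> keys u \<subseteq> ?I \<and> (\<forall>j\<in>?I. lookup u j < S i j)"
      and Hk: "\<And>u. u \<in> keys H \<Longrightarrow> keys u \<subseteq> ?I \<and> (\<forall>j\<in>?I. lookup u j \<le> S i j)"
      and "ereal (real (1 + (\<Sum>j\<in>?I. S i j))) \<le> total_deg (F i)"
      by (rule poly_systems_row[OF F i p0]) (rule that; assumption)
    define M where "M j = lead_exponent m S k j" for j
    define T where "T = (\<Sum>j\<in>?I. exponent_scale (S i j) (M j))"
    \<comment> \<open>the bound for the monomials of the lower part of \<open>G\<^sub>i\<close>, smaller than \<open>T\<close> in the exponent of \<open>X\<^sub>i\<^sub>+\<^sub>1\<close>\<close>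
    define s where "s = (\<Sum>j\<in>?I. exponent_scale (if j = i + 1 then S i j - 1 else S i j) (M j))"
    have top_orb: "has_leading p (M j) (\<lambda>x. orbit p m F x k j)" if "j \<in> ?I" for j
      using lead that by (simp add: M_def)
    have i1: "i + 1 \<in> ?I" using i by simp
    have sT: "monomial_le s T" unfolding s_def T_def by (intro monomial_le_sum) (simp add: monomial_le_def)
    have "s \<noteq> T"
    proof -
      have M1: "lookup (M (i + 1)) (i + 1) \<ge> 1" by (simp add: M_def lead_exponent_def lookup_add)
      have "lookup s (i + 1) = (\<Sum>j\<in>?I. (if j = i + 1 then S i j - 1 else S i j) * lookup (M j) (i + 1))"
        by (simp add: s_def lookup_sum)
      also have "\<dots> < (\<Sum>j\<in>?I. S i j * lookup (M j) (i + 1))"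
        by (rule sum_strict_mono_ex1) (use i1 M1 S[OF i] in \<open>auto intro!: bexI[of _ "i + 1"]\<close>)
      also have "\<dots> = lookup T (i + 1)" by (simp add: T_def lookup_sum)
      finally show ?thesis by auto
    qed
    have lowGt: "dominated p s (\<lambda>x. mpoly_eval Gt (\<lambda>j. orbit p m F x k j))"
    proof (rule dominated_compose[where V = ?I and M = M])
      fix u assume u: "u \<in> keys Gt"
      have "monomial_le (\<Sum>j\<in>?I. exponent_scale (lookup u j) (M j)) s"
        unfolding s_def
      proof (rule monomial_le_sum)
        fix j assume "j \<in> ?I"
        then have "lookup u j < S i j" using Gtk[OF u] by blast
        then have "lookup u j \<le> (if j = i + 1 then S i j - 1 else S i j)" by auto
        then show "monomial_le (exponent_scale (lookup u j) (M j)) (exponent_scale (if j = i + 1 then S i j - 1 else S i j) (M j))"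
          unfolding monomial_le_def lookup_exponent_scale by (intro allI mult_right_mono) auto
      qed
      then show "keys u \<subseteq> ?I \<and> monomial_le (\<Sum>j\<in>?I. exponent_scale (lookup u j) (M j)) s" using Gtk[OF u] by blast
    qed (use top_orb has_leading_imp_dominated in auto)
    have lowH: "dominated p T (\<lambda>x. mpoly_eval H (\<lambda>j. orbit p m F x k j))"
    proof (rule dominated_compose[where V = ?I and M = M])
      fix u assume u: "u \<in> keys H"
      have "monomial_le (\<Sum>j\<in>?I. exponent_scale (lookup u j) (M j)) T"
        unfolding T_def
      proof (rule monomial_le_sum)
        fix j assume "j \<in> ?I"
        then have "lookup u j \<le> S i j" using Hk[OF u] by blast
        then show "monomial_le (exponent_scale (lookup u j) (M j)) (exponent_scale (S i j) (M j))"
          unfolding monomial_le_def lookup_exponent_scale by (intro allI mult_right_mono) auto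
      qed
      then show "keys u \<subseteq> ?I \<and> monomial_le (\<Sum>j\<in>?I. exponent_scale (lookup u j) (M j)) T" using Hk[OF u] by blast
    qed (use top_orb has_leading_imp_dominated in auto)
    have "has_leading p (0 + T) (\<lambda>x. g * (\<Prod>j\<in>?I. orbit p m F x k j ^ S i j))"
      unfolding T_def by (intro has_leading_mult[OF p] has_leading_const gp has_leading_prod[OF p] has_leading_power[OF p] top_orb)
    then have "has_leading p T (\<lambda>x. g * (\<Prod>j\<in>?I. orbit p m F x k j ^ S i j) + mpoly_eval Gt (\<lambda>j. orbit p m F x k j))"
      using lowGt sT \<open>s \<noteq> T\<close> by (intro has_leading_add_dominated) auto
    then have topG: "has_leading p T (\<lambda>x. mpoly_eval G (orbit p m F x k))"
      by (rule has_leading_cong) (use GE in simp)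
    have E: "growth_exponent m S (Suc k) i = growth_exponent m S k i + T"
      by (simp add: T_def M_def lead_exponent_def)
    have "has_leading p (growth_exponent m S k i + T) (\<lambda>x. G0 x * mpoly_eval G (orbit p m F x k))"
      by (rule has_leading_mult[OF p GH0(1) topG])
    moreover have "dominated p (growth_exponent m S k i + T)
       (\<lambda>x. H0 x * mpoly_eval G (orbit p m F x k) + mpoly_eval H (orbit p m F x k))"
      by (intro dominated_add dominated_mult GH0(2) has_leading_imp_dominated[OF topG] dominated_mono[OF lowH] monomial_le_add_right)
    moreover have "[orbit p m F x (Suc k) i = x i * (G0 x * mpoly_eval G (orbit p m F x k)) +
        (H0 x * mpoly_eval G (orbit p m F x k) + mpoly_eval H (orbit p m F x k))] (mod int p)" for x
    proof -
      have "[mpoly_eval (F i) (orbit p m F x k) =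
         orbit p m F x k i * mpoly_eval G (orbit p m F x k) + mpoly_eval H (orbit p m F x k)] (mod int p)"
        by (rule FE)
      also have "[orbit p m F x k i * mpoly_eval G (orbit p m F x k) + mpoly_eval H (orbit p m F x k) =
         (x i * G0 x + H0 x) * mpoly_eval G (orbit p m F x k) + mpoly_eval H (orbit p m F x k)] (mod int p)"
        using GH0(3)[of x] by (intro cong_add cong_mult cong_refl)
      also have "(x i * G0 x + H0 x) * mpoly_eval G (orbit p m F x k) + mpoly_eval H (orbit p m F x k) =
        x i * (G0 x * mpoly_eval G (orbit p m F x k)) +
        (H0 x * mpoly_eval G (orbit p m F x k) + mpoly_eval H (orbit p m F x k))" by (simp add: algebra_simps)
      finally show ?thesis using orb[of x] cong_trans by blast
    qed
    ultimately show ?thesis unfolding E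
      by (intro exI[of _ "\<lambda>x. G0 x * mpoly_eval G (orbit p m F x k)"]
          exI[of _ "\<lambda>x. H0 x * mpoly_eval G (orbit p m F x k) + mpoly_eval H (orbit p m F x k)"] conjI allI)
  qed
qed

section \<open>Complete exponential sums along iterates\<close>

lemma dominated_independent:
  assumes "dominated p t f" "\<And>j. j \<in> keys t \<Longrightarrow> x j = y j" shows "[f x = f y] (mod int p)"
proof -
  obtain P where P: "\<forall>u\<in>keys P. monomial_le u t" "\<forall>x. [f x = mpoly_eval P x] (mod int p)"
    using assms(1) unfolding dominated_def by blast
  have "[mpoly_eval P x = mpoly_eval P y] (mod int p)"
    by (rule mpoly_eval_cong_point) (use P(1) monomial_le_keys assms(2) in \<open>force intro: cong_refl\<close>)
  then show ?thesis using P(2) by (meson cong_sym cong_trans)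
qed

text \<open>
  The phase is \<open>x\<^sub>r b\<^sub>r g(x) + R(x)\<close> with \<open>g\<close> and \<open>R\<close> independent of \<open>x\<^sub>0, \<dots>, x\<^sub>r\<close>, so summation over \<open>x\<^sub>r\<close>
  counts the zeros of \<open>g = \<Sum>\<^sub>k c\<^sub>k G\<^sub>r\<^sub>,\<^sub>k\<close>. The largest \<open>k\<close> with \<open>c\<^sub>k\<close> nonzero modulo \<open>p\<close> contributes a
  leading monomial that no smaller \<open>k\<close> reaches.
\<close>

lemma complete_sum_bound:
  fixes c :: "nat \<Rightarrow> int"
  assumes p: "prime p" and F: "F \<in> poly_systems p S m" and S: "\<And>i. i < m \<Longrightarrow> S i (i + 1) \<noteq> 0"
    and d: "system_deg m F = ereal (real d)"
    and r: "r < m" "\<And>i. i < r \<Longrightarrow> b i = 0" "\<not> int p dvd b r"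
    and c: "k0 < K" "\<not> int p dvd c k0"
  shows "norm (\<Sum>x\<in>Fp_vecs p m. e_mod p (\<Sum>k<K. c k * (\<Sum>i=0..m. b i * orbit p m F x k i)))
     \<le> (1 + real d * real K) ^ m * real p ^ m"
proof -
  have p0: "p > 0" using p prime_gt_0_nat by blast
  define E where "E k = growth_exponent m S k r" for k
  obtain G H where G: "\<And>k. has_leading p (E k) (G k)" and H: "\<And>k. dominated p (E k) (H k)"
    and GH: "\<And>k x. [orbit p m F x k r = x r * G k x + H k x] (mod int p)"
    unfolding E_def using orbit_affine[OF p F S, where i = r] r(1) by (metis less_imp_le)
  define kx where "kx = Max {k. k < K \<and> \<not> int p dvd c k}"
  have fin: "finite {k. k < K \<and> \<not> int p dvd c k}" by simp
  have "kx \<in> {k. k < K \<and> \<not> int p dvd c k}" unfolding kx_def by (rule Max_in[OF fin]) (use c in auto)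
  then have kx: "kx < K" "\<not> int p dvd c kx" by auto
  have kmax: "int p dvd c k" if "k < K" "kx < k" for k
    using Max_ge[OF fin, of k] that unfolding kx_def[symmetric] by auto
  define g where "g x = (\<Sum>k<K. c k * G k x)" for x
  have "has_leading p (E kx) g"
  proof -
    have t1: "has_leading p (E kx) (\<lambda>x. c kx * G kx x)"
      using has_leading_mult[OF p has_leading_const[OF kx(2)] G[of kx]] by simp
    have t2: "has_leading p (E kx) (\<lambda>x. c kx * G kx x + (\<Sum>k<kx. c k * G k x))"
    proof (cases kx)
      case 0 then show ?thesis using t1 by simp
    next
      case (Suc k')
      show ?thesis
      proof (rule has_leading_add_dominated[OF t1])
        show "dominated p (E k') (\<lambda>x. \<Sum>k<kx. c k * G k x)"
        proof (rule dominated_sum)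
          fix k assume "k \<in> {..<kx}"
          then have "monomial_le (E k) (E k')" unfolding E_def using Suc by (intro growth_exponent_mono) auto
          then show "dominated p (E k') (\<lambda>x. c k * G k x)"
            using dominated_mult[OF dominated_const[of p 0 "c k"] has_leading_imp_dominated[OF G[of k]]] dominated_mono by simp
        qed
        show "monomial_le (E k') (E kx)" unfolding E_def using Suc by (intro growth_exponent_mono) auto
        have "lookup (E k') (r + 1) \<noteq> lookup (E kx) (r + 1)"
          unfolding E_def growth_exponent_next[OF r(1)] using Suc S[OF r(1)] by simp
        then show "E k' \<noteq> E kx" by auto
      qed
    qed
    show ?thesis
    proof (rule has_leading_cong[OF t2])
      fix x
      have "g x = (\<Sum>k<Suc kx. c k * G k x) + (\<Sum>k\<in>{Suc kx..<K}. c k * G k x)"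
        unfolding g_def using kx(1) by (metis Suc_leI atLeast0LessThan sum.atLeastLessThan_concat zero_le)
      moreover have "[(\<Sum>k\<in>{Suc kx..<K}. c k * G k x) = (\<Sum>k\<in>{Suc kx..<K}. 0)] (mod int p)"
        by (rule cong_sum) (use kmax in \<open>auto simp: cong_0_iff\<close>)
      ultimately show "[g x = c kx * G kx x + (\<Sum>k<kx. c k * G k x)] (mod int p)"
        using cong_add[OF cong_refl, of "\<Sum>k\<in>{Suc kx..<K}. c k * G k x" 0 "int p" "\<Sum>k<Suc kx. c k * G k x"]
        by (simp add: add_ac)
    qed
  qed
  note topg = this
  define R where "R x = b r * (\<Sum>k<K. c k * H k x) + (\<Sum>i\<in>{r+1..m}. b i * (\<Sum>k<K. c k * orbit p m F x k i))" for x
  have indep: "[f x = f y] (mod int p)"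
    if "dominated p t f" "keys t \<subseteq> {r+1..m}" "\<And>j. j \<in> {r+1..m} \<Longrightarrow> x j = y j" for t f x y
    using dominated_independent[OF that(1)] that by blast
  have kE: "keys (E k) \<subseteq> {r+1..m}" for k unfolding E_def by (rule keys_growth_exponent)
  have Rindep: "[R x = R y] (mod int p)" if xy: "\<And>j. j \<in> {r+1..m} \<Longrightarrow> x j = y j" for x y
    unfolding R_def
  proof (intro cong_add cong_mult cong_sum cong_refl)
    show "[H k x = H k y] (mod int p)" for k using indep[OF H kE] xy by blast
    show "[orbit p m F x k i = orbit p m F y k i] (mod int p)" if i: "i \<in> {r+1..m}" for k i
    proof (rule indep[OF _ _ xy])
      show "dominated p (lead_exponent m S k i) (\<lambda>x. orbit p m F x k i)"
        using orbit_affine[OF p F S, of i k] has_leading_affine[OF p] has_leading_imp_dominated i by (metis atLeastAtMost_iff)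
      show "keys (lead_exponent m S k i) \<subseteq> {r+1..m}"
        unfolding lead_exponent_def using keys_add[of "Poly_Mapping.single i 1" "growth_exponent m S k i"]
          keys_growth_exponent[of m S k i] i by (fastforce split: if_splits)
    qed
  qed
  have gindep: "[g x = g y] (mod int p)" if "\<And>j. j \<in> {r+1..m} \<Longrightarrow> x j = y j" for x y
    using indep[OF has_leading_imp_dominated[OF topg] kE] that by blast
  define \<Psi> where "\<Psi> x = (\<Sum>k<K. c k * (\<Sum>i=0..m. b i * orbit p m F x k i))" for x
  have phase: "[\<Psi> x = x r * (b r * g x) + R x] (mod int p)" for x
  proof -
    have "\<Psi> x = (\<Sum>k<K. \<Sum>i=0..m. c k * (b i * orbit p m F x k i))" by (simp add: \<Psi>_def sum_distrib_left)
    also have "\<dots> = (\<Sum>i=0..m. \<Sum>k<K. c k * (b i * orbit p m F x k i))" by (rule sum.swap)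
    also have "\<dots> = (\<Sum>i=0..m. b i * (\<Sum>k<K. c k * orbit p m F x k i))" by (simp add: sum_distrib_left mult_ac)
    also have "\<dots> = (\<Sum>i\<in>insert r {r+1..m}. b i * (\<Sum>k<K. c k * orbit p m F x k i))"
      by (rule sum.mono_neutral_right) (use r in auto)
    also have "\<dots> = b r * (\<Sum>k<K. c k * orbit p m F x k r) + (\<Sum>i\<in>{r+1..m}. b i * (\<Sum>k<K. c k * orbit p m F x k i))"
      by simp
    finally have 1: "\<Psi> x = b r * (\<Sum>k<K. c k * orbit p m F x k r) +
       (\<Sum>i\<in>{r+1..m}. b i * (\<Sum>k<K. c k * orbit p m F x k i))" .
    have 2: "b r * (\<Sum>k<K. c k * (x r * G k x + H k x)) +
       (\<Sum>i\<in>{r+1..m}. b i * (\<Sum>k<K. c k * orbit p m F x k i)) = x r * (b r * g x) + R x"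
      by (simp add: R_def g_def sum_distrib_left sum.distrib algebra_simps)
    show ?thesis unfolding 1 2[symmetric]
      by (intro cong_add cong_mult cong_sum cong_refl GH)
  qed
  define W where "W = {0..m} - {r}"
  have W: "insert r W = {0..m}" "r \<notin> W" "finite W" "card W = m" using r(1) by (auto simp: W_def)
  have vecs: "Fp_vecs p m = (\<lambda>(v, y). y(r := v)) ` (Fp p \<times> PiE W (\<lambda>_. Fp p))"
    unfolding Fp_vecs_def W(1)[symmetric] PiE_insert_eq ..
  have finW: "finite (PiE W (\<lambda>_. Fp p))" using W by (intro finite_PiE) auto
  have "(\<Sum>x\<in>Fp_vecs p m. e_mod p (\<Psi> x)) = (\<Sum>(v, y)\<in>Fp p \<times> PiE W (\<lambda>_. Fp p). e_mod p (\<Psi> (y(r := v))))"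
    unfolding vecs using inj_combinator[OF W(2), of "\<lambda>_. Fp p"] by (subst sum.reindex) (auto simp: case_prod_beta)
  also have "\<dots> = (\<Sum>v\<in>Fp p. \<Sum>y\<in>PiE W (\<lambda>_. Fp p). e_mod p (\<Psi> (y(r := v))))"
    by (simp add: sum.cartesian_product)
  also have "\<dots> = (\<Sum>y\<in>PiE W (\<lambda>_. Fp p). \<Sum>v\<in>Fp p. e_mod p (\<Psi> (y(r := v))))" by (rule sum.swap)
  also have "\<dots> = (\<Sum>y\<in>PiE W (\<lambda>_. Fp p). e_mod p (R y) * (if int p dvd g y then of_nat p else 0))"
  proof (rule sum.cong[OF refl])
    fix y
    have "e_mod p (\<Psi> (y(r := v))) = e_mod p (R y) * e_mod p ((b r * g y) * v)" for v
    proof -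
      have "[\<Psi> (y(r := v)) = (y(r := v)) r * (b r * g (y(r := v))) + R (y(r := v))] (mod int p)" by (rule phase)
      also have "[(y(r := v)) r * (b r * g (y(r := v))) + R (y(r := v)) = v * (b r * g y) + R y] (mod int p)"
        by (intro cong_add cong_mult cong_refl gindep Rindep) auto
      finally have "e_mod p (\<Psi> (y(r := v))) = e_mod p (v * (b r * g y) + R y)" using p0 e_mod_cong by blast
      then show ?thesis by (simp add: e_mod_add mult_ac)
    qed
    then have "(\<Sum>v\<in>Fp p. e_mod p (\<Psi> (y(r := v)))) = e_mod p (R y) * (\<Sum>v\<in>Fp p. e_mod p ((b r * g y) * v))"
      by (simp add: sum_distrib_left)
    also have "int p dvd b r * g y \<longleftrightarrow> int p dvd g y" using r(3) p by (simp add: prime_dvd_mult_iff)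
    then have "(\<Sum>v\<in>Fp p. e_mod p ((b r * g y) * v)) = (if int p dvd g y then of_nat p else 0)"
      by (simp add: sum_e_mod_Fp p0)
    finally show "(\<Sum>v\<in>Fp p. e_mod p (\<Psi> (y(r := v)))) = e_mod p (R y) * (if int p dvd g y then of_nat p else 0)" .
  qed
  also have "norm \<dots> \<le> (\<Sum>y\<in>PiE W (\<lambda>_. Fp p). real p * of_bool (int p dvd g y))"
    by (intro order.trans[OF norm_sum] sum_mono) (simp add: norm_mult)
  also have "\<dots> = real p * real (card {y \<in> PiE W (\<lambda>_. Fp p). int p dvd g y})"
    unfolding real_card_of_bool[OF finW] by (rule sum_distrib_left[symmetric])
  also have "\<dots> \<le> real ((\<Sum>j\<in>W. lookup (E kx) j) * p ^ card W)"
  proof -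
    have "keys (E kx) \<subseteq> W" using kE[of kx] by (auto simp: W_def)
    then show ?thesis using schwartz_zippel[OF p W(3) _ topg] by (metis of_nat_le_iff of_nat_mult)
  qed
  also have "\<dots> \<le> real ((1 + d * K) ^ m * p ^ m)"
  proof -
    have "(\<Sum>j\<in>W. lookup (E kx) j) \<le> (\<Sum>j\<in>{0..m}. lookup (E kx) j)" by (intro sum_mono2) (auto simp: W_def)
    also have "\<dots> \<le> (1 + d * kx) ^ (m - r)"
      using growth_exponent_total[OF row_sum_le_degree[OF F _ p0 d], of r kx] r(1) by (simp add: E_def)
    also have "\<dots> \<le> (1 + d * K) ^ (m - r)" using kx(1) by (intro power_mono) auto
    also have "\<dots> \<le> (1 + d * K) ^ m" by (intro power_increasing) auto
    finally show ?thesis by (simp only: W(4) of_nat_le_iff mult_right_mono)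
  qed
  finally show ?thesis unfolding \<Psi>_def by simp
qed

section \<open>Moments and incomplete sums\<close>

lemma orbit_in_Fp_vecs: "p > 0 \<Longrightarrow> w \<in> Fp_vecs p m \<Longrightarrow> orbit p m F w n \<in> Fp_vecs p m"
  by (cases n) (auto simp: Fp_vecs_def Fp_def)

lemma orbit_add: "orbit p m F w (n + k) = orbit p m F (orbit p m F w n) k"
  by (induction k) auto

text \<open>
  A repetition inside the least period would, by periodicity, propagate to all indices and give a smaller
  period.
\<close>

lemma orbit_inj_on_period:
  assumes "purely_periodic (orbit p m F w) \<tau>" shows "inj_on (orbit p m F w) {..<\<tau>}"
proof -
  let ?w = "orbit p m F w"
  have t: "\<tau> > 0" "\<And>n. ?w (n + \<tau>) = ?w n" "\<And>t. 0 < t \<Longrightarrow> (\<forall>n. ?w (n + t) = ?w n) \<Longrightarrow> \<tau> \<le> t"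
    using assms unfolding purely_periodic_def by auto
  have per: "?w (n + c * \<tau>) = ?w n" for n c
  proof (induction c)
    case (Suc c)
    have "?w (n + Suc c * \<tau>) = ?w (n + c * \<tau> + \<tau>)" by (simp add: algebra_simps)
    then show ?case using t(2) Suc by simp
  qed simp
  have False if ij: "i < j" "j < \<tau>" "?w i = ?w j" for i j
  proof -
    define s where "s = j - i"
    have tail: "?w (i + k + s) = ?w (i + k)" for k
    proof -
      have "i + k + s = j + k" using ij by (simp add: s_def)
      then show ?thesis using ij orbit_add by metis
    qed
    have "?w (n + s) = ?w n" for n
    proof -
      have "i \<le> n + i * \<tau>" using t(1) by (metis One_nat_def Suc_leI le_add2 le_trans mult.commute mult_le_mono2 nat_mult_1 nat_mult_1_right)
      then obtain k where k: "n + i * \<tau> = i + k" using le_Suc_ex by blast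
      have "?w (n + s) = ?w (n + s + i * \<tau>)" by (rule per[symmetric])
      also have "n + s + i * \<tau> = i + k + s" using k by simp
      also have "?w (i + k + s) = ?w (n + i * \<tau>)" unfolding k by (rule tail)
      also have "\<dots> = ?w n" by (rule per)
      finally show ?thesis .
    qed
    then have "\<tau> \<le> s" using t(3)[of s] ij by (simp add: s_def)
    then show False using ij by (simp add: s_def)
  qed
  then show ?thesis unfolding inj_on_def by (metis lessThan_iff nat_neq_iff)
qed

lemma card_Fp_vecs: "card (Fp_vecs p m) = p ^ (m + 1)" and finite_Fp_vecs: "finite (Fp_vecs p m)"
  by (auto simp: Fp_vecs_def card_PiE intro: finite_PiE)

lemma norm_sum_shift:
  fixes f :: "nat \<Rightarrow> complex"
  assumes "\<And>n. norm (f n) \<le> 1"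
  shows "norm ((\<Sum>n<N. f (n + k)) - (\<Sum>n<N. f n)) \<le> 2 * real k"
proof (induction k)
  case (Suc k)
  have "(\<Sum>n<N. f (n + Suc k)) = (\<Sum>n<N. f (n + k)) + (f (N + k) - f k)"
    using sum_lessThan_telescope[of "\<lambda>n. f (n + k)" N] by (simp add: sum_subtractf algebra_simps)
  then have "(\<Sum>n<N. f (n + Suc k)) - (\<Sum>n<N. f n) = ((\<Sum>n<N. f (n + k)) - (\<Sum>n<N. f n)) + (f (N + k) - f k)"
    by simp
  also have "norm \<dots> \<le> 2 * real k + (1 + 1)"
    by (intro norm_triangle_le add_mono Suc norm_triangle_le_diff assms)
  finally show ?case by simp
qed simp

lemma power_mean_even:
  fixes a :: "nat \<Rightarrow> real"
  assumes "\<And>n. a n \<ge> 0" "N > 0"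
  shows "((\<Sum>n<N. a n) / N) ^ (2 * \<nu>) \<le> (\<Sum>n<N. a n ^ (2 * \<nu>)) / N"
proof -
  have "(\<Sum>n\<in>{..<N}. (1 / real N) *\<^sub>R a n) ^ (2 * \<nu>) \<le> (\<Sum>n\<in>{..<N}. (1 / real N) * a n ^ (2 * \<nu>))"
    by (rule convex_on_sum[where C = UNIV]) (use assms in \<open>auto intro: convex_power_even\<close>)
  then show ?thesis by (simp add: sum_divide_distrib)
qed

lemma norm_power_sum_expand:
  fixes z :: "nat \<Rightarrow> complex"
  shows "complex_of_real (norm (\<Sum>k<K. z k) ^ (2 * \<nu>)) =
    (\<Sum>f\<in>PiE {..<\<nu>} (\<lambda>_. {..<K}). \<Sum>g\<in>PiE {..<\<nu>} (\<lambda>_. {..<K}). (\<Prod>i<\<nu>. z (f i)) * cnj (\<Prod>i<\<nu>. z (g i)))"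
proof -
  have "(\<Sum>k<K. z k) ^ \<nu> = (\<Prod>i<\<nu>. \<Sum>k<K. z k)" by simp
  also have "\<dots> = (\<Sum>f\<in>PiE {..<\<nu>} (\<lambda>_. {..<K}). \<Prod>i<\<nu>. z (f i))" by (rule prod_sum_PiE) auto
  finally have *: "(\<Sum>k<K. z k) ^ \<nu> = (\<Sum>f\<in>PiE {..<\<nu>} (\<lambda>_. {..<K}). \<Prod>i<\<nu>. z (f i))" .
  have "complex_of_real (norm (\<Sum>k<K. z k) ^ (2 * \<nu>)) = complex_of_real ((norm ((\<Sum>k<K. z k) ^ \<nu>))\<^sup>2)"
    by (simp add: norm_power mult.commute flip: power_mult)
  also have "\<dots> = (\<Sum>k<K. z k) ^ \<nu> * cnj ((\<Sum>k<K. z k) ^ \<nu>)" by (rule complex_norm_square)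
  finally show ?thesis unfolding * by (simp only: cnj_sum sum_product)
qed

text \<open>
  The coefficient of the \<open>k\<close>-th iterate in the phase of the term of \<open>|\<Sum>\<^sub>k z\<^sub>k|\<^sup>2\<^sup>\<nu>\<close> that belongs to
  \<open>f\<close> and \<open>g\<close>.
\<close>

definition count_diff :: "nat \<Rightarrow> (nat \<Rightarrow> nat) \<Rightarrow> (nat \<Rightarrow> nat) \<Rightarrow> nat \<Rightarrow> int" where
  "count_diff \<nu> f g k = int (card {i\<in>{..<\<nu>}. f i = k}) - int (card {i\<in>{..<\<nu>}. g i = k})"

lemma sum_count:
  fixes h :: "nat \<Rightarrow> int" and \<nu> K :: nat
  assumes "\<And>i. i < \<nu> \<Longrightarrow> f i < K"
  shows "(\<Sum>i<\<nu>. h (f i)) = (\<Sum>k<K. int (card {i\<in>{..<\<nu>}. f i = k}) * h k)"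
proof -
  have "(\<Sum>i<\<nu>. h (f i)) = (\<Sum>k<K. \<Sum>i\<in>{i\<in>{..<\<nu>}. f i = k}. h (f i))"
    by (rule sum.group[symmetric]) (use assms in auto)
  also have "\<dots> = (\<Sum>k<K. int (card {i\<in>{..<\<nu>}. f i = k}) * h k)" by (intro sum.cong refl) simp
  finally show ?thesis .
qed

text \<open>
  The coefficients lie between \<open>-\<nu>\<close> and \<open>\<nu>\<close>, so for \<open>\<nu> < p\<close> they vanish modulo \<open>p\<close> only if every value of
  \<open>g\<close> is a value of \<open>f\<close>. For given \<open>f\<close> this leaves at most \<open>\<nu>\<^sup>\<nu>\<close> functions \<open>g\<close>.
\<close>

lemma count_diff_diagonal:
  assumes "\<nu> < p" and g: "g \<in> PiE {..<\<nu>} (\<lambda>_. {..<K})" and dvd: "\<And>k. k < K \<Longrightarrow> int p dvd count_diff \<nu> f g k"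
  shows "g \<in> PiE {..<\<nu>} (\<lambda>_. f ` {..<\<nu>})"
proof -
  have "g i \<in> f ` {..<\<nu>}" if i: "i < \<nu>" for i
  proof (rule ccontr)
    assume n: "g i \<notin> f ` {..<\<nu>}"
    define k where "k = g i"
    have "k < K" using g i by (auto simp: k_def)
    have "{i\<in>{..<\<nu>}. f i = k} = {}" using n by (fastforce simp: k_def image_iff)
    then have c: "count_diff \<nu> f g k = - int (card {i\<in>{..<\<nu>}. g i = k})" by (simp add: count_diff_def)
    have "card {i\<in>{..<\<nu>}. g i = k} > 0" using i by (auto simp: k_def card_gt_0_iff)
    moreover have "card {i\<in>{..<\<nu>}. g i = k} \<le> \<nu>" using card_mono[of "{..<\<nu>}" "{i\<in>{..<\<nu>}. g i = k}"] by auto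
    moreover have "int p dvd int (card {i\<in>{..<\<nu>}. g i = k})" using dvd[OF \<open>k < K\<close>] c by simp
    then have "p dvd card {i\<in>{..<\<nu>}. g i = k}" by simp
    ultimately show False using assms(1) by (meson dvd_imp_le le_less_trans not_le)
  qed
  then show ?thesis using g by (auto simp: PiE_iff)
qed

text \<open>
  The two terms come from the pairs \<open>(f, g)\<close> whose phase vanishes identically, estimated trivially, and
  from all other pairs, where the bound for complete sums applies.
\<close>

lemma moment_bound:
  assumes p: "prime p" and F: "F \<in> poly_systems p S m" and S: "\<And>i. i < m \<Longrightarrow> S i (i + 1) \<noteq> 0"
    and d: "system_deg m F = ereal (real d)"
    and r: "r < m" "\<And>i. i < r \<Longrightarrow> b i = 0" "\<not> int p dvd b r" and nu: "\<nu> < p"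
  shows "(\<Sum>x\<in>Fp_vecs p m. norm (\<Sum>k<K. e_mod p (\<Sum>i=0..m. b i * orbit p m F x k i)) ^ (2 * \<nu>))
    \<le> real \<nu> ^ \<nu> * real K ^ \<nu> * real p ^ (m + 1) + real K ^ (2 * \<nu>) * ((1 + real d * real K) ^ m * real p ^ m)"
proof -
  define B where "B = (1 + real d * real K) ^ m * real p ^ m"
  have B0: "B \<ge> 0" by (simp add: B_def)
  define h where "h x k = (\<Sum>i=0..m. b i * orbit p m F x k i)" for x k
  let ?P = "PiE {..<\<nu>} (\<lambda>_. {..<K})"
  have finP: "finite ?P" by (intro finite_PiE) auto
  have cP: "card ?P = K ^ \<nu>" by (simp add: card_PiE)
  define I where "I f g = (\<Sum>x\<in>Fp_vecs p m. e_mod p (\<Sum>k<K. count_diff \<nu> f g k * h x k))" for f g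
  have "complex_of_real (\<Sum>x\<in>Fp_vecs p m. norm (\<Sum>k<K. e_mod p (h x k)) ^ (2 * \<nu>)) =
    (\<Sum>x\<in>Fp_vecs p m. \<Sum>f\<in>?P. \<Sum>g\<in>?P. e_mod p (\<Sum>k<K. count_diff \<nu> f g k * h x k))"
    unfolding of_real_sum norm_power_sum_expand
  proof (intro sum.cong refl)
    fix x f g assume fg: "f \<in> ?P" "g \<in> ?P"
    have "(\<Prod>i<\<nu>. e_mod p (h x (f i))) * cnj (\<Prod>i<\<nu>. e_mod p (h x (g i))) =
      e_mod p ((\<Sum>i<\<nu>. h x (f i)) - (\<Sum>i<\<nu>. h x (g i)))" by (simp only: e_mod_diff e_mod_sum)
    also have "(\<Sum>i<\<nu>. h x (f i)) - (\<Sum>i<\<nu>. h x (g i)) = (\<Sum>k<K. count_diff \<nu> f g k * h x k)"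
    proof -
      have "(\<Sum>i<\<nu>. h x (f i)) = (\<Sum>k<K. int (card {i\<in>{..<\<nu>}. f i = k}) * h x k)"
        using fg by (intro sum_count) auto
      moreover have "(\<Sum>i<\<nu>. h x (g i)) = (\<Sum>k<K. int (card {i\<in>{..<\<nu>}. g i = k}) * h x k)"
        using fg by (intro sum_count) auto
      ultimately show ?thesis by (simp add: count_diff_def left_diff_distrib sum_subtractf)
    qed
    finally show "(\<Prod>i<\<nu>. e_mod p (h x (f i))) * cnj (\<Prod>i<\<nu>. e_mod p (h x (g i))) =
      e_mod p (\<Sum>k<K. count_diff \<nu> f g k * h x k)" .
  qed
  also have "\<dots> = (\<Sum>f\<in>?P. \<Sum>x\<in>Fp_vecs p m. \<Sum>g\<in>?P. e_mod p (\<Sum>k<K. count_diff \<nu> f g k * h x k))" by (rule sum.swap)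
  also have "\<dots> = (\<Sum>f\<in>?P. \<Sum>g\<in>?P. I f g)" unfolding I_def by (intro sum.cong refl sum.swap)
  finally have eq: "complex_of_real (\<Sum>x\<in>Fp_vecs p m. norm (\<Sum>k<K. e_mod p (h x k)) ^ (2 * \<nu>)) = (\<Sum>f\<in>?P. \<Sum>g\<in>?P. I f g)" .
  have "(\<Sum>x\<in>Fp_vecs p m. norm (\<Sum>k<K. e_mod p (h x k)) ^ (2 * \<nu>)) \<le>
     norm (complex_of_real (\<Sum>x\<in>Fp_vecs p m. norm (\<Sum>k<K. e_mod p (h x k)) ^ (2 * \<nu>)))"
    by (simp only: norm_of_real abs_ge_self)
  also have "\<dots> \<le> (\<Sum>f\<in>?P. \<Sum>g\<in>?P. norm (I f g))"
    unfolding eq by (intro order.trans[OF norm_sum] sum_mono norm_sum)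
  also have "\<dots> \<le> (\<Sum>f\<in>?P. real \<nu> ^ \<nu> * real p ^ (m + 1) + real K ^ \<nu> * B)"
  proof (rule sum_mono)
    fix f assume f: "f \<in> ?P"
    let ?D = "PiE {..<\<nu>} (\<lambda>_. f ` {..<\<nu>})"
    have finD: "finite ?D" by (intro finite_PiE) auto
    have "card ?D = card (f ` {..<\<nu>}) ^ \<nu>" by (simp add: card_PiE)
    also have "\<dots> \<le> \<nu> ^ \<nu>" using card_image_le[of "{..<\<nu>}" f] by (intro power_mono) auto
    finally have cD: "real (card ?D) \<le> real \<nu> ^ \<nu>" by (metis of_nat_le_iff of_nat_power)
    have "norm (I f g) \<le> real p ^ (m + 1) * of_bool (g \<in> ?D) + B" if g: "g \<in> ?P" for g
    proof (cases "\<exists>k<K. \<not> int p dvd count_diff \<nu> f g k")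
      case True
      then obtain k0 where "k0 < K" "\<not> int p dvd count_diff \<nu> f g k0" by blast
      have "norm (I f g) \<le> B"
        unfolding I_def h_def B_def 
        by (rule complete_sum_bound[where S = S and b = b and r = r and c = "count_diff \<nu> f g" and K = K]) (fact+)
      then show ?thesis by (simp add: add_increasing)
    next
      case False
      then have "g \<in> ?D" using count_diff_diagonal[OF nu g] by blast
      have "norm (I f g) \<le> (\<Sum>x\<in>Fp_vecs p m. 1)"
        unfolding I_def by (intro order.trans[OF norm_sum] sum_mono) simp
      then have "norm (I f g) \<le> real p ^ (m + 1)" by (simp add: card_Fp_vecs)
      then show ?thesis using \<open>g \<in> ?D\<close> B0 by simp
    qed
    then have "(\<Sum>g\<in>?P. norm (I f g)) \<le> (\<Sum>g\<in>?P. real p ^ (m + 1) * of_bool (g \<in> ?D) + B)" by (rule sum_mono)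
    also have "\<dots> = real p ^ (m + 1) * (\<Sum>g\<in>?P. of_bool (g \<in> ?D)) + real K ^ \<nu> * B"
      by (simp only: sum.distrib sum_distrib_left[symmetric]) (simp add: cP)
    also have "(\<Sum>g\<in>?P. of_bool (g \<in> ?D)) = real (card {g \<in> ?P. g \<in> ?D})" using finP by (rule real_card_of_bool[symmetric])
    finally have *: "(\<Sum>g\<in>?P. norm (I f g)) \<le> real p ^ (m + 1) * real (card {g \<in> ?P. g \<in> ?D}) + real K ^ \<nu> * B" .
    have "card {g \<in> ?P. g \<in> ?D} \<le> card ?D" by (rule card_mono[OF finD]) blast
    then have "real (card {g \<in> ?P. g \<in> ?D}) \<le> real \<nu> ^ \<nu>" using cD by linarith
    then have "real p ^ (m + 1) * real (card {g \<in> ?P. g \<in> ?D}) \<le> real p ^ (m + 1) * real \<nu> ^ \<nu>"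
      by (rule mult_left_mono) simp
    with * show "(\<Sum>g\<in>?P. norm (I f g)) \<le> real \<nu> ^ \<nu> * real p ^ (m + 1) + real K ^ \<nu> * B"
      by (simp add: mult.commute)
  qed
  also have "\<dots> = real \<nu> ^ \<nu> * real K ^ \<nu> * real p ^ (m + 1) + real K ^ (2 * \<nu>) * B"
  proof -
    have "real K ^ (2 * \<nu>) = real K ^ \<nu> * real K ^ \<nu>" by (simp add: mult_2 power_add)
    then show ?thesis by (simp only: sum_constant cP of_nat_power distrib_left mult_ac)
  qed
  finally show ?thesis by (simp add: h_def B_def)
qed

text \<open>
  Averaging over the translates by \<open>k < K\<close> costs \<open>2 K\<close>. The quantity \<open>Y\<close> is the mean over the orbit of the
  normalised sum over \<open>k\<close>; its moment is dominated by the moment over all vectors.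
\<close>

lemma orbit_sum_moment_bound:
  fixes N :: nat
  assumes p: "prime p" and F: "F \<in> poly_systems p S m" and S: "\<And>i. i < m \<Longrightarrow> S i (i + 1) \<noteq> 0"
    and d: "system_deg m F = ereal (real d)" and w0: "w0 \<in> Fp_vecs p m"
    and per: "purely_periodic (orbit p m F w0) \<tau>" and N: "0 < N" "N \<le> \<tau>"
    and r: "r < m" "\<And>i. i < r \<Longrightarrow> b i = 0" "\<not> int p dvd b r" and nu: "\<nu> < p" "\<nu> > 0" and K: "K > 0"
  shows "\<exists>Y::real. Y \<ge> 0 \<and> Y ^ (2 * \<nu>) \<le> (real \<nu> ^ \<nu> * real p ^ (m + 1) / real K ^ \<nu> + (1 + real d * real K) ^ m * real p ^ m) / N \<and>
     norm (\<Sum>n<N. e_mod p (\<Sum>i=0..m. b i * orbit p m F w0 n i)) \<le> N * Y + 2 * K"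
proof -
  have p0: "p > 0" using p prime_gt_0_nat by blast
  define \<psi> where "\<psi> n = e_mod p (\<Sum>i=0..m. b i * orbit p m F w0 n i)" for n
  define A where "A x = norm (\<Sum>k<K. e_mod p (\<Sum>i=0..m. b i * orbit p m F x k i))" for x
  define W where "W = (\<Sum>n<N. A (orbit p m F w0 n))"
  have W0: "W \<ge> 0" unfolding W_def A_def by (intro sum_nonneg) auto
  have AW: "A (orbit p m F w0 n) = norm (\<Sum>k<K. \<psi> (n + k))" for n
    by (simp add: A_def \<psi>_def orbit_add)
  have "real K * norm (\<Sum>n<N. \<psi> n) = norm (\<Sum>k<K. \<Sum>n<N. \<psi> n)" by (simp add: norm_mult)
  also have "(\<Sum>k<K. \<Sum>n<N. \<psi> n) = (\<Sum>k<K. \<Sum>n<N. \<psi> (n + k)) - (\<Sum>k<K. (\<Sum>n<N. \<psi> (n + k)) - (\<Sum>n<N. \<psi> n))"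
    by (simp add: sum_subtractf)
  also have "norm \<dots> \<le> W + real K * (2 * real K)"
  proof (rule norm_triangle_le_diff[OF add_mono])
    have "(\<Sum>k<K. \<Sum>n<N. \<psi> (n + k)) = (\<Sum>n<N. \<Sum>k<K. \<psi> (n + k))" by (rule sum.swap)
    then show "norm (\<Sum>k<K. \<Sum>n<N. \<psi> (n + k)) \<le> W" unfolding W_def AW by (simp add: norm_sum)
    have "norm (\<Sum>k<K. (\<Sum>n<N. \<psi> (n + k)) - (\<Sum>n<N. \<psi> n)) \<le> (\<Sum>k<K. 2 * real K)"
    proof (intro order.trans[OF norm_sum] sum_mono)
      fix k assume "k \<in> {..<K}"
      then show "norm ((\<Sum>n<N. \<psi> (n + k)) - (\<Sum>n<N. \<psi> n)) \<le> 2 * real K"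
        using norm_sum_shift[where f = \<psi> and N = N and k = k] by (simp add: \<psi>_def)
    qed
    then show "norm (\<Sum>k<K. (\<Sum>n<N. \<psi> (n + k)) - (\<Sum>n<N. \<psi> n)) \<le> real K * (2 * real K)" by simp
  qed
  finally have 1: "real K * norm (\<Sum>n<N. \<psi> n) \<le> W + real K * (2 * real K)" .
  define Y where "Y = W / (real N * real K)"
  have Y0: "Y \<ge> 0" using W0 by (simp add: Y_def)
  have "real K * norm (\<Sum>n<N. \<psi> n) \<le> real K * (N * Y + 2 * K)"
    using 1 K N by (simp add: Y_def algebra_simps)
  then have main: "norm (\<Sum>n<N. \<psi> n) \<le> N * Y + 2 * K" using K by simp
  have "(W / N) ^ (2 * \<nu>) \<le> (\<Sum>n<N. A (orbit p m F w0 n) ^ (2 * \<nu>)) / N"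
    unfolding W_def by (rule power_mean_even) (use N in \<open>auto simp: A_def\<close>)
  also have "\<dots> \<le> (\<Sum>x\<in>Fp_vecs p m. A x ^ (2 * \<nu>)) / N"
  proof (rule divide_right_mono)
    have inj: "inj_on (orbit p m F w0) {..<N}"
      using orbit_inj_on_period[OF per] N(2) by (meson inj_on_subset lessThan_subset_iff)
    have "(\<Sum>n<N. A (orbit p m F w0 n) ^ (2 * \<nu>)) = (\<Sum>x\<in>orbit p m F w0 ` {..<N}. A x ^ (2 * \<nu>))"
      by (simp add: sum.reindex[OF inj])
    also have "\<dots> \<le> (\<Sum>x\<in>Fp_vecs p m. A x ^ (2 * \<nu>))"
      using orbit_in_Fp_vecs[OF p0 w0] by (intro sum_mono2 finite_Fp_vecs) (auto simp: A_def)
    finally show "(\<Sum>n<N. A (orbit p m F w0 n) ^ (2 * \<nu>)) \<le> (\<Sum>x\<in>Fp_vecs p m. A x ^ (2 * \<nu>))" .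
  qed simp
  also have "\<dots> \<le> (real \<nu> ^ \<nu> * real K ^ \<nu> * real p ^ (m + 1) + real K ^ (2 * \<nu>) * ((1 + real d * real K) ^ m * real p ^ m)) / N"
    unfolding A_def by (intro divide_right_mono moment_bound[where S = S and b = b and r = r, OF p F S d r nu(1)]) auto
  finally have 2: "(W / N) ^ (2 * \<nu>) \<le> (real \<nu> ^ \<nu> * real K ^ \<nu> * real p ^ (m + 1) + real K ^ (2 * \<nu>) * ((1 + real d * real K) ^ m * real p ^ m)) / N" .
  have "Y ^ (2 * \<nu>) = (W / N) ^ (2 * \<nu>) / real K ^ (2 * \<nu>)" by (simp add: Y_def power_divide power_mult_distrib)
  also have "\<dots> \<le> (real \<nu> ^ \<nu> * real K ^ \<nu> * real p ^ (m + 1) + real K ^ (2 * \<nu>) * ((1 + real d * real K) ^ m * real p ^ m)) / N / real K ^ (2 * \<nu>)"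
    using 2 by (intro divide_right_mono) auto
  also have "\<dots> = (real \<nu> ^ \<nu> * real p ^ (m + 1) / real K ^ \<nu> + (1 + real d * real K) ^ m * real p ^ m) / N"
  proof -
    have "real K ^ (2 * \<nu>) = real K ^ \<nu> * real K ^ \<nu>" by (simp add: mult_2 power_add)
    then show ?thesis using K N by (simp add: field_simps)
  qed
  finally show ?thesis using main Y0 unfolding \<psi>_def by (intro exI[of _ Y] conjI) simp_all
qed

text \<open>
  With \<open>K\<close> about \<open>p\<^sup>\<kappa>\<close>, \<open>\<kappa> = \<epsilon> / (2 m)\<close>, the degrees contribute a factor \<open>p\<^sup>\<epsilon>\<^sup>/\<^sup>2\<close>, which the length of the
  orbit absorbs, and \<open>\<nu> \<ge> 1 / \<kappa>\<close> makes \<open>K\<^sup>\<nu>\<close> at least \<open>p\<close>, which absorbs the diagonal term. Primes up to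
  \<open>\<nu>\<close> are covered by the constant.
\<close>

lemma exp_sum_bound_nonlast_coordinate:
  fixes m d :: nat and \<epsilon> :: real
  assumes m: "m \<ge> 1" and eps: "0 < \<epsilon>" "\<epsilon> \<le> 1"
  shows "\<exists>\<delta>>0. \<exists>C\<ge>1::real. \<forall>(p::nat) S F w0 \<tau> (N::nat) b r.
     prime p \<longrightarrow> F \<in> poly_systems p S m \<longrightarrow> (\<forall>i<m. S i (i + 1) \<noteq> 0) \<longrightarrow> system_deg m F = ereal (real d) \<longrightarrow>
     w0 \<in> Fp_vecs p m \<longrightarrow> purely_periodic (orbit p m F w0) \<tau> \<longrightarrow> 0 < N \<longrightarrow> N \<le> \<tau> \<longrightarrow>
     real N \<ge> real p powr (real m + \<epsilon>) \<longrightarrow> r < m \<longrightarrow> (\<forall>i<r. b i = 0) \<longrightarrow> \<not> int p dvd b r \<longrightarrow>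
     norm (\<Sum>n<N. e_mod p (\<Sum>i=0..m. b i * orbit p m F w0 n i)) \<le> C * real N * real p powr (- \<delta>)"
proof -
  define \<kappa> where "\<kappa> = \<epsilon> / (2 * m)"
  have k0: "\<kappa> > 0" "\<kappa> \<le> 1" using m eps by (auto simp: \<kappa>_def field_simps)
  obtain \<nu> :: nat where "1 / \<kappa> < \<nu>" using reals_Archimedean2 by blast
  then have nuk: "real \<nu> * \<kappa> \<ge> 1" using k0 by (simp add: field_simps)
  have nu0: "\<nu> > 0" using nuk by (cases \<nu>) auto
  define \<delta> where "\<delta> = \<epsilon> / (4 * \<nu>)"
  have d0: "\<delta> > 0" "\<delta> \<le> 1" "\<delta> \<le> \<epsilon>" using eps nu0 by (auto simp: \<delta>_def field_simps)
  define C0 where "C0 = 1 + real \<nu> ^ \<nu> + (1 + 2 * real d) ^ m"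
  have C0: "C0 \<ge> 1" by (simp add: C0_def)
  define C where "C = C0 + 4 + \<nu>"
  have C1: "C \<ge> 1" using C0 by (simp add: C_def)
  have main: "norm (\<Sum>n<N. e_mod p (\<Sum>i=0..m. b i * orbit p m F w0 n i)) \<le> C * real N * real p powr (- \<delta>)"
    if p: "prime p" and F: "F \<in> poly_systems p S m" and S: "\<forall>i<m. S i (i + 1) \<noteq> 0"
      and d: "system_deg m F = ereal (real d)" and w0: "w0 \<in> Fp_vecs p m"
      and per: "purely_periodic (orbit p m F w0) \<tau>" and N: "0 < N" "N \<le> \<tau>"
      and big: "real N \<ge> real p powr (real m + \<epsilon>)"
      and r: "r < m" "\<forall>i<r. b i = 0" "\<not> int p dvd b r" for p S F w0 \<tau> N b r
  proof -
    define q where "q = real p"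
    have q1: "q > 1" using prime_gt_1_nat[OF p] by (simp add: q_def)
    show ?thesis
    proof (cases "p \<le> \<nu>")
      case True
      have "norm (\<Sum>n<N. e_mod p (\<Sum>i=0..m. b i * orbit p m F w0 n i)) \<le> (\<Sum>n<N. 1)"
        by (intro order.trans[OF norm_sum] sum_mono) simp
      also have "\<dots> = 1 * real N" by simp
      also have "\<dots> \<le> (C * q powr (- \<delta>)) * real N"
      proof (rule mult_right_mono)
        have "q powr \<delta> \<le> q powr 1" using q1 d0 by (intro powr_mono) auto
        also have "\<dots> \<le> C" using True C0 q1 by (simp add: q_def C_def)
        finally show "1 \<le> C * q powr (- \<delta>)" using q1 by (simp add: powr_minus_divide pos_le_divide_eq)
      qed simp
      finally show ?thesis by (simp add: q_def mult_ac)
    next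
      case False
      define K where "K = nat \<lceil>q powr \<kappa>\<rceil>"
      have qk1: "q powr \<kappa> \<ge> 1" using q1 k0 by (intro ge_one_powr_ge_zero) auto
      have K1: "q powr \<kappa> \<le> K" unfolding K_def by linarith
      have K2: "K \<le> 2 * q powr \<kappa>" unfolding K_def using qk1 by linarith
      have K0: "K > 0" using K1 qk1 by (cases K) auto
      obtain Y :: real where Y: "Y \<ge> 0"
        "Y ^ (2 * \<nu>) \<le> (real \<nu> ^ \<nu> * q ^ (m + 1) / real K ^ \<nu> + (1 + real d * real K) ^ m * q ^ m) / N"
        and bd: "norm (\<Sum>n<N. e_mod p (\<Sum>i=0..m. b i * orbit p m F w0 n i)) \<le> N * Y + 2 * K"
        using orbit_sum_moment_bound[where S = S and b = b and r = r, OF p F S[rule_format] d w0 per N r(1) r(2)[rule_format] r(3) _ nu0 K0] False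
        unfolding q_def by auto
      have NQ: "real N \<ge> q ^ m * q powr \<epsilon>" using big q1 by (simp add: q_def powr_add powr_realpow)
      have "q \<le> real K ^ \<nu>"
      proof -
        have "q \<le> q powr (\<nu> * \<kappa>)" using powr_mono[of 1 "\<nu> * \<kappa>" q] nuk q1 by simp
        also have "\<dots> = (q powr \<kappa>) ^ \<nu>" using q1 by (simp add: powr_powr mult.commute flip: powr_realpow)
        also have "\<dots> \<le> real K ^ \<nu>" using K1 by (intro power_mono) auto
        finally show ?thesis .
      qed
      then have t1: "real \<nu> ^ \<nu> * q ^ (m + 1) / real K ^ \<nu> \<le> real \<nu> ^ \<nu> * q ^ m"
      proof -
        assume "q \<le> real K ^ \<nu>"
        then have "(real \<nu> ^ \<nu> * q ^ m) * q \<le> (real \<nu> ^ \<nu> * q ^ m) * real K ^ \<nu>"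
          using q1 by (intro mult_left_mono) auto
        then show ?thesis using K0 by (simp add: divide_le_eq mult_ac)
      qed
      have t2: "(1 + real d * real K) ^ m \<le> (1 + 2 * real d) ^ m * q powr (\<epsilon> / 2)"
      proof -
        have "real d * real K \<le> real d * (2 * q powr \<kappa>)" using K2 by (intro mult_left_mono) auto
        then have "1 + real d * real K \<le> (1 + 2 * real d) * q powr \<kappa>" using qk1 by (simp add: algebra_simps)
        then have "(1 + real d * real K) ^ m \<le> ((1 + 2 * real d) * q powr \<kappa>) ^ m" by (intro power_mono) auto
        also have "\<dots> = (1 + 2 * real d) ^ m * (q powr \<kappa>) ^ m" by (rule power_mult_distrib)
        also have "(q powr \<kappa>) ^ m = q powr (\<kappa> * m)" using q1 by (simp add: powr_powr flip: powr_realpow)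
        also have "\<kappa> * m = \<epsilon> / 2" using m by (simp add: \<kappa>_def)
        finally show ?thesis .
      qed
      have e1: "1 \<le> q powr (\<epsilon> / 2)" using q1 eps by (intro ge_one_powr_ge_zero) auto
      have "real \<nu> ^ \<nu> * q ^ (m + 1) / real K ^ \<nu> + (1 + real d * real K) ^ m * q ^ m
         \<le> real \<nu> ^ \<nu> * q ^ m + (1 + 2 * real d) ^ m * q powr (\<epsilon> / 2) * q ^ m"
        using t1 t2 q1 by (intro add_mono mult_right_mono) auto
      also have "\<dots> \<le> (real \<nu> ^ \<nu> * q powr (\<epsilon> / 2)) * q ^ m + (1 + 2 * real d) ^ m * q powr (\<epsilon> / 2) * q ^ m"
        using e1 q1 by (intro add_mono mult_right_mono order.refl) (auto intro: mult_left_le[of 1, simplified] simp: mult_le_cancel_left1)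
      also have "\<dots> \<le> C0 * (q powr (\<epsilon> / 2) * q ^ m)" using q1 by (simp add: C0_def algebra_simps)
      finally have "Y ^ (2 * \<nu>) \<le> C0 * (q powr (\<epsilon> / 2) * q ^ m) / N"
        by (intro order.trans[OF Y(2)] divide_right_mono) auto
      also have "\<dots> \<le> C0 * (q powr (\<epsilon> / 2) * q ^ m) / (q ^ m * q powr \<epsilon>)"
        using NQ C0 q1 N by (intro divide_left_mono) auto
      also have "\<dots> = C0 * q powr (- (\<epsilon> / 2))"
      proof -
        have "q powr \<epsilon> = q powr (\<epsilon> / 2) * q powr (\<epsilon> / 2)" by (simp flip: powr_add)
        then show ?thesis using q1 by (simp add: powr_minus_divide)
      qed
      also have "\<dots> \<le> C0 ^ (2 * \<nu>) * (q powr (- \<delta>)) ^ (2 * \<nu>)"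
      proof -
        have "(q powr (- \<delta>)) ^ (2 * \<nu>) = q powr (- (\<epsilon> / 2))"
          using q1 nu0 by (simp add: powr_powr \<delta>_def flip: powr_realpow)
        moreover have "C0 \<le> C0 ^ (2 * \<nu>)" using C0 nu0 by (intro self_le_power) auto
        ultimately show ?thesis by (simp add: mult_right_mono)
      qed
      finally have "Y ^ (2 * \<nu>) \<le> (C0 * q powr (- \<delta>)) ^ (2 * \<nu>)" by (simp only: power_mult_distrib)
      then have Yle: "Y \<le> C0 * q powr (- \<delta>)"
        using power_le_imp_le_base[of Y "2 * \<nu> - 1" "C0 * q powr (- \<delta>)"] nu0 C0 by simp
      have "2 * real K \<le> 4 * real N * q powr (- \<delta>)"
      proof -
        have "q powr \<kappa> \<le> q powr 1" using q1 k0 by (intro powr_mono) auto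
        also have "\<dots> \<le> q ^ m" using m q1 by (simp add: self_le_power)
        also have "\<dots> = q ^ m * q powr \<epsilon> * q powr (- \<epsilon>)" using q1 by (simp add: powr_minus_divide)
        also have "\<dots> \<le> real N * q powr (- \<epsilon>)" using NQ by (intro mult_right_mono) auto
        also have "\<dots> \<le> real N * q powr (- \<delta>)" using q1 d0 by (intro mult_left_mono powr_mono) auto
        finally show ?thesis using K2 by linarith
      qed
      moreover have "real N * Y \<le> real N * (C0 * q powr (- \<delta>))" using Yle by (intro mult_left_mono) auto
      ultimately have "norm (\<Sum>n<N. e_mod p (\<Sum>i=0..m. b i * orbit p m F w0 n i)) \<le> (C0 + 4) * (real N * q powr (- \<delta>))"
        using bd by (simp add: algebra_simps)
      also have "\<dots> \<le> C * (real N * q powr (- \<delta>))" by (intro mult_right_mono) (auto simp: C_def)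
      finally show ?thesis by (simp add: q_def mult_ac)
    qed
  qed
  show ?thesis
    by (intro exI[of _ \<delta>] exI[of _ C] conjI allI impI d0(1) C1) (rule main; assumption)
qed

section \<open>The last coordinate\<close>

lemma norm_sum_periodic:
  fixes f :: "nat \<Rightarrow> complex"
  assumes T: "T > 0" and per: "\<And>n. f (n + T) = f n" and f: "\<And>n. norm (f n) \<le> 1"
  shows "norm (\<Sum>n<N. f n) \<le> real N / real T * norm (\<Sum>n<T. f n) + real T"
proof (induction N rule: less_induct)
  case (less N)
  show ?case
  proof (cases "N < T")
    case True
    have "norm (\<Sum>n<N. f n) \<le> (\<Sum>n<N. 1)" by (intro order.trans[OF norm_sum] sum_mono f)
    also have "\<dots> \<le> real T" using True by simp
    finally show ?thesis by (simp add: add_increasing)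
  next
    case False
    define M where "M = N - T"
    have N: "N = T + M" "M < N" using False T by (auto simp: M_def)
    have "(\<Sum>n<N. f n) = (\<Sum>n<T. f n) + (\<Sum>n<M. f (n + T))"
      unfolding N(1) by (induction M) (simp_all add: add_ac)
    also have "norm \<dots> \<le> norm (\<Sum>n<T. f n) + norm (\<Sum>n<M. f n)" by (simp add: per norm_triangle_ineq)
    also have "\<dots> \<le> norm (\<Sum>n<T. f n) + (real M / real T * norm (\<Sum>n<T. f n) + real T)"
      using less[OF N(2)] by simp
    also have "\<dots> = real N / real T * norm (\<Sum>n<T. f n) + real T"
      using T by (simp add: N(1) field_simps)
    finally show ?thesis .
  qed
qed

text \<open>
  The points of the orbit are distinct, and \<open>p\<^sup>m\<close> points share a given last coordinate.
\<close>

lemma length_le_card_last_coordinate: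
  assumes p: "p > 0" and w0: "w0 \<in> Fp_vecs p m" and per: "purely_periodic (orbit p m F w0) \<tau>" and N: "N \<le> \<tau>"
  shows "N \<le> card ((\<lambda>n. orbit p m F w0 n m) ` {..<N}) * p ^ m"
proof -
  let ?w = "orbit p m F w0"
  let ?V = "(\<lambda>n. ?w n m) ` {..<N}"
  let ?g = "\<lambda>n. (?w n m, restrict (?w n) {..<m})"
  have inj: "inj_on ?g {..<N}"
  proof (rule inj_onI)
    fix n k assume nk: "n \<in> {..<N}" "k \<in> {..<N}" "?g n = ?g k"
    have ext: "?w n \<in> extensional {0..m}" for n
      using orbit_in_Fp_vecs[OF p w0] by (auto simp: Fp_vecs_def PiE_def)
    have "?w n = ?w k"
    proof (rule extensionalityI[OF ext ext])
      fix i assume "i \<in> {0..m}"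
      show "?w n i = ?w k i"
      proof (cases "i = m")
        case False
        then have "i \<in> {..<m}" using \<open>i \<in> {0..m}\<close> by auto
        moreover have "restrict (?w n) {..<m} i = restrict (?w k) {..<m} i" using nk by simp
        ultimately show ?thesis by simp
      qed (use nk in simp)
    qed
    then show "n = k" using orbit_inj_on_period[OF per] nk N by (auto simp: inj_on_def)
  qed
  have "?g ` {..<N} \<subseteq> ?V \<times> PiE {..<m} (\<lambda>_. Fp p)"
    using orbit_in_Fp_vecs[OF p w0] by (auto simp: Fp_vecs_def PiE_iff split: if_splits)
  then have "card {..<N} \<le> card (?V \<times> PiE {..<m} (\<lambda>_. Fp p))"
    by (intro card_inj_on_le[OF inj] finite_cartesian_product finite_imageI finite_PiE) auto
  then show ?thesis by (simp add: card_cartesian_product card_PiE)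
qed

lemma multiplicative_order:
  assumes p: "prime p" and g: "\<not> int p dvd g"
  obtains T where "T > 0" "[g ^ T = 1] (mod int p)" "inj_on (\<lambda>i. g ^ i mod int p) {..<T}" "T \<le> p"
proof -
  have p0: "p > 0" using p prime_gt_0_nat by blast
  have "coprime g (int p)" using p g by (metis coprime_commute prime_imp_coprime prime_nat_int_transfer)
  then have cancel: "[g ^ (k - i) = 1] (mod int p)" if "[g ^ i = g ^ k] (mod int p)" "i < k" for i k :: nat
  proof -
    have "g ^ k = g ^ i * g ^ (k - i)" using that by (simp flip: power_add)
    then have "[g ^ i * 1 = g ^ i * g ^ (k - i)] (mod int p)" using that by simp
    moreover have "coprime (g ^ i) (int p)" using \<open>coprime g (int p)\<close> by simp
    ultimately show ?thesis using cong_mult_lcancel cong_sym by blast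
  qed
  have sub: "(\<lambda>i. g ^ i mod int p) ` I \<subseteq> {0..<int p}" for I using p0 by auto
  have "\<not> inj_on (\<lambda>i. g ^ i mod int p) (UNIV :: nat set)"
    using finite_imageD[of "\<lambda>i. g ^ i mod int p" "UNIV :: nat set"] finite_subset[OF sub] by auto
  then obtain i k :: nat where "i < k" "g ^ i mod int p = g ^ k mod int p"
    unfolding inj_on_def by (metis linorder_neqE_nat)
  then have ex: "k - i > 0 \<and> [g ^ (k - i) = 1] (mod int p)" using cancel by (simp add: cong_def)
  define T where "T = (LEAST T. T > 0 \<and> [g ^ T = 1] (mod int p))"
  have T: "T > 0" "[g ^ T = 1] (mod int p)" unfolding T_def using LeastI[where P = "\<lambda>T. T > 0 \<and> [g ^ T = 1] (mod int p)", OF ex] by auto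
  have least: "T \<le> s" if "s > 0" "[g ^ s = 1] (mod int p)" for s
    unfolding T_def using that by (intro Least_le) auto
  have inj: "inj_on (\<lambda>i. g ^ i mod int p) {..<T}"
  proof (rule linorder_inj_onI')
    fix i k assume ik: "i \<in> {..<T}" "k \<in> {..<T}" "i < k"
    show "g ^ i mod int p \<noteq> g ^ k mod int p"
    proof
      assume "g ^ i mod int p = g ^ k mod int p"
      then have "T \<le> k - i" using cancel[of i k] ik by (intro least) (auto simp: cong_def)
      then show False using ik by auto
    qed
  qed
  have "T = card ((\<lambda>i. g ^ i mod int p) ` {..<T})" by (simp add: card_image[OF inj])
  also have "\<dots> \<le> card {0..<int p}" by (intro card_mono sub) auto
  finally show thesis using that[OF T inj] by simp
qed

text \<open>
  If \<open>g = 1\<close> then \<open>u n\<close> runs through an arithmetic progression modulo \<open>p\<close>, and the sum over a period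
  vanishes. Otherwise \<open>u n = c + A g\<^sup>n\<close> with the fixed point \<open>c\<close>, and a period is a coset of the group
  generated by \<open>g\<close>, which has at least \<open>p\<^sup>\<epsilon>\<close> elements. In both cases \<open>u\<close> is not constant because its
  period is long.
\<close>

lemma exp_sum_bound_last_coordinate:
  fixes m :: nat and \<epsilon> :: real
  assumes m: "m \<ge> 1" and eps: "0 < \<epsilon>"
  shows "\<exists>\<delta>>0. \<exists>C\<ge>1::real. \<forall>(p::nat) S F w0 \<tau> (N::nat) b.
     prime p \<longrightarrow> F \<in> poly_systems p S m \<longrightarrow>
     w0 \<in> Fp_vecs p m \<longrightarrow> purely_periodic (orbit p m F w0) \<tau> \<longrightarrow> N \<le> \<tau> \<longrightarrow>
     real N \<ge> real p powr (real m + \<epsilon>) \<longrightarrow> (\<forall>i<m. b i = 0) \<longrightarrow> \<not> int p dvd b m \<longrightarrow>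
     norm (\<Sum>n<N. e_mod p (\<Sum>i=0..m. b i * orbit p m F w0 n i)) \<le> C * real N * real p powr (- \<delta>)"
proof -
  obtain \<delta>1 C1 where d1: "\<delta>1 > 0" "C1 \<ge> (1::real)" and bgk: "\<And>(p::nat) (g::int) (a::int) (T::nat).
    prime p \<Longrightarrow> \<not> int p dvd g \<Longrightarrow> \<not> int p dvd a \<Longrightarrow> T > 0 \<Longrightarrow> [g ^ T = 1] (mod int p) \<Longrightarrow>
    inj_on (\<lambda>i. g ^ i mod int p) {..<T} \<Longrightarrow> real T \<ge> real p powr \<epsilon> \<Longrightarrow>
    norm (\<Sum>i<T. e_mod p (a * g ^ i)) \<le> C1 * T * real p powr (- \<delta>1)"
    using power_orbit_sum_bound[OF eps] by blast
  define \<delta> where "\<delta> = min \<delta>1 \<epsilon>"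
  have d0: "\<delta> > 0" "\<delta> \<le> \<delta>1" "\<delta> \<le> \<epsilon>" using d1 eps by (auto simp: \<delta>_def)
  have main: "norm (\<Sum>n<N. e_mod p (\<Sum>i=0..m. b i * orbit p m F w0 n i)) \<le> (C1 + 1) * real N * real p powr (- \<delta>)"
    if p: "prime p" and F: "F \<in> poly_systems p S m" and w0: "w0 \<in> Fp_vecs p m"
      and per: "purely_periodic (orbit p m F w0) \<tau>" and N: "N \<le> \<tau>"
      and big: "real N \<ge> real p powr (real m + \<epsilon>)" and b: "\<forall>i<m. b i = 0" "\<not> int p dvd b m"
    for p S F w0 \<tau> N b
  proof -
    have p0: "p > 0" using p prime_gt_0_nat by blast
    have p1: "real p > 1" using prime_gt_1_nat[OF p] by simp
    define u where "u n = orbit p m F w0 n m" for n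
    have phase: "(\<Sum>i=0..m. b i * orbit p m F w0 n i) = b m * u n" for n
    proof -
      have "(\<Sum>i=0..m. b i * orbit p m F w0 n i) = (\<Sum>i\<in>{m}. b i * orbit p m F w0 n i)"
        by (rule sum.mono_neutral_right) (use b in auto)
      then show ?thesis by (simp add: u_def)
    qed
    define f where "f n = e_mod p (b m * u n)" for n
    have nf: "norm (f n) \<le> 1" for n by (simp add: f_def)
    obtain g h where g: "g \<in> Fp p" "g \<noteq> 0" "h \<in> Fp p" "mpoly_cong p (F m) (Const g * Var m + Const h)"
      using F unfolding poly_systems_def by blast
    have gp: "\<not> int p dvd g" using g by (simp add: Fp_nonzero_not_dvd)
    have step: "[u (Suc n) = g * u n + h] (mod int p)" for n
      using mpoly_eval_cong_poly[OF g(4), of "orbit p m F w0 n"] by (simp add: u_def mpoly_eval_add mpoly_eval_mult)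
    have uF: "u n \<in> Fp p" for n
      using orbit_in_Fp_vecs[OF p0 w0, of F n] by (auto simp: u_def Fp_vecs_def PiE_iff)
    have ueq: "u i = u j" if "[u i = u j] (mod int p)" for i j
      using that uF[of i] uF[of j] by (simp add: Fp_def cong_def)
    have big': "real p ^ m * real p powr \<epsilon> \<le> N" using big p0 by (simp add: powr_add powr_realpow)
    \<comment> \<open>the last component takes many values, hence its period is long\<close>
    have long: "real p powr \<epsilon> \<le> T" if T: "T > 0" "\<And>n. u (n + T) = u n" for T
    proof -
      have "u n = u (n mod T)" for n
      proof (induction n rule: less_induct)
        case (less n)
        show ?case
        proof (cases "n < T")
          case False
          then have "u n = u (n - T)" using T(2)[of "n - T"] by simp
          also have "\<dots> = u ((n - T) mod T)" using less False T by auto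
          finally show ?thesis using False by (simp add: le_mod_geq)
        qed simp
      qed
      then have "u ` {..<N} \<subseteq> u ` {..<T}" using T(1) by (metis image_subsetI imageI lessThan_iff mod_less_divisor)
      then have "card (u ` {..<N}) \<le> card (u ` {..<T})" by (intro card_mono) auto
      also have "\<dots> \<le> T" using card_image_le[of "{..<T}" u] by simp
      finally have "N \<le> T * p ^ m"
        using length_le_card_last_coordinate[OF p0 w0 per N] unfolding u_def[symmetric] by (meson le_trans mult_le_mono1)
      then have "real N \<le> real T * real p ^ m" by (metis of_nat_le_iff of_nat_mult of_nat_power)
      then have "real p ^ m * real p powr \<epsilon> \<le> real p ^ m * T" using big' by (simp add: mult.commute)
      then show ?thesis using p0 by simp
    qed
    have nonconst: "\<not> (\<forall>n. u (Suc n) = u n)"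
    proof
      assume "\<forall>n. u (Suc n) = u n"
      then have "real p powr \<epsilon> \<le> 1" using long[of 1] by simp
      moreover have "real p powr \<epsilon> > 1" using p1 eps by (intro gr_one_powr) auto
      ultimately show False by simp
    qed
    have pN: "real p \<le> real N * real p powr (- \<delta>)"
    proof -
      have "real p * real p powr \<epsilon> \<le> real p ^ m * real p powr \<epsilon>"
        using m p1 by (intro mult_right_mono self_le_power) auto
      then have "real p * real p powr \<epsilon> * real p powr (- \<epsilon>) \<le> real N * real p powr (- \<epsilon>)"
        using big' by (intro mult_right_mono) auto
      moreover have "real p powr \<epsilon> * real p powr (- \<epsilon>) = 1" using p0 by (simp flip: powr_add)
      ultimately have "real p \<le> real N * real p powr (- \<epsilon>)" by (simp add: mult.assoc)
      also have "\<dots> \<le> real N * real p powr (- \<delta>)" using d0 p1 by (intro mult_left_mono powr_mono) auto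
      finally show ?thesis .
    qed
    have period_bound: "norm (\<Sum>n<N. f n) \<le> (C1 + 1) * real N * real p powr (- \<delta>)"
      if T: "T > 0" "T \<le> p" "\<And>n. f (n + T) = f n" and s: "norm (\<Sum>n<T. f n) \<le> C1 * T * real p powr (- \<delta>)" for T
    proof -
      have "norm (\<Sum>n<N. f n) \<le> real N / real T * norm (\<Sum>n<T. f n) + real T"
        by (rule norm_sum_periodic[where f = f, OF T(1) T(3) nf])
      also have "\<dots> \<le> real N / real T * (C1 * T * real p powr (- \<delta>)) + real p"
        using T s by (intro add_mono mult_left_mono) auto
      also have "real N / real T * (C1 * T * real p powr (- \<delta>)) = C1 * (real N * real p powr (- \<delta>))" using T(1) by simp
      also have "C1 * (real N * real p powr (- \<delta>)) + real p \<le> C1 * (real N * real p powr (- \<delta>)) + real N * real p powr (- \<delta>)"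
        using pN by simp
      finally show ?thesis by (simp add: algebra_simps)
    qed
    have "norm (\<Sum>n<N. f n) \<le> (C1 + 1) * real N * real p powr (- \<delta>)"
    proof (cases "int p dvd g - 1")
      case True
      have un: "[u n = u 0 + h * int n] (mod int p)" for n
      proof (induction n)
        case (Suc n)
        have "[g = 1] (mod int p)" using True by (simp add: cong_iff_dvd_diff)
        then have "[g * u n + h = 1 * (u 0 + h * int n) + h] (mod int p)"
          using Suc by (intro cong_add cong_mult) auto
        then have "[u (Suc n) = 1 * (u 0 + h * int n) + h] (mod int p)" using step[of n] cong_trans by blast
        then show ?case by (simp add: algebra_simps)
      qed simp
      have hp: "\<not> int p dvd h"
      proof
        assume "int p dvd h"
        then have "[u 0 + h * int n = u 0] (mod int p)" for n by (simp add: cong_iff_dvd_diff)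
        then have "[u (Suc n) = u n] (mod int p)" for n using un cong_trans cong_sym by meson
        then show False using nonconst ueq by blast
      qed
      have fn: "f n = e_mod p (b m * u 0) * e_mod p ((b m * h) * int n)" for n
      proof -
        have "[b m * u n = b m * (u 0 + h * int n)] (mod int p)" using un by (intro cong_mult) auto
        then show ?thesis unfolding f_def using e_mod_cong[OF p0] by (simp add: distrib_left e_mod_add mult.assoc)
      qed
      have "\<not> int p dvd b m * h" using b hp p by (simp add: prime_dvd_mult_iff)
      then have "(\<Sum>n<p. f n) = 0"
        unfolding fn sum_distrib_left[symmetric] by (simp add: sum_e_mod_nat p0)
      moreover have "f (n + p) = f n" for n
      proof -
        have "e_mod p ((b m * h) * int (n + p)) = e_mod p ((b m * h) * int n)"
          by (rule e_mod_cong[OF p0]) (simp add: cong_iff_dvd_diff algebra_simps)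
        then show ?thesis unfolding fn by simp
      qed
      ultimately show ?thesis using period_bound[of p] p0 d1 by simp
    next
      case False
      then have "coprime (g - 1) (int p)" using p by (metis coprime_commute prime_imp_coprime prime_nat_int_transfer)
      then obtain l where l: "[(g - 1) * l = 1] (mod int p)" using cong_solve_coprime_int by blast
      \<comment> \<open>the fixed point of \<open>u \<mapsto> g u + h\<close> modulo \<open>p\<close>\<close>
      define c where "c = - h * l"
      have c: "[g * c + h = c] (mod int p)"
      proof -
        have "g * c + h - c = - h * ((g - 1) * l - 1)" by (simp add: c_def algebra_simps)
        then show ?thesis using l by (simp add: cong_iff_dvd_diff)
      qed
      define A where "A = u 0 - c"
      have un: "[u n = c + A * g ^ n] (mod int p)" for n
      proof (induction n)
        case (Suc n)
        have "[g * u n + h = g * (c + A * g ^ n) + h] (mod int p)" using Suc by (intro cong_add cong_mult) auto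
        also have "g * (c + A * g ^ n) + h = (g * c + h) + A * g ^ Suc n" by (simp add: algebra_simps)
        also have "[(g * c + h) + A * g ^ Suc n = c + A * g ^ Suc n] (mod int p)" using c by (intro cong_add) auto
        finally show ?case using step[of n] cong_trans by blast
      qed (simp add: A_def)
      have Ap: "\<not> int p dvd A"
      proof
        assume "int p dvd A"
        then have "[c + A * g ^ n = c] (mod int p)" for n by (simp add: cong_iff_dvd_diff)
        then have "[u (Suc n) = u n] (mod int p)" for n using un cong_trans cong_sym by meson
        then show False using nonconst ueq by blast
      qed
      obtain T where T0: "T > 0" and gT: "[g ^ T = 1] (mod int p)"
        and inj: "inj_on (\<lambda>i. g ^ i mod int p) {..<T}" and Tp: "T \<le> p"
        using multiplicative_order[OF p gp] by blast
      have uT: "u (n + T) = u n" for n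
      proof (rule ueq)
        have "[c + A * (g ^ n * g ^ T) = c + A * (g ^ n * 1)] (mod int p)" using gT by (intro cong_add cong_mult cong_refl)
        then show "[u (n + T) = u n] (mod int p)" using un[of "n + T"] un[of n] unfolding power_add
          by (metis cong_sym cong_trans mult.right_neutral)
      qed
      have fT: "f (n + T) = f n" for n by (simp add: f_def uT)
      have fn: "f n = e_mod p (b m * c) * e_mod p ((b m * A) * g ^ n)" for n
      proof -
        have "[b m * u n = b m * (c + A * g ^ n)] (mod int p)" using un by (intro cong_mult) auto
        then show ?thesis unfolding f_def using e_mod_cong[OF p0] by (simp add: distrib_left e_mod_add mult.assoc)
      qed
      have bA: "\<not> int p dvd b m * A" using b Ap p by (simp add: prime_dvd_mult_iff)
      have "norm (\<Sum>n<T. f n) = norm (\<Sum>n<T. e_mod p ((b m * A) * g ^ n))"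
        unfolding fn sum_distrib_left[symmetric] by (simp add: norm_mult)
      also have "\<dots> \<le> C1 * T * real p powr (- \<delta>1)"
        by (rule bgk[OF p gp bA T0 gT inj long[OF T0 uT]])
      also have "\<dots> \<le> C1 * T * real p powr (- \<delta>)" using d0 d1 p1 by (intro mult_left_mono powr_mono) auto
      finally show ?thesis by (rule period_bound[OF T0 Tp fT])
    qed
    then show ?thesis by (simp add: f_def phase)
  qed
  have "C1 + 1 \<ge> 1" using d1 by simp
  show ?thesis
    by (intro exI[of _ \<delta>] exI[of _ "C1 + 1"] conjI allI impI d0(1) \<open>C1 + 1 \<ge> 1\<close>) (rule main; assumption)
qed

section \<open>The bound for every nonzero frequency vector\<close>

theorem theorem6:
  fixes m d :: nat and \<epsilon> :: real
  assumes "m \<ge> 1" and "d \<ge> 2" and "\<epsilon> > 0"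
  shows "\<exists>\<delta>>0. \<exists>C>0. \<forall>(p::nat) (S :: nat \<Rightarrow> nat \<Rightarrow> nat) F w0 (\<tau>::nat) (N::nat) b.
           prime p \<longrightarrow>
           exponent_matrix m S \<longrightarrow>
           (\<Prod>i<m. S i (i + 1)) \<noteq> 0 \<longrightarrow>
           F \<in> poly_systems p S m \<longrightarrow>
           system_deg m F = ereal (real d) \<longrightarrow>
           w0 \<in> Fp_vecs p m \<longrightarrow>
           purely_periodic (orbit p m F w0) \<tau> \<longrightarrow>
           N > 0 \<longrightarrow> N \<le> \<tau> \<longrightarrow> real N \<ge> real p powr (real m + \<epsilon>) \<longrightarrow>
           b \<in> Fp_vecs p m \<longrightarrow> (\<exists>i\<le>m. b i \<noteq> 0) \<longrightarrow>
           norm (\<Sum>n<N. e_mod p (\<Sum>i=0..m. b i * orbit p m F w0 n i))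
             \<le> C * real N * real p powr (- \<delta>)"
proof -
  define \<epsilon>' where "\<epsilon>' = min \<epsilon> 1"
  have e: "0 < \<epsilon>'" "\<epsilon>' \<le> 1" "\<epsilon>' \<le> \<epsilon>" using assms(3) by (auto simp: \<epsilon>'_def)
  obtain \<delta>1 C1 where d1: "\<delta>1 > 0" "C1 \<ge> (1::real)" and b1: "\<forall>(p::nat) S F w0 \<tau> (N::nat) b r.
     prime p \<longrightarrow> F \<in> poly_systems p S m \<longrightarrow> (\<forall>i<m. S i (i + 1) \<noteq> 0) \<longrightarrow> system_deg m F = ereal (real d) \<longrightarrow>
     w0 \<in> Fp_vecs p m \<longrightarrow> purely_periodic (orbit p m F w0) \<tau> \<longrightarrow> 0 < N \<longrightarrow> N \<le> \<tau> \<longrightarrow>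
     real N \<ge> real p powr (real m + \<epsilon>') \<longrightarrow> r < m \<longrightarrow> (\<forall>i<r. b i = 0) \<longrightarrow> \<not> int p dvd b r \<longrightarrow>
     norm (\<Sum>n<N. e_mod p (\<Sum>i=0..m. b i * orbit p m F w0 n i)) \<le> C1 * real N * real p powr (- \<delta>1)"
    using exp_sum_bound_nonlast_coordinate[OF assms(1) e(1,2), of d] by (elim exE conjE) (rule that)
  obtain \<delta>2 C2 where d2: "\<delta>2 > 0" "C2 \<ge> (1::real)" and b2: "\<forall>(p::nat) S F w0 \<tau> (N::nat) b.
     prime p \<longrightarrow> F \<in> poly_systems p S m \<longrightarrow>
     w0 \<in> Fp_vecs p m \<longrightarrow> purely_periodic (orbit p m F w0) \<tau> \<longrightarrow> N \<le> \<tau> \<longrightarrow>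
     real N \<ge> real p powr (real m + \<epsilon>') \<longrightarrow> (\<forall>i<m. b i = 0) \<longrightarrow> \<not> int p dvd b m \<longrightarrow>
     norm (\<Sum>n<N. e_mod p (\<Sum>i=0..m. b i * orbit p m F w0 n i)) \<le> C2 * real N * real p powr (- \<delta>2)"
    using exp_sum_bound_last_coordinate[OF assms(1) e(1)] by (elim exE conjE) (rule that)
  define \<delta> C where "\<delta> = min \<delta>1 \<delta>2" and "C = max C1 C2"
  have weaken: "x \<le> C * real N * real p powr (- \<delta>)"
    if x: "x \<le> C' * real N * real p powr (- \<delta>')" and C': "C' \<le> C" "0 \<le> C'" "\<delta> \<le> \<delta>'" and p: "prime p"
    for x C' \<delta>' and N p :: nat
  proof -
    have "real p \<ge> 1" using prime_ge_1_nat[OF p] by simp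
    then have "C' * real N * real p powr (- \<delta>') \<le> C * real N * real p powr (- \<delta>)"
      using C' by (intro mult_mono powr_mono) auto
    then show ?thesis using x by linarith
  qed
  have main: "norm (\<Sum>n<N. e_mod p (\<Sum>i=0..m. b i * orbit p m F w0 n i)) \<le> C * real N * real p powr (- \<delta>)"
    if p: "prime p" and S: "(\<Prod>i<m. S i (i + 1)) \<noteq> 0" and F: "F \<in> poly_systems p S m"
      and sd: "system_deg m F = ereal (real d)" and w0: "w0 \<in> Fp_vecs p m"
      and per: "purely_periodic (orbit p m F w0) \<tau>" and N: "N > 0" "N \<le> \<tau>"
      and big: "real N \<ge> real p powr (real m + \<epsilon>)" and b: "b \<in> Fp_vecs p m" "\<exists>i\<le>m. b i \<noteq> 0"
    for p S F w0 \<tau> N b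
  proof -
    have S': "\<forall>i<m. S i (i + 1) \<noteq> 0" using S by simp
    have "real p powr (real m + \<epsilon>') \<le> real p powr (real m + \<epsilon>)"
      using prime_ge_1_nat[OF p] e by (intro powr_mono) auto
    then have big': "real N \<ge> real p powr (real m + \<epsilon>')" using big by linarith
    define r where "r = (LEAST i. b i \<noteq> 0)"
    obtain i where i: "i \<le> m" "b i \<noteq> 0" using b by blast
    have r: "b r \<noteq> 0" "r \<le> m" using LeastI[of "\<lambda>i. b i \<noteq> 0" i] Least_le[of "\<lambda>i. b i \<noteq> 0" i] i by (auto simp: r_def)
    have below: "\<forall>i<r. b i = 0" using not_less_Least unfolding r_def by blast
    have "b r \<in> Fp p" using b(1) r(2) by (auto simp: Fp_vecs_def PiE_iff)
    then have br: "\<not> int p dvd b r" using r(1) by (rule Fp_nonzero_not_dvd)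
    show ?thesis
    proof (cases "r < m")
      case True
      have "norm (\<Sum>n<N. e_mod p (\<Sum>i=0..m. b i * orbit p m F w0 n i)) \<le> C1 * real N * real p powr (- \<delta>1)"
        by (rule b1[rule_format, where S = S and \<tau> = \<tau> and r = r])
          (use p F S' sd w0 per N big' True below br in auto)
      then show ?thesis by (rule weaken) (use d1 p in \<open>auto simp: C_def \<delta>_def\<close>)
    next
      case False
      then have "r = m" using r(2) by simp
      have "norm (\<Sum>n<N. e_mod p (\<Sum>i=0..m. b i * orbit p m F w0 n i)) \<le> C2 * real N * real p powr (- \<delta>2)"
        by (rule b2[rule_format, where S = S and \<tau> = \<tau>])
          (use p F w0 per N big' below br \<open>r = m\<close> in auto)
      then show ?thesis by (rule weaken) (use d2 p in \<open>auto simp: C_def \<delta>_def\<close>)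
    qed
  qed
  have "\<delta> > 0" "C > 0" using d1 d2 by (auto simp: \<delta>_def C_def)
  then show ?thesis
    by (intro exI[of _ \<delta>] exI[of _ C] conjI allI impI) (assumption | rule main; assumption)+
qed

end
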